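(* Let $P$ be a triangle with perimeter $L$ and let $\psi_P\colon[0,L]\to[0,L]$ be its slap map. Then $\psi_P$ has a unique ergodic acip. If $P$ is acute, then this acip is mixing and is supported on the whole interval $[0,L]$. If $P$ is not acute, then this acip has an even number of mixing components.
   Context: Slap map: let $P$ be a non-self-intersecting polygon with perimeter $L$, and let $s\in[0,L]$ be the arc length parameter of $\partial P$. For a point $s\in\partial P$ (not a vertex), let $\rho$ be the ray starting at $s$, directed inside $P$ and orthogonal to $\partial P$ at $s$, and let $s'$ be the point of $\rho\cap\partial P$, different from $s$, which is closest to $s$. The slap map of $P$ is the piecewise affine map $\psi_P\colon[0,L]\to[0,L]$, $s\mapsto s'$ (its values at the finitely many exceptional points are irrelevant). An acip of a map $f$ of an interval $I$ is an $f$-invariant Borel probability measure that is absolutely continuous with respect to Lebesgue measure on $I$. Mixing components: for a piecewise expanding map $f$ and an ergodic acip $\nu$ of $f$ with support $\Lambda$, there are an integer $k\ge 1$ and disjoint measurable sets $\Sigma_1,\dots,\Sigma_k$ with $\Lambda=\Sigma_1\cup\dots\cup\Sigma_k$ (up to null sets), cyclically permuted by $f$, such that $f^k|_{\Sigma_1}$ is exact with respect to the (normalized) restriction of $\nu$ to $\Sigma_1$. The sets $\Sigma_j$ are the mixing components of $\nu$, and $k$ is the mixing period (the number of mixing components). *)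

theory Defs
  imports "HOL-Probability.Probability"
begin

text \<open>
  A polygon is given by the cyclic list of its vertices. The definitions are meant for lists
  describing a non-self-intersecting polygon, for instance three non-collinear points. The arc
  length parameter has its origin at the first vertex and follows the order of the list.
\<close>

definition vertex :: "(real^2) list \<Rightarrow> nat \<Rightarrow> real^2" where
  "vertex vs i = vs ! (i mod length vs)"

definition arc_pos :: "(real^2) list \<Rightarrow> nat \<Rightarrow> real" where
  "arc_pos vs i = (\<Sum>j<i. dist (vertex vs j) (vertex vs (Suc j)))"

definition perimeter :: "(real^2) list \<Rightarrow> real" where
  "perimeter vs = arc_pos vs (length vs)"

definition polygon_boundary :: "(real^2) list \<Rightarrow> (real^2) set" where
  "polygon_boundary vs = (\<Union>i<length vs. closed_segment (vertex vs i) (vertex vs (Suc i)))"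

text \<open>The point of the boundary with arc length parameter \<open>s\<close>, for \<open>0 \<le> s \<le> perimeter vs\<close>.\<close>

definition boundary_point :: "(real^2) list \<Rightarrow> real \<Rightarrow> real^2" where
  "boundary_point vs s =
     (let i = (LEAST i. s \<le> arc_pos vs (Suc i))
      in vertex vs i + (s - arc_pos vs i) *\<^sub>R sgn (vertex vs (Suc i) - vertex vs i))"

text \<open>
  \<open>v\<close> is the direction of the ray starting at the point with parameter \<open>s\<close>, orthogonal to the
  edge that contains this point in its relative interior, and directed inside the polygon.
\<close>

definition inward_normal :: "(real^2) list \<Rightarrow> real \<Rightarrow> real^2 \<Rightarrow> bool" where
  "inward_normal vs s v \<longleftrightarrow>
     norm v = 1 \<and>
     (\<exists>i<length vs. arc_pos vs i < s \<and> s < arc_pos vs (Suc i) \<and>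
        orthogonal v (vertex vs (Suc i) - vertex vs i)) \<and>
     (\<exists>e>0. \<forall>t. 0 < t \<and> t < e \<longrightarrow>
        boundary_point vs s + t *\<^sub>R v \<in> inside (polygon_boundary vs))"

definition slap_point :: "(real^2) list \<Rightarrow> real \<Rightarrow> real^2 \<Rightarrow> bool" where
  "slap_point vs s y \<longleftrightarrow>
     (\<exists>v. inward_normal vs s v \<and>
        (let x = boundary_point vs s;
             R = {x + t *\<^sub>R v | t. 0 \<le> t} \<inter> polygon_boundary vs - {x}
         in y \<in> R \<and> (\<forall>z\<in>R. dist x y \<le> dist x z)))"

text \<open>
  The values of a slap map at the parameters of the vertices are arbitrary. The parameters \<open>0\<close>
  and \<open>perimeter vs\<close> describe the same vertex, and a slap map may take either value at a point
  that is sent to it. So a slap map is unique up to finitely many values.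
\<close>

definition slap_map :: "(real^2) list \<Rightarrow> (real \<Rightarrow> real) \<Rightarrow> bool" where
  "slap_map vs \<psi> \<longleftrightarrow>
     \<psi> \<in> {0..perimeter vs} \<rightarrow> {0..perimeter vs} \<and>
     (\<forall>s\<in>{0..perimeter vs} - arc_pos vs ` {..length vs}.
        slap_point vs s (boundary_point vs (\<psi> s)))"

definition angle_at :: "real^2 \<Rightarrow> real^2 \<Rightarrow> real^2 \<Rightarrow> real" where
  "angle_at A B C = arccos (((B - A) \<bullet> (C - A)) / (norm (B - A) * norm (C - A)))"

definition acute_triangle :: "real^2 \<Rightarrow> real^2 \<Rightarrow> real^2 \<Rightarrow> bool" where
  "acute_triangle A B C \<longleftrightarrow>
     angle_at A B C < pi / 2 \<and> angle_at B C A < pi / 2 \<and> angle_at C A B < pi / 2"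

definition invariant_under :: "('a \<Rightarrow> 'a) \<Rightarrow> 'a measure \<Rightarrow> bool" where
  "invariant_under f M \<longleftrightarrow> f \<in> measurable M M \<and> distr M M f = M"

definition acip :: "real set \<Rightarrow> (real \<Rightarrow> real) \<Rightarrow> real measure \<Rightarrow> bool" where
  "acip I f M \<longleftrightarrow>
     prob_space M \<and> sets M = sets (restrict_space borel I) \<and>
     absolutely_continuous (restrict_space lborel I) M \<and> invariant_under f M"

definition ergodic :: "('a \<Rightarrow> 'a) \<Rightarrow> 'a measure \<Rightarrow> bool" where
  "ergodic f M \<longleftrightarrow>
     invariant_under f M \<and>
     (\<forall>A\<in>sets M. f -` A \<inter> space M = A \<longrightarrow> measure M A = 0 \<or> measure M A = 1)"

definition mixing :: "('a \<Rightarrow> 'a) \<Rightarrow> 'a measure \<Rightarrow> bool" where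
  "mixing f M \<longleftrightarrow>
     invariant_under f M \<and>
     (\<forall>A\<in>sets M. \<forall>B\<in>sets M.
        (\<lambda>n. measure M ((f ^^ n) -` A \<inter> B)) \<longlonglongrightarrow> measure M A * measure M B)"

text \<open>
  Exactness: the tail sigma-algebra, that is the intersection over \<open>n\<close> of the sigma-algebras
  of preimages under \<open>f ^^ n\<close>, is trivial.
\<close>

definition exact :: "('a \<Rightarrow> 'a) \<Rightarrow> 'a measure \<Rightarrow> bool" where
  "exact f M \<longleftrightarrow>
     invariant_under f M \<and>
     (\<forall>A. (\<forall>n. \<exists>B\<in>sets M. A = (f ^^ n) -` B \<inter> space M) \<longrightarrow>
        measure M A = 0 \<or> measure M A = 1)"

text \<open>The topological support, relative to the space of the measure.\<close>

definition measure_support :: "'a::topological_space measure \<Rightarrow> 'a set" where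
  "measure_support M =
     {x \<in> space M. \<forall>U. open U \<and> x \<in> U \<longrightarrow> emeasure M (U \<inter> space M) > 0}"

text \<open>
  The sets \<open>\<Sigma> 0, \<dots>, \<Sigma> (k - 1)\<close> are the mixing components. Their union is the support, and they
  are permuted by \<open>f\<close>, up to null sets of \<open>M\<close>. The normalized restriction of \<open>M\<close> to \<open>\<Sigma> 0\<close> is
  \<open>uniform_measure M (\<Sigma> 0)\<close>; it lives on the whole space of \<open>M\<close> and vanishes outside \<open>\<Sigma> 0\<close>, so
  its exactness does not depend on the behaviour of \<open>f ^^ k\<close> outside \<open>\<Sigma> 0\<close>.
\<close>

definition mixing_components ::
  "('a::topological_space \<Rightarrow> 'a) \<Rightarrow> 'a measure \<Rightarrow> nat \<Rightarrow> (nat \<Rightarrow> 'a set) \<Rightarrow> bool" where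
  "mixing_components f M k \<Sigma> \<longleftrightarrow>
     k \<ge> 1 \<and>
     (\<forall>j<k. \<Sigma> j \<in> sets M) \<and>
     disjoint_family_on \<Sigma> {..<k} \<and>
     (AE x in M. x \<in> measure_support M \<longleftrightarrow> x \<in> (\<Union>j<k. \<Sigma> j)) \<and>
     (\<forall>j<k. AE x in M. x \<in> \<Sigma> j \<longleftrightarrow> f x \<in> \<Sigma> (Suc j mod k)) \<and>
     exact (f ^^ k) (uniform_measure M (\<Sigma> 0))"

end

theory Submission
  imports Defs
begin

text \<open>
  The slap map of a triangle is piecewise affine, with slopes \<open>- 1 / cos \<alpha>\<close> for the angles \<open>\<alpha>\<close>, so it
  is expanding. A Lasota--Yorke inequality for step densities bounds the iterated images of
  Lebesgue measure, which gives an acip as a cluster point of averages, and shows that the images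
  of every set of positive measure reach a fixed size. So a tail set has measure zero or at least
  some \<open>\<eta> > 0\<close>: the tail algebra is finite, and its atoms are the mixing components.

  If the angle at one vertex is not acute, then the only cut inside a side is the foot of the
  altitude from that vertex. Every interval grows until it contains this point, hence Lebesgue
  measure is ergodic and the acip is unique. The opposite side is interchanged with the union of the
  other two sides, hence the period is even.

  If the triangle is acute, then every branch maps onto a full side. The density that equals
  the side length on each side is invariant, and mixing reduces to the convergence of a Markov
  chain on the three sides.
\<close>

section \<open>Invariant measures of nonsingular maps\<close>

text \<open>A normal ray projects a side onto a side that makes an acute angle \<alpha> with it,
  which stretches lengths by 1 / cos \<alpha>. The slopes exceed 1 but may be close to it, so the
  estimates are made for an iterate whose slopes are above 4. The jumps of \<psi> are an obstacle to
  existence: a weak limit of averaged images of Lebesgue measure need not be invariant. The limit is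
  therefore taken set by set, and a uniform bound by a multiple of Lebesgue measure restores
  countable additivity. In the non-acute case no invariant density is written down and its zero set
  is unknown. So ergodicity is proved for Lebesgue measure itself, which yields ergodicity and
  uniqueness of acips at once, and the mixing components are found abstractly. Growth is formulated
  for a set \<open>A\<close> and arbitrary sets \<open>E n\<close> that contain the image of
  \<open>A\<close> under \<open>f ^^ n\<close>: with \<open>E n = A\<close> it speaks of invariant
  sets, and with the sets from the definition of the tail algebra it speaks of tail sets.\<close>

lemma measurable_funpow:
  assumes "f \<in> measurable M M"
  shows "f ^^ n \<in> measurable M M"
  by (induction n) (use assms in \<open>auto simp: id_def intro!: measurable_comp[of _ M M]\<close>)

text \<open>The averages of the images of \<open>m\<close> are points of a product of compact
  intervals with one factor for every set, so they have a cluster point. Pointwise limits keep the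
  bound, finite additivity and the total mass. Countable additivity can be lost in such a limit and
  is recovered afterwards from the bound by \<open>K * measure m E\<close>.\<close>

lemma invariant_cluster_point:
  fixes m :: "'a measure" and f :: "'a \<Rightarrow> 'a" and K :: real
  assumes fin: "finite_measure m" and f: "f \<in> measurable m m"
    and K: "\<And>n E. E \<in> sets m \<Longrightarrow> measure m ((f ^^ n) -` E \<inter> space m) \<le> K * measure m E"
  obtains \<nu> :: "'a set \<Rightarrow> real" where
    "\<And>E. 0 \<le> \<nu> E"
    "\<And>E. E \<in> sets m \<Longrightarrow> \<nu> E \<le> K * measure m E"
    "\<And>A B. \<lbrakk>A \<in> sets m; B \<in> sets m; A \<inter> B = {}\<rbrakk> \<Longrightarrow> \<nu> (A \<union> B) = \<nu> A + \<nu> B"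
    "\<And>E. E \<in> sets m \<Longrightarrow> \<nu> (f -` E \<inter> space m) = \<nu> E"
    "\<nu> (space m) = measure m (space m)"
proof -
  interpret finite_measure m by fact
  have fn: "f ^^ n \<in> measurable m m" for n by (rule measurable_funpow[OF f])
  define b where "b k E = measure m ((f ^^ k) -` E \<inter> space m)" for k E
  define c where "c n E = (\<Sum>k<Suc n. b k E) / real (Suc n)" for n E
  define S :: "('a set \<Rightarrow> real) set" where "S = PiE UNIV (\<lambda>_. {0..measure m (space m)})"
  have b_nonneg: "0 \<le> b k E" and b_le: "b k E \<le> measure m (space m)" for k E
    by (auto simp: b_def bounded_measure)
  have c_in: "c n \<in> S" for n
  proof -
    have "0 \<le> c n E" for E unfolding c_def by (intro divide_nonneg_nonneg sum_nonneg) (auto simp: b_nonneg)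
    moreover have "c n E \<le> measure m (space m)" for E
    proof -
      have "(\<Sum>k<Suc n. b k E) \<le> of_nat (card {..<Suc n}) * measure m (space m)"
        by (rule sum_bounded_above) (rule b_le)
      thus ?thesis unfolding c_def by (simp add: field_simps del: sum.lessThan_Suc)
    qed
    ultimately show ?thesis by (auto simp: S_def PiE_def extensional_def)
  qed
  have "compactin (product_topology (\<lambda>_. euclidean) UNIV) S"
    unfolding S_def compactin_PiE by (simp add: compactin_euclidean_iff)
  hence "compact S" by (simp add: euclidean_product_topology compactin_euclidean_iff)
  define G where "G = filtermap c sequentially"
  have "G \<noteq> bot" by (simp add: G_def filtermap_bot_iff)
  moreover have "eventually (\<lambda>x. x \<in> S) G" by (simp add: G_def eventually_filtermap c_in)
  ultimately obtain \<nu> where nu: "\<nu> \<in> S" "inf (nhds \<nu>) G \<noteq> bot"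
    using \<open>compact S\<close> unfolding compact_filter by blast
  \<comment> \<open>The product may have uncountably many factors, so a convergent subsequence is
    not at hand; limits are taken along a filter finer than both the neighbourhoods of
    \<open>\<nu>\<close> and the tails of the averages.\<close>
  define F where "F = inf (nhds \<nu>) G"
  have F: "F \<noteq> bot" "F \<le> nhds \<nu>" "F \<le> G" using nu(2) by (auto simp: F_def)
  have lim: "((\<lambda>g. g E) \<longlongrightarrow> \<nu> E) F" for E
  proof (rule tendsto_mono[OF F(2)], rule topological_tendstoI)
    fix U :: "real set" assume "open U" "\<nu> E \<in> U"
    have "open ((\<lambda>g::'a set \<Rightarrow> real. g E) -` U)"
      by (rule open_vimage[OF \<open>open U\<close>]) simp
    thus "eventually (\<lambda>g. g E \<in> U) (nhds \<nu>)"
      using \<open>\<nu> E \<in> U\<close> by (auto simp: eventually_nhds)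
  qed
  have ev: "eventually P F" if "\<And>n. P (c n)" for P
    using that F(3) by (auto simp: G_def eventually_filtermap le_filter_def)
  have seq: "(\<phi> \<longlongrightarrow> l) F" if "(\<lambda>n. \<phi> (c n)) \<longlonglongrightarrow> l" for \<phi> :: "('a set \<Rightarrow> real) \<Rightarrow> real" and l
    using that by (intro tendsto_mono[OF F(3)]) (simp add: G_def filterlim_filtermap)
  show ?thesis
  proof
    show "0 \<le> \<nu> E" for E using nu(1) by (auto simp: S_def PiE_def Pi_def)
    fix E assume E: "E \<in> sets m"
    have "c n E \<le> K * measure m E" for n
    proof -
      have "(\<Sum>k<Suc n. b k E) \<le> of_nat (card {..<Suc n}) * (K * measure m E)"
        by (rule sum_bounded_above) (use K[OF E] in \<open>simp add: b_def\<close>)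
      thus ?thesis unfolding c_def by (simp add: field_simps del: sum.lessThan_Suc)
    qed
    thus "\<nu> E \<le> K * measure m E"
      by (intro tendsto_upperbound[OF lim ev F(1)])
  next
    fix A B assume AB: "A \<in> sets m" "B \<in> sets m" "A \<inter> B = {}"
    have "b k (A \<union> B) = b k A + b k B" for k
    proof -
      have "(f ^^ k) -` (A \<union> B) \<inter> space m = ((f ^^ k) -` A \<inter> space m) \<union> ((f ^^ k) -` B \<inter> space m)"
        by auto
      thus ?thesis unfolding b_def
        using AB measurable_sets[OF fn] by (simp add: finite_measure_Union disjoint_iff)
    qed
    hence "c n (A \<union> B) = c n A + c n B" for n
      by (simp add: c_def sum.distrib add_divide_distrib del: sum.lessThan_Suc)
    hence "((\<lambda>g. g (A \<union> B)) \<longlongrightarrow> \<nu> A + \<nu> B) F"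
      by (intro Lim_transform_eventually[OF tendsto_add[OF lim lim]] ev) simp
    thus "\<nu> (A \<union> B) = \<nu> A + \<nu> B" using lim F(1) tendsto_unique by blast
  next
    fix E assume E: "E \<in> sets m"
    define E' where "E' = f -` E \<inter> space m"
    have b_Suc: "b k E' = b (Suc k) E" for k
    proof -
      have "(f ^^ k) -` E' \<inter> space m = (f ^^ Suc k) -` E \<inter> space m"
        unfolding E'_def using measurable_space[OF fn] by auto
      thus ?thesis by (simp add: b_def)
    qed
    \<comment> \<open>The sums telescope, so invariance of the n-th average fails only by two
      boundary terms divided by \<open>Suc n\<close>.\<close>
    have "c n E' - c n E = (b (Suc n) E - b 0 E) / real (Suc n)" for n
    proof -
      have "(\<Sum>k<Suc n. b k E') - (\<Sum>k<Suc n. b k E) = b (Suc n) E - b 0 E"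
        unfolding b_Suc sum_subtractf[symmetric] by (rule sum_lessThan_telescope)
      thus ?thesis unfolding c_def diff_divide_distrib[symmetric] by simp
    qed
    moreover have "(\<lambda>n. (b (Suc n) E - b 0 E) / real (Suc n)) \<longlonglongrightarrow> 0"
    proof (rule Lim_null_comparison)
      show "\<forall>\<^sub>F n in sequentially. norm ((b (Suc n) E - b 0 E) / real (Suc n)) \<le> measure m (space m) * inverse (real (Suc n))"
      proof (intro always_eventually allI)
        fix n
        have "\<bar>b (Suc n) E - b 0 E\<bar> \<le> measure m (space m)"
          using b_nonneg[of "Suc n" E] b_nonneg[of 0 E] b_le[of "Suc n" E] b_le[of 0 E] by linarith
        thus "norm ((b (Suc n) E - b 0 E) / real (Suc n)) \<le> measure m (space m) * inverse (real (Suc n))"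
          by (simp add: divide_inverse abs_mult mult_right_mono)
      qed
      show "(\<lambda>n. measure m (space m) * inverse (real (Suc n))) \<longlonglongrightarrow> 0"
        using tendsto_mult_right_zero[OF LIMSEQ_inverse_real_of_nat] .
    qed
    ultimately have "((\<lambda>g. g E' - g E) \<longlongrightarrow> 0) F" by (intro seq) simp
    moreover have "((\<lambda>g. g E' - g E) \<longlongrightarrow> \<nu> E' - \<nu> E) F" by (intro tendsto_diff lim)
    ultimately have "\<nu> E' - \<nu> E = 0" using F(1) tendsto_unique by blast
    thus "\<nu> (f -` E \<inter> space m) = \<nu> E" by (simp add: E'_def)
  next
    have "(f ^^ k) -` space m \<inter> space m = space m" for k
      using measurable_space[OF fn] by auto
    hence "c n (space m) = measure m (space m)" for n
      by (simp add: c_def b_def del: sum.lessThan_Suc)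
    hence "((\<lambda>g. g (space m)) \<longlongrightarrow> measure m (space m)) F" by (intro seq) simp
    thus "\<nu> (space m) = measure m (space m)" using lim F(1) tendsto_unique by blast
  qed
qed

lemma ex_acip_of_bounded_pushforward:
  fixes m :: "'a measure" and f :: "'a \<Rightarrow> 'a" and K :: real
  assumes fin: "finite_measure m" and f: "f \<in> measurable m m"
    and pos: "measure m (space m) > 0"
    and K: "\<And>n E. E \<in> sets m \<Longrightarrow> measure m ((f ^^ n) -` E \<inter> space m) \<le> K * measure m E"
  shows "\<exists>\<mu>. prob_space \<mu> \<and> sets \<mu> = sets m \<and> absolutely_continuous m \<mu> \<and> invariant_under f \<mu>"
proof -
  interpret finite_measure m by fact
  obtain \<nu> :: "'a set \<Rightarrow> real" where nu: "\<And>E. 0 \<le> \<nu> E"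
    "\<And>E. E \<in> sets m \<Longrightarrow> \<nu> E \<le> K * measure m E"
    "\<And>A B. \<lbrakk>A \<in> sets m; B \<in> sets m; A \<inter> B = {}\<rbrakk> \<Longrightarrow> \<nu> (A \<union> B) = \<nu> A + \<nu> B"
    "\<And>E. E \<in> sets m \<Longrightarrow> \<nu> (f -` E \<inter> space m) = \<nu> E"
    "\<nu> (space m) = measure m (space m)"
    using invariant_cluster_point[OF fin f K] by blast
  define p where "p E = ennreal (\<nu> E / measure m (space m))" for E
  define \<mu> where "\<mu> = measure_of (space m) (sets m) p"
  have nu0: "\<nu> {} = 0" using nu(1)[of "{}"] nu(2)[of "{}"] by simp
  have pa: "positive (sets m) p" by (simp add: positive_def p_def nu0)
  have aa: "additive (sets m) p"
    unfolding additive_def p_def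
    by (auto simp: nu(1,3) ennreal_plus[symmetric] add_divide_distrib simp del: ennreal_plus)
  have ca: "countably_additive (sets m) p"
  proof (rule sets.empty_continuous_imp_countably_additive[OF pa aa])
    show "\<forall>A\<in>sets m. p A \<noteq> \<infinity>" by (simp add: p_def)
    \<comment> \<open>For sets decreasing to the empty set the domination by
      \<open>K * measure m\<close> forces \<open>\<nu>\<close> to 0; for a finite additive set
      function this is countable additivity.\<close>
    fix A :: "nat \<Rightarrow> 'a set" assume A: "range A \<subseteq> sets m" "decseq A" "(\<Inter>i. A i) = {}"
    have "(\<lambda>i. measure m (A i)) \<longlonglongrightarrow> measure m (\<Inter>i. A i)"
      by (rule finite_Lim_measure_decseq) (use A in auto)
    hence "(\<lambda>i. K * measure m (A i)) \<longlonglongrightarrow> K * 0"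
      unfolding A(3) by (intro tendsto_mult_left) simp
    hence "(\<lambda>i. \<nu> (A i)) \<longlonglongrightarrow> 0"
      using A(1) nu(1,2) by (intro tendsto_sandwich[of "\<lambda>_. 0" "\<lambda>i. \<nu> (A i)" _ "\<lambda>i. K * measure m (A i)"]) auto
    hence "(\<lambda>i. ennreal (\<nu> (A i) / measure m (space m))) \<longlonglongrightarrow> ennreal (0 / measure m (space m))"
      using pos by (intro tendsto_ennrealI tendsto_divide) auto
    thus "(\<lambda>i. p (A i)) \<longlonglongrightarrow> 0" by (simp add: p_def)
  qed
  have em: "emeasure \<mu> E = p E" if "E \<in> sets m" for E
    by (rule emeasure_measure_of[OF \<mu>_def])
      (use that pa ca sets.space_closed[of m] in \<open>simp_all add: \<mu>_def\<close>)
  have sets: "sets \<mu> = sets m" and sp: "space \<mu> = space m"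
    by (simp_all add: \<mu>_def)
  have "prob_space \<mu>"
    by (rule prob_spaceI) (use pos in \<open>simp add: sp em p_def nu(5)\<close>)
  moreover have "absolutely_continuous m \<mu>"
    unfolding absolutely_continuous_def
  proof
    fix N assume N: "N \<in> null_sets m"
    hence "\<nu> N \<le> 0" using nu(2)[of N] by (auto simp: null_sets_def measure_def)
    hence "\<nu> N = 0" using nu(1)[of N] by simp
    thus "N \<in> null_sets \<mu>" using N by (auto simp: null_sets_def sets em p_def)
  qed
  moreover have "invariant_under f \<mu>"
  proof -
    have fm: "f \<in> measurable \<mu> \<mu>" using f measurable_cong_sets[OF sets sets] by simp
    have "distr \<mu> \<mu> f = \<mu>"
    proof (rule measure_eqI)
      fix A assume "A \<in> sets (distr \<mu> \<mu> f)"
      hence "A \<in> sets m" by (simp add: sets)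
      thus "emeasure (distr \<mu> \<mu> f) A = emeasure \<mu> A"
        using f by (simp add: emeasure_distr[OF fm] sets sp em p_def nu(4) measurable_sets)
    qed simp
    thus ?thesis using fm by (simp add: invariant_under_def)
  qed
  ultimately show ?thesis using sets by blast
qed

section \<open>Almost everywhere invariant sets, and uniqueness from ergodicity\<close>

lemma AE_funpow:
  assumes inv: "invariant_under f \<mu>" and P: "AE x in \<mu>. P x"
  shows "AE x in \<mu>. P ((f ^^ n) x)"
proof (induction n)
  case 0
  then show ?case using P by simp
next
  case (Suc n)
  have f: "f \<in> measurable \<mu> \<mu>" and d: "distr \<mu> \<mu> f = \<mu>" using inv by (auto simp: invariant_under_def)
  have "AE x in distr \<mu> \<mu> f. P ((f ^^ n) x)" using Suc by (simp only: d)
  hence "AE x in \<mu>. P ((f ^^ n) (f x))" by (rule AE_distrD[OF f])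
  thus ?case by (simp add: funpow_swap1)
qed

lemma measure_funpow_vimage:
  assumes inv: "invariant_under f \<mu>" and A: "A \<in> sets \<mu>"
  shows "measure \<mu> ((f ^^ n) -` A \<inter> space \<mu>) = measure \<mu> A"
proof (induction n)
  case 0
  then show ?case using sets.sets_into_space[OF A] by (simp add: Int_absorb2)
next
  case (Suc n)
  have f: "f \<in> measurable \<mu> \<mu>" and d: "distr \<mu> \<mu> f = \<mu>" using inv by (auto simp: invariant_under_def)
  define B where "B = (f ^^ n) -` A \<inter> space \<mu>"
  have B: "B \<in> sets \<mu>" unfolding B_def using measurable_funpow[OF f] A by (rule measurable_sets)
  have "(f ^^ Suc n) -` A \<inter> space \<mu> = f -` B \<inter> space \<mu>"
    using measurable_space[OF f] by (auto simp: B_def funpow_swap1)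
  also have "measure \<mu> \<dots> = measure (distr \<mu> \<mu> f) B"
    using measure_distr[OF f, of B] B by simp
  finally have "measure \<mu> ((f ^^ Suc n) -` A \<inter> space \<mu>) = measure \<mu> B" by (simp only: d)
  also have "\<dots> = measure \<mu> A" unfolding B_def by (rule Suc)
  finally show ?case .
qed

text \<open>A set that is invariant almost everywhere agrees with the set of those points whose orbit is
  eventually in it; the latter is invariant everywhere, for every measure at once.\<close>

definition eventually_in :: "('a \<Rightarrow> 'a) \<Rightarrow> 'a set \<Rightarrow> 'a set \<Rightarrow> 'a set" where
  "eventually_in f X D = {x \<in> X. \<exists>N. \<forall>n\<ge>N. (f ^^ n) x \<in> D}"

lemma eventually_in_sets:
  assumes "f \<in> measurable M M" "D \<in> sets M"
  shows "eventually_in f (space M) D \<in> sets M"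
proof -
  have [measurable]: "f ^^ n \<in> measurable M M" for n by (rule measurable_funpow[OF assms(1)])
  have [measurable]: "D \<in> sets M" by fact
  show ?thesis unfolding eventually_in_def by measurable
qed

lemma vimage_eventually_in:
  assumes "f \<in> X \<rightarrow> X"
  shows "f -` eventually_in f X D \<inter> X = eventually_in f X D"
proof -
  have "(\<exists>N. \<forall>n\<ge>N. (f ^^ n) (f x) \<in> D) \<longleftrightarrow> (\<exists>N. \<forall>n\<ge>N. (f ^^ n) x \<in> D)" for x
  proof
    assume "\<exists>N. \<forall>n\<ge>N. (f ^^ n) (f x) \<in> D"
    then obtain N where N: "\<And>n. n \<ge> N \<Longrightarrow> (f ^^ n) (f x) \<in> D" by blast
    have "(f ^^ n) x \<in> D" if "n \<ge> Suc N" for n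
      using N[of "n - 1"] that by (cases n) (auto simp: funpow_swap1)
    thus "\<exists>N. \<forall>n\<ge>N. (f ^^ n) x \<in> D" by blast
  next
    assume "\<exists>N. \<forall>n\<ge>N. (f ^^ n) x \<in> D"
    then obtain N where N: "\<And>n. n \<ge> N \<Longrightarrow> (f ^^ n) x \<in> D" by blast
    have "(f ^^ n) (f x) \<in> D" if "n \<ge> N" for n
      using N[of "Suc n"] that by (auto simp: funpow_swap1)
    thus "\<exists>N. \<forall>n\<ge>N. (f ^^ n) (f x) \<in> D" by blast
  qed
  thus ?thesis using assms by (auto simp: eventually_in_def)
qed

lemma AE_eventually_in:
  assumes inv: "invariant_under f \<mu>" and D: "AE x in \<mu>. x \<in> D \<longleftrightarrow> f x \<in> D"
  shows "AE x in \<mu>. x \<in> eventually_in f (space \<mu>) D \<longleftrightarrow> x \<in> D"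
proof -
  have "AE x in \<mu>. \<forall>n. (f ^^ n) x \<in> D \<longleftrightarrow> f ((f ^^ n) x) \<in> D"
    unfolding AE_all_countable using AE_funpow[OF inv D] by blast
  thus ?thesis
  proof (rule AE_mp, intro AE_I2 impI)
    fix x assume x: "x \<in> space \<mu>" "\<forall>n. (f ^^ n) x \<in> D \<longleftrightarrow> f ((f ^^ n) x) \<in> D"
    have "(f ^^ n) x \<in> D \<longleftrightarrow> x \<in> D" for n
      by (induction n) (use x(2) in auto)
    thus "x \<in> eventually_in f (space \<mu>) D \<longleftrightarrow> x \<in> D"
      using x(1) by (auto simp: eventually_in_def)
  qed
qed

lemma ergodic_AE_invariant:
  assumes erg: "ergodic f \<mu>" and D: "D \<in> sets \<mu>" "AE x in \<mu>. x \<in> D \<longleftrightarrow> f x \<in> D"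
  shows "measure \<mu> D = 0 \<or> measure \<mu> D = 1"
proof -
  have inv: "invariant_under f \<mu>" using erg by (simp add: ergodic_def)
  hence f: "f \<in> measurable \<mu> \<mu>" by (simp add: invariant_under_def)
  define E where "E = eventually_in f (space \<mu>) D"
  have E: "E \<in> sets \<mu>" unfolding E_def using f D(1) by (rule eventually_in_sets)
  have "f -` E \<inter> space \<mu> = E"
    unfolding E_def by (rule vimage_eventually_in) (use measurable_space[OF f] in auto)
  hence "measure \<mu> E = 0 \<or> measure \<mu> E = 1" using erg E by (auto simp: ergodic_def)
  moreover have "measure \<mu> E = measure \<mu> D"
    by (rule measure_eq_AE) (use AE_eventually_in[OF inv D(2)] E D(1) in \<open>auto simp: E_def\<close>)
  ultimately show ?thesis by simp
qed

text \<open>Let \<open>D\<close> be the set where the density of \<mu> exceeds that of \<nu>. Each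
  of the two measures gives \<open>D\<close> and its preimage \<open>D'\<close> the same mass, so
  the difference \<mu> - \<nu> has the same value on \<open>D - D'\<close> and on
  \<open>D' - D\<close>; the first value is nonnegative and the second nonpositive, so both vanish.
  Hence \<open>D\<close> is invariant almost everywhere, ergodicity of \<open>m\<close> gives it the
  same mass under \<mu> and \<nu>, so \<open>D\<close> is null, and two comparable probability
  measures are equal.\<close>

lemma acip_unique_of_nonsingular_ergodic:
  fixes m :: "'a measure"
  assumes fin: "finite_measure m"
    and erg: "\<And>A. \<lbrakk>A \<in> sets m; f -` A \<inter> space m = A\<rbrakk> \<Longrightarrow> measure m A = 0 \<or> measure m (space m - A) = 0"
    and \<mu>: "prob_space \<mu>" "sets \<mu> = sets m" "absolutely_continuous m \<mu>" "invariant_under f \<mu>"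
    and \<nu>: "prob_space \<nu>" "sets \<nu> = sets m" "absolutely_continuous m \<nu>" "invariant_under f \<nu>"
  shows "\<mu> = \<nu>"
proof -
  interpret finite_measure m by fact
  interpret M: prob_space \<mu> by fact
  interpret N: prob_space \<nu> by fact
  have spm: "space \<mu> = space m" and spn: "space \<nu> = space m"
    using sets_eq_imp_space_eq[OF \<mu>(2)] sets_eq_imp_space_eq[OF \<nu>(2)] by auto
  have f: "f \<in> measurable m m"
    using \<mu>(4) measurable_cong_sets[OF \<mu>(2) \<mu>(2)] by (simp add: invariant_under_def)
  define \<phi> where "\<phi> = RN_deriv m \<mu>"
  define \<psi> where "\<psi> = RN_deriv m \<nu>"
  have [measurable]: "\<phi> \<in> borel_measurable m" "\<psi> \<in> borel_measurable m" by (auto simp: \<phi>_def \<psi>_def)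
  have dm: "density m \<phi> = \<mu>" unfolding \<phi>_def by (rule density_RN_deriv[OF \<mu>(3,2)])
  have dn: "density m \<psi> = \<nu>" unfolding \<psi>_def by (rule density_RN_deriv[OF \<nu>(3,2)])
  have em: "emeasure \<mu> E = (\<integral>\<^sup>+x. \<phi> x * indicator E x \<partial>m)" if "E \<in> sets m" for E
    using that by (subst dm[symmetric]) (simp add: emeasure_density)
  have en: "emeasure \<nu> E = (\<integral>\<^sup>+x. \<psi> x * indicator E x \<partial>m)" if "E \<in> sets m" for E
    using that by (subst dn[symmetric]) (simp add: emeasure_density)
  define D where "D = {x \<in> space m. \<psi> x < \<phi> x}"
  have D[measurable]: "D \<in> sets m" unfolding D_def by measurable
  \<comment> \<open>On a subset of \<open>D\<close> the difference of the densities is strictly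
    positive, so equal integrals leave only a null set.\<close>
  have null: "measure m E = 0" if E: "E \<in> sets m" "E \<subseteq> D" "emeasure \<mu> E = emeasure \<nu> E" for E
  proof -
    note [measurable] = E(1)
    have fin': "emeasure \<nu> E \<noteq> \<infinity>" by simp
    have "(\<integral>\<^sup>+x. (\<phi> x * indicator E x - \<psi> x * indicator E x) \<partial>m) =
        (\<integral>\<^sup>+x. \<phi> x * indicator E x \<partial>m) - (\<integral>\<^sup>+x. \<psi> x * indicator E x \<partial>m)"
    proof (rule nn_integral_diff)
      show "(\<integral>\<^sup>+x. \<psi> x * indicator E x \<partial>m) \<noteq> \<infinity>" using fin' en[OF E(1)] by simp
      show "AE x in m. \<psi> x * indicator E x \<le> \<phi> x * indicator E x"
        using E(2) by (intro AE_I2) (auto simp: D_def indicator_def)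
    qed measurable
    also have "\<dots> = 0" using E(3) fin' by (simp add: em[OF E(1), symmetric] en[OF E(1), symmetric])
    finally have "AE x in m. \<phi> x * indicator E x - \<psi> x * indicator E x = 0"
      by (subst (asm) nn_integral_0_iff_AE) auto
    hence "AE x in m. x \<notin> E"
    proof (rule AE_mp, intro AE_I2 impI notI)
      fix x assume "\<phi> x * indicator E x - \<psi> x * indicator E x = 0" "x \<in> E"
      hence "\<phi> x - \<psi> x = 0" "\<psi> x < \<phi> x" using E(2) by (auto simp: D_def)
      thus False by (auto simp: diff_eq_0_iff_ennreal)
    qed
    moreover have "{x \<in> space m. \<not> x \<notin> E} = E" using sets.sets_into_space[OF E(1)] by auto
    ultimately show ?thesis using AE_iff_measurable[OF E(1)] by (auto simp: measure_def)
  qed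
  have le1: "emeasure \<nu> E \<le> emeasure \<mu> E" if "E \<in> sets m" "E \<subseteq> D" for E
    unfolding em[OF that(1)] en[OF that(1)]
    by (rule nn_integral_mono) (use that(2) in \<open>auto simp: D_def indicator_def intro: less_imp_le\<close>)
  have le2: "emeasure \<mu> E \<le> emeasure \<nu> E" if "E \<in> sets m" "E \<inter> D = {}" for E
    unfolding em[OF that(1)] en[OF that(1)]
    by (rule nn_integral_mono) (use that(2) in \<open>force simp: D_def indicator_def not_less\<close>)
  define D' where "D' = f -` D \<inter> space m"
  have D'[measurable]: "D' \<in> sets m" unfolding D'_def using f D by (rule measurable_sets)
  have mD: "measure \<mu> D' = measure \<mu> D" "measure \<nu> D' = measure \<nu> D"
    using measure_funpow_vimage[OF \<mu>(4), of D 1] measure_funpow_vimage[OF \<nu>(4), of D 1] D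
    by (auto simp: D'_def spm spn \<mu>(2) \<nu>(2))
  have split: "measure \<mu> (D - D') = measure \<mu> (D' - D)" "measure \<nu> (D - D') = measure \<nu> (D' - D)"
  proof -
    have "measure \<mu> (D - D') = measure \<mu> D - measure \<mu> (D \<inter> D')"
         "measure \<mu> (D' - D) = measure \<mu> D' - measure \<mu> (D' \<inter> D)"
      using M.finite_measure_Diff' \<mu>(2) D D' by auto
    thus "measure \<mu> (D - D') = measure \<mu> (D' - D)" using mD by (simp add: Int_commute)
    have "measure \<nu> (D - D') = measure \<nu> D - measure \<nu> (D \<inter> D')"
         "measure \<nu> (D' - D) = measure \<nu> D' - measure \<nu> (D' \<inter> D)"
      using N.finite_measure_Diff' \<nu>(2) D D' by auto
    thus "measure \<nu> (D - D') = measure \<nu> (D' - D)" using mD by (simp add: Int_commute)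
  qed
  have "measure \<nu> (D - D') \<le> measure \<mu> (D - D')"
    using le1[of "D - D'"] by (simp add: M.emeasure_eq_measure N.emeasure_eq_measure)
  moreover have "measure \<mu> (D' - D) \<le> measure \<nu> (D' - D)"
    using le2[of "D' - D"] by (simp add: Int_commute M.emeasure_eq_measure N.emeasure_eq_measure)
  ultimately have "emeasure \<mu> (D - D') = emeasure \<nu> (D - D')"
    using split by (simp add: M.emeasure_eq_measure N.emeasure_eq_measure)
  hence m0: "measure m (D - D') = 0" by (intro null) auto
  hence "D - D' \<in> null_sets m" by (auto simp: null_sets_def emeasure_eq_measure)
  hence "D - D' \<in> null_sets \<mu>" "D - D' \<in> null_sets \<nu>"
    using \<mu>(3) \<nu>(3) by (auto simp: absolutely_continuous_def)
  hence z1: "measure \<mu> (D - D') = 0" "measure \<nu> (D - D') = 0" by (auto simp: null_sets_def measure_def)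
  \<comment> \<open>\<open>D' - D\<close> may have positive measure under \<open>m\<close>; it is
    enough that both invariant measures ignore it.\<close>
  hence z2: "measure \<mu> (D' - D) = 0" "measure \<nu> (D' - D) = 0" using split by auto
  have AEm: "AE x in \<mu>. x \<in> D \<longleftrightarrow> f x \<in> D"
  proof (rule AE_I[where N = "(D - D') \<union> (D' - D)"])
    show "{x \<in> space \<mu>. \<not> (x \<in> D \<longleftrightarrow> f x \<in> D)} \<subseteq> (D - D') \<union> (D' - D)" by (auto simp: D'_def spm)
    show "emeasure \<mu> ((D - D') \<union> (D' - D)) = 0"
      using z1 z2 \<mu>(2) Diff_triv[of "D' - D" "D - D'"] by (simp add: M.emeasure_eq_measure M.finite_measure_Union' disjoint_iff)
  qed (use \<mu>(2) in auto)
  have AEn: "AE x in \<nu>. x \<in> D \<longleftrightarrow> f x \<in> D"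
  proof (rule AE_I[where N = "(D - D') \<union> (D' - D)"])
    show "{x \<in> space \<nu>. \<not> (x \<in> D \<longleftrightarrow> f x \<in> D)} \<subseteq> (D - D') \<union> (D' - D)" by (auto simp: D'_def spn)
    show "emeasure \<nu> ((D - D') \<union> (D' - D)) = 0"
      using z1 z2 \<nu>(2) Diff_triv[of "D' - D" "D - D'"] by (simp add: N.emeasure_eq_measure N.finite_measure_Union' disjoint_iff)
  qed (use \<nu>(2) in auto)
  \<comment> \<open>\<open>D\<close> is invariant only up to null sets, while the hypothesis on
    \<open>m\<close> speaks of exactly invariant sets.\<close>
  define E where "E = eventually_in f (space m) D"
  have E[measurable]: "E \<in> sets m" unfolding E_def using f D by (rule eventually_in_sets)
  have "f -` E \<inter> space m = E"
    unfolding E_def by (rule vimage_eventually_in) (use measurable_space[OF f] in auto)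
  hence "measure m E = 0 \<or> measure m (space m - E) = 0" using erg E by blast
  hence "E \<in> null_sets m \<or> space m - E \<in> null_sets m" by (auto simp: null_sets_def emeasure_eq_measure)
  hence "(E \<in> null_sets \<mu> \<and> E \<in> null_sets \<nu>) \<or> (space m - E \<in> null_sets \<mu> \<and> space m - E \<in> null_sets \<nu>)"
    using \<mu>(3) \<nu>(3) by (auto simp: absolutely_continuous_def)
  hence "(measure \<mu> E = 0 \<and> measure \<nu> E = 0) \<or> (measure \<mu> (space \<mu> - E) = 0 \<and> measure \<nu> (space \<nu> - E) = 0)"
    by (auto simp: null_sets_def measure_def spm spn)
  hence "measure \<mu> E = measure \<nu> E"
    using M.prob_compl[of E] N.prob_compl[of E] E \<mu>(2) \<nu>(2) by auto
  moreover have "measure \<mu> E = measure \<mu> D"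
    by (rule measure_eq_AE) (use AE_eventually_in[OF \<mu>(4) AEm] E D \<mu>(2) in \<open>auto simp: E_def spm\<close>)
  moreover have "measure \<nu> E = measure \<nu> D"
    by (rule measure_eq_AE) (use AE_eventually_in[OF \<nu>(4) AEn] E D \<nu>(2) in \<open>auto simp: E_def spn\<close>)
  ultimately have "emeasure \<mu> D = emeasure \<nu> D" by (simp add: M.emeasure_eq_measure N.emeasure_eq_measure)
  hence "measure m D = 0" by (intro null) auto
  hence "D \<in> null_sets m" by (auto simp: null_sets_def emeasure_eq_measure)
  hence "D \<in> null_sets \<mu>" using \<mu>(3) by (auto simp: absolutely_continuous_def)
  hence D0: "measure \<mu> D = 0" by (auto simp: null_sets_def measure_def)
  have le: "measure \<mu> A \<le> measure \<nu> A" if A[measurable]: "A \<in> sets m" for A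
  proof -
    have "measure \<mu> A \<le> measure \<mu> (A - D) + measure \<mu> D"
      using measure_Un_le[of "A - D" \<mu> D] M.finite_measure_mono[of A "(A - D) \<union> D"] A D \<mu>(2)
      by fastforce
    also have "\<dots> = measure \<mu> (A - D)" using D0 by simp
    also have "\<dots> \<le> measure \<nu> (A - D)"
      using le2[of "A - D"] by (auto simp: M.emeasure_eq_measure N.emeasure_eq_measure)
    also have "\<dots> \<le> measure \<nu> A" using A D \<nu>(2) by (intro N.finite_measure_mono) auto
    finally show ?thesis .
  qed
  show ?thesis
  proof (rule measure_eqI)
    fix A assume "A \<in> sets \<mu>"
    hence A[measurable]: "A \<in> sets m" by (simp add: \<mu>(2))
    have "measure \<mu> (space m - A) \<le> measure \<nu> (space m - A)" by (rule le) auto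
    hence "measure \<nu> A \<le> measure \<mu> A"
      using M.prob_compl[of A] N.prob_compl[of A] A \<mu>(2) \<nu>(2) spm spn by simp
    thus "emeasure \<mu> A = emeasure \<nu> A"
      using le[OF A] by (simp add: M.emeasure_eq_measure N.emeasure_eq_measure)
  qed (simp add: \<mu>(2) \<nu>(2))
qed

section \<open>Tail sets and mixing components\<close>

definition tail_set :: "('a \<Rightarrow> 'a) \<Rightarrow> 'a measure \<Rightarrow> 'a set \<Rightarrow> bool" where
  "tail_set f M A \<longleftrightarrow> (\<forall>n. \<exists>B\<in>sets M. A = (f ^^ n) -` B \<inter> space M)"

lemma tail_set_in_sets: "tail_set f M A \<Longrightarrow> A \<in> sets M"
  unfolding tail_set_def by (drule spec[of _ 0]) auto

lemma tail_set_Int: "tail_set f M A \<Longrightarrow> tail_set f M B \<Longrightarrow> tail_set f M (A \<inter> B)"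
  unfolding tail_set_def
proof
  fix n assume "\<forall>n. \<exists>B\<in>sets M. A = (f ^^ n) -` B \<inter> space M" "\<forall>n. \<exists>Ba\<in>sets M. B = (f ^^ n) -` Ba \<inter> space M"
  then obtain C D where "C \<in> sets M" "D \<in> sets M" "A = (f ^^ n) -` C \<inter> space M" "B = (f ^^ n) -` D \<inter> space M"
    by meson
  thus "\<exists>Ba\<in>sets M. A \<inter> B = (f ^^ n) -` Ba \<inter> space M" by (intro bexI[of _ "C \<inter> D"]) auto
qed

lemma tail_set_Diff: "tail_set f M A \<Longrightarrow> tail_set f M B \<Longrightarrow> tail_set f M (A - B)"
  unfolding tail_set_def
proof
  fix n assume "\<forall>n. \<exists>B\<in>sets M. A = (f ^^ n) -` B \<inter> space M" "\<forall>n. \<exists>Ba\<in>sets M. B = (f ^^ n) -` Ba \<inter> space M"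
  then obtain C D where "C \<in> sets M" "D \<in> sets M" "A = (f ^^ n) -` C \<inter> space M" "B = (f ^^ n) -` D \<inter> space M"
    by meson
  thus "\<exists>Ba\<in>sets M. A - B = (f ^^ n) -` Ba \<inter> space M" by (intro bexI[of _ "C - D"]) auto
qed

lemma tail_set_funpow_vimage:
  assumes f: "f \<in> measurable M M" and A: "tail_set f M A"
  shows "tail_set f M ((f ^^ j) -` A \<inter> space M)"
  unfolding tail_set_def
proof
  fix n
  obtain B where B: "B \<in> sets M" "A = (f ^^ n) -` B \<inter> space M" using A unfolding tail_set_def by meson
  have "(f ^^ n) ((f ^^ j) x) = (f ^^ j) ((f ^^ n) x)" for x
    by (simp add: funpow_add[symmetric, THEN fun_cong, unfolded o_def] add.commute)
  hence "(f ^^ j) -` A \<inter> space M = (f ^^ n) -` ((f ^^ j) -` B \<inter> space M) \<inter> space M"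
    using B(2) measurable_space[OF measurable_funpow[OF f]] by auto
  moreover have "(f ^^ j) -` B \<inter> space M \<in> sets M"
    using measurable_funpow[OF f] B(1) by (rule measurable_sets)
  ultimately show "\<exists>B\<in>sets M. (f ^^ j) -` A \<inter> space M = (f ^^ n) -` B \<inter> space M" by blast
qed

text \<open>Since k * n \<ge> n, a preimage under the n-th iterate of \<open>f ^^ k\<close> is also
  a preimage under \<open>f ^^ n\<close>. So exactness of \<open>f ^^ k\<close> can be tested
  against the atoms of the tail algebra of \<open>f\<close>.\<close>

lemma tail_set_of_power:
  assumes f: "f \<in> measurable M M" and k: "k \<ge> 1"
    and A: "\<forall>n. \<exists>B\<in>sets M. A = ((f ^^ k) ^^ n) -` B \<inter> space M"
  shows "tail_set f M A"
  unfolding tail_set_def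
proof
  fix n
  obtain B where B: "B \<in> sets M" "A = ((f ^^ k) ^^ n) -` B \<inter> space M" using A by meson
  have "k * n = (k * n - n) + n" using k by simp
  hence "(f ^^ k) ^^ n = (f ^^ (k * n - n)) \<circ> (f ^^ n)"
    by (simp only: funpow_mult funpow_add[symmetric])
  hence "A = (f ^^ n) -` ((f ^^ (k * n - n)) -` B \<inter> space M) \<inter> space M"
    using B(2) measurable_space[OF measurable_funpow[OF f]] by auto
  moreover have "(f ^^ (k * n - n)) -` B \<inter> space M \<in> sets M"
    using measurable_funpow[OF f] B(1) by (rule measurable_sets)
  ultimately show "\<exists>B\<in>sets M. A = (f ^^ n) -` B \<inter> space M" by blast
qed

text \<open>A tail set of almost minimal positive measure is an atom of the tail algebra. Its preimages
  are atoms of the same measure, so they recur, and one cycle of them is the whole space.\<close>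

lemma mixing_components_of_tail_bound:
  fixes \<mu> :: "'a::topological_space measure"
  assumes prob: "prob_space \<mu>" and erg: "ergodic f \<mu>"
    and supp: "AE x in \<mu>. x \<in> measure_support \<mu>"
    and \<eta>: "\<eta> > 0" "\<And>A. \<lbrakk>tail_set f \<mu> A; measure \<mu> A > 0\<rbrakk> \<Longrightarrow> \<eta> \<le> measure \<mu> A"
  shows "\<exists>k \<Sigma>. mixing_components f \<mu> k \<Sigma>"
proof -
  interpret prob_space \<mu> by fact
  have inv: "invariant_under f \<mu>" using erg by (simp add: ergodic_def)
  hence f: "f \<in> measurable \<mu> \<mu>" by (simp add: invariant_under_def)
  note fn = measurable_funpow[OF f]
  define T where "T = {A. tail_set f \<mu> A \<and> measure \<mu> A > 0}"
  define i where "i = Inf (measure \<mu> ` T)"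
  have "tail_set f \<mu> (space \<mu>)"
    unfolding tail_set_def using measurable_space[OF fn] by (intro allI bexI[of _ "space \<mu>"]) auto
  hence T_ne: "measure \<mu> ` T \<noteq> {}" using prob_space by (auto simp: T_def)
  have bdd: "bdd_below (measure \<mu> ` T)" by (intro bdd_belowI[of _ 0]) auto
  \<comment> \<open>\<open>A\<close> is chosen within \<eta> of the infimum: a proper splitting
    would produce a tail set of measure at least \<open>i\<close> and a remainder of measure at
    least \<eta>, together more than the measure of \<open>A\<close>.\<close>
  have "Inf (measure \<mu> ` T) < i + \<eta>" using \<eta>(1) by (simp add: i_def)
  then obtain A where A: "tail_set f \<mu> A" "measure \<mu> A > 0" "measure \<mu> A < i + \<eta>"
    using cInf_lessD[OF T_ne] by (auto simp: T_def)
  define a where "a = measure \<mu> A"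
  have atom: "measure \<mu> (B \<inter> C) = 0 \<or> measure \<mu> (B \<inter> C) = a"
    if B: "tail_set f \<mu> B" "measure \<mu> B = a" and C: "tail_set f \<mu> C" for B C
  proof (rule ccontr)
    assume *: "\<not> ?thesis"
    have BC: "B \<in> sets \<mu>" "C \<in> sets \<mu>" using B C tail_set_in_sets by auto
    have d: "measure \<mu> (B - C) = a - measure \<mu> (B \<inter> C)"
      using finite_measure_Diff'[of B C] BC B(2) by simp
    have "measure \<mu> (B \<inter> C) > 0" using * by (simp add: zero_less_measure_iff)
    hence "i \<le> measure \<mu> (B \<inter> C)"
      unfolding i_def using tail_set_Int[OF B(1) C] by (intro cInf_lower bdd) (auto simp: T_def)
    moreover have "measure \<mu> (B - C) \<noteq> 0" using * d by simp
    hence "\<eta> \<le> measure \<mu> (B - C)"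
      using tail_set_Diff[OF B(1) C] by (intro \<eta>(2)) (auto simp: zero_less_measure_iff)
    ultimately show False using A(3) d by (simp add: a_def)
  qed
  define A' where "A' j = (f ^^ j) -` A \<inter> space \<mu>" for j
  have As: "A \<in> sets \<mu>" using A(1) by (rule tail_set_in_sets)
  have A'0: "A' 0 = A" using sets.sets_into_space[OF As] by (auto simp: A'_def)
  have A't: "tail_set f \<mu> (A' j)" for j unfolding A'_def by (rule tail_set_funpow_vimage[OF f A(1)])
  have A's[measurable]: "A' j \<in> sets \<mu>" for j using A't by (rule tail_set_in_sets)
  have A'm: "measure \<mu> (A' j) = a" for j unfolding A'_def a_def by (rule measure_funpow_vimage[OF inv As])
  have fA': "f x \<in> A' j \<longleftrightarrow> x \<in> A' (Suc j)" if "x \<in> space \<mu>" for x j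
    using that measurable_space[OF f] by (auto simp: A'_def funpow_swap1)
  have shift: "measure \<mu> (A' p \<inter> A' (p + q)) = measure \<mu> (A' 0 \<inter> A' q)" for p q
  proof -
    have "(f ^^ (p + q)) x = (f ^^ q) ((f ^^ p) x)" for x by (simp add: funpow_add add.commute[of p])
    hence "A' p \<inter> A' (p + q) = (f ^^ p) -` (A' 0 \<inter> A' q) \<inter> space \<mu>"
      using measurable_space[OF fn] by (auto simp: A'_def)
    thus ?thesis using measure_funpow_vimage[OF inv, of "A' 0 \<inter> A' q" p] by simp
  qed
  \<comment> \<open>If the atom never met its own preimages, these would be infinitely many
    essentially disjoint sets of the same positive measure.\<close>
  have "\<exists>q\<ge>1. measure \<mu> (A' 0 \<inter> A' q) = a"
  proof (rule ccontr)
    assume "\<not> ?thesis"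
    hence z: "measure \<mu> (A' 0 \<inter> A' q) = 0" if "q \<ge> 1" for q
      using atom[OF A't A'm A't] that by blast
    have z': "measure \<mu> (A' p \<inter> A' r) = 0" if "p < r" for p r
      using shift[of p "r - p"] z[of "r - p"] that by simp
    have "measure \<mu> (\<Union>j<n. A' j) = real n * a" for n
    proof (induction n)
      case (Suc n)
      have "A' n \<inter> (\<Union>j<n. A' j) = (\<Union>j<n. A' j \<inter> A' n)" by auto
      also have "measure \<mu> \<dots> \<le> (\<Sum>j<n. measure \<mu> (A' j \<inter> A' n))"
        by (rule finite_measure_subadditive_finite) auto
      also have "\<dots> = 0" using z' by simp
      finally have "measure \<mu> (A' n \<inter> (\<Union>j<n. A' j)) = 0" by (simp add: measure_le_0_iff)
      moreover have "(\<Union>j<Suc n. A' j) = A' n \<union> (\<Union>j<n. A' j)" by (auto simp: less_Suc_eq)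
      ultimately show ?case
        using Suc A'm[of n] finite_measure_Union'[of "A' n" "\<Union>j<n. A' j"]
          finite_measure_Diff'[of "\<Union>j<n. A' j" "A' n"]
        by (simp add: Int_commute field_simps)
    qed simp
    hence le1: "real n * a \<le> 1" for n by (metis prob_le_1)
    have "a > 0" using A(2) by (simp add: a_def)
    then obtain n where "1 < real n * a" using reals_Archimedean3 by blast
    thus False using le1[of n] by simp
  qed
  define k where "k = (LEAST q. q \<ge> 1 \<and> measure \<mu> (A' 0 \<inter> A' q) = a)"
  have k: "k \<ge> 1" "measure \<mu> (A' 0 \<inter> A' k) = a"
    using LeastI_ex[OF \<open>\<exists>q\<ge>1. measure \<mu> (A' 0 \<inter> A' q) = a\<close>] by (auto simp: k_def)
  have kmin: "measure \<mu> (A' 0 \<inter> A' q) = 0" if "1 \<le> q" "q < k" for q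
    using not_less_Least[of q "\<lambda>q. q \<ge> 1 \<and> measure \<mu> (A' 0 \<inter> A' q) = a"] atom[OF A't A'm A't] that
    unfolding k_def by blast
  have AE0k: "AE x in \<mu>. x \<in> A' 0 \<longleftrightarrow> x \<in> A' k"
  proof (rule AE_I[where N = "(A' 0 - A' k) \<union> (A' k - A' 0)"])
    have "measure \<mu> (A' 0 - A' k) = 0" "measure \<mu> (A' k - A' 0) = 0"
      using finite_measure_Diff'[of "A' 0" "A' k"] finite_measure_Diff'[of "A' k" "A' 0"] k(2) A'm
      by (simp_all add: Int_commute)
    moreover have "(A' k - A' 0) - (A' 0 - A' k) = A' k - A' 0" by auto
    ultimately show "emeasure \<mu> ((A' 0 - A' k) \<union> (A' k - A' 0)) = 0"
      by (simp add: emeasure_eq_measure finite_measure_Union')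
  qed auto
  define U where "U = (\<Union>j<k. A' j)"
  have U[measurable]: "U \<in> sets \<mu>" unfolding U_def by auto
  have "AE x in \<mu>. x \<in> U \<longleftrightarrow> f x \<in> U"
    using AE0k
  proof (rule AE_mp, intro AE_I2 impI)
    fix x assume x: "x \<in> space \<mu>" "x \<in> A' 0 \<longleftrightarrow> x \<in> A' k"
    have "f x \<in> U \<longleftrightarrow> (\<exists>j<k. x \<in> A' (Suc j))" using fA'[OF x(1)] by (auto simp: U_def)
    also have "\<dots> \<longleftrightarrow> (\<exists>j<k. x \<in> A' j)"
    proof
      assume "\<exists>j<k. x \<in> A' (Suc j)"
      then obtain j where "j < k" "x \<in> A' (Suc j)" by blast
      thus "\<exists>j<k. x \<in> A' j" using x(2) k(1) by (cases "Suc j = k") (auto intro: exI[of _ "Suc j"] exI[of _ 0])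
    next
      assume "\<exists>j<k. x \<in> A' j"
      then obtain j where j: "j < k" "x \<in> A' j" by blast
      show "\<exists>j<k. x \<in> A' (Suc j)"
      proof (cases j)
        case 0
        thus ?thesis using j x(2) k(1) by (intro exI[of _ "k - 1"]) auto
      next
        case (Suc l)
        thus ?thesis using j by (intro exI[of _ l]) auto
      qed
    qed
    finally show "x \<in> U \<longleftrightarrow> f x \<in> U" by (auto simp: U_def)
  qed
  from ergodic_AE_invariant[OF erg U this] have "measure \<mu> U = 1"
  proof
    assume "measure \<mu> U = 0"
    moreover have "a \<le> measure \<mu> U"
      unfolding A'm[of 0, symmetric] using k(1) by (intro finite_measure_mono U) (force simp: U_def)
    ultimately show ?thesis using A(2) by (simp add: a_def)
  qed
  hence AEU: "AE x in \<mu>. x \<in> U" by (simp add: prob_eq_1)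
  \<comment> \<open>\<open>N\<close> collects the overlaps of distinct sets of the cycle, which are
    null because \<open>k\<close> is minimal.\<close>
  define N where "N = (\<Union>p<k. \<Union>r\<in>{p<..<k}. A' p \<inter> A' r)"
  have N[measurable]: "N \<in> sets \<mu>" unfolding N_def by auto
  have "A' p \<inter> A' r \<in> null_sets \<mu>" if "p < r" "r < k" for p r
    using shift[of p "r - p"] kmin[of "r - p"] that
    by (auto simp: null_sets_def emeasure_eq_measure)
  hence "N \<in> null_sets \<mu>" unfolding N_def by (intro null_sets_UN' countable_finite) auto
  hence AEN: "AE x in \<mu>. x \<notin> N" by (rule AE_not_in)
  define \<Sigma>0 where "\<Sigma>0 j = (if j = 0 then A else A' (k - j))" for j
  define \<Sigma> where "\<Sigma> j = (if j = 0 then A else A' (k - j) - N)" for j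
  have \<Sigma>ae: "AE x in \<mu>. \<forall>j<k. x \<in> \<Sigma> j \<longleftrightarrow> x \<in> \<Sigma>0 j"
    using AEN by (rule AE_mp) (auto simp: \<Sigma>_def \<Sigma>0_def)
  have un: "(\<Union>j<k. \<Sigma>0 j) = U"
  proof -
    have "x \<in> (\<Union>j<k. \<Sigma>0 j)" if "j < k" "x \<in> A' j" for x j
      using that k(1) by (intro UN_I[of "if j = 0 then 0 else k - j"]) (auto simp: \<Sigma>0_def A'0)
    moreover have "x \<in> U" if "j < k" "x \<in> \<Sigma>0 j" for x j
      using that k(1) unfolding U_def \<Sigma>0_def A'0[symmetric]
      by (intro UN_I[of "if j = 0 then 0 else k - j"]) (auto split: if_splits)
    ultimately show ?thesis by (auto simp: U_def)
  qed
  have 1: "\<Sigma> j \<in> sets \<mu>" for j by (auto simp: \<Sigma>_def As)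
  have disj: "A' p \<inter> A' r \<subseteq> N" if "p < k" "r < k" "p \<noteq> r" for p r
    using that by (cases p r rule: linorder_cases) (force simp: N_def)+
  have 2: "disjoint_family_on \<Sigma> {..<k}"
    unfolding disjoint_family_on_def
  proof (intro ballI impI)
    fix p r assume pr: "p \<in> {..<k}" "r \<in> {..<k}" "p \<noteq> r"
    hence "k - p \<noteq> k - r" by auto
    thus "\<Sigma> p \<inter> \<Sigma> r = {}"
      using pr disj[of "k - p" "k - r"] disj[of 0 "k - r"] disj[of "k - p" 0]
      by (auto simp: \<Sigma>_def A'0)
  qed
  have 3: "AE x in \<mu>. x \<in> measure_support \<mu> \<longleftrightarrow> x \<in> (\<Union>j<k. \<Sigma> j)"
    using supp AEU \<Sigma>ae by eventually_elim (use un in auto)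
  have 4: "AE x in \<mu>. x \<in> \<Sigma> j \<longleftrightarrow> f x \<in> \<Sigma> (Suc j mod k)" if j: "j < k" for j
    using \<Sigma>ae AE_funpow[OF inv \<Sigma>ae, of 1] AE0k AE_space
  proof eventually_elim
    case (elim x)
    have "Suc j mod k < k" using k(1) by simp
    hence e: "f x \<in> \<Sigma> (Suc j mod k) \<longleftrightarrow> f x \<in> \<Sigma>0 (Suc j mod k)" "x \<in> \<Sigma> j \<longleftrightarrow> x \<in> \<Sigma>0 j"
      using elim j by auto
    show ?case
    proof (cases "Suc j = k")
      case True
      hence "f x \<in> \<Sigma>0 (Suc j mod k) \<longleftrightarrow> x \<in> A' 1" using fA'[OF elim(4), of 0] by (simp add: \<Sigma>0_def A'0)
      moreover have "x \<in> \<Sigma>0 j \<longleftrightarrow> x \<in> A' 1"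
        using True elim(3) by (auto simp: \<Sigma>0_def A'0)
      ultimately show ?thesis using e by simp
    next
      case False
      hence "Suc (k - Suc j) = k - j" "Suc j < k" using j by auto
      hence "f x \<in> \<Sigma>0 (Suc j mod k) \<longleftrightarrow> x \<in> A' (k - j)"
        using fA'[OF elim(4), of "k - Suc j"] by (simp add: \<Sigma>0_def)
      moreover have "x \<in> \<Sigma>0 j \<longleftrightarrow> x \<in> A' (k - j)" using elim(3) by (auto simp: \<Sigma>0_def A'0)
      ultimately show ?thesis using e by simp
    qed
  qed
  define V where "V = uniform_measure \<mu> A"
  have Vs: "sets V = sets \<mu>" "space V = space \<mu>" by (simp_all add: V_def)
  have eV: "emeasure V B = ennreal (measure \<mu> (A \<inter> B) / a)" if "B \<in> sets \<mu>" for B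
    using that As A(2) by (simp add: V_def emeasure_eq_measure a_def divide_ennreal)
  have fkV: "f ^^ k \<in> measurable V V" using fn measurable_cong_sets[OF Vs(1) Vs(1)] by simp
  have "distr V V (f ^^ k) = V"
  proof (rule measure_eqI)
    fix B assume "B \<in> sets (distr V V (f ^^ k))"
    hence B[measurable]: "B \<in> sets \<mu>" by (simp add: Vs)
    have B': "(f ^^ k) -` B \<inter> space \<mu> \<in> sets \<mu>" using fn B by (rule measurable_sets)
    have "measure \<mu> (A \<inter> ((f ^^ k) -` B \<inter> space \<mu>)) = measure \<mu> (A' k \<inter> ((f ^^ k) -` B \<inter> space \<mu>))"
      by (rule measure_eq_AE) (use AE0k B' As in \<open>auto simp: A'0\<close>)
    also have "A' k \<inter> ((f ^^ k) -` B \<inter> space \<mu>) = (f ^^ k) -` (A \<inter> B) \<inter> space \<mu>" by (auto simp: A'_def)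
    also have "measure \<mu> \<dots> = measure \<mu> (A \<inter> B)" by (rule measure_funpow_vimage[OF inv]) (use As in auto)
    finally show "emeasure (distr V V (f ^^ k)) B = emeasure V B"
      using emeasure_distr[OF fkV] B' by (simp add: Vs eV)
  qed simp
  hence invV: "invariant_under (f ^^ k) V" using fkV by (simp add: invariant_under_def)
  have 5: "exact (f ^^ k) V"
    unfolding exact_def
  proof (intro conjI allI impI invV)
    fix C assume "\<forall>n. \<exists>B\<in>sets V. C = ((f ^^ k) ^^ n) -` B \<inter> space V"
    hence C: "tail_set f \<mu> C" using tail_set_of_power[OF f k(1)] by (simp add: Vs)
    have "measure V C = measure \<mu> (A \<inter> C) / a"
      using eV[OF tail_set_in_sets[OF C]] A(2) by (simp add: measure_def a_def)
    moreover have "measure \<mu> (A \<inter> C) = 0 \<or> measure \<mu> (A \<inter> C) = a"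
      using atom[OF A(1) _ C] by (simp add: a_def)
    ultimately show "measure V C = 0 \<or> measure V C = 1" using A(2) by (auto simp: a_def)
  qed
  have "mixing_components f \<mu> k \<Sigma>"
    unfolding mixing_components_def using k(1) 1 2 3 4 5 by (simp add: \<Sigma>_def[of 0] V_def)
  thus ?thesis by blast
qed

text \<open>Most of the growth happens where the density of \<open>\<mu>\<close> is bounded below.\<close>

lemma tail_bound_of_growth:
  fixes m :: "'a measure"
  assumes fin: "finite_measure m" and \<delta>: "\<delta> > 0"
    and growth: "\<And>A E. \<lbrakk>A \<in> sets m; measure m A > 0; \<And>n. E n \<in> sets m;
      \<And>n. A \<subseteq> (f ^^ n) -` E n\<rbrakk> \<Longrightarrow> \<exists>n. \<delta> \<le> measure m (E n)"
    and \<mu>: "prob_space \<mu>" "sets \<mu> = sets m" "absolutely_continuous m \<mu>" "invariant_under f \<mu>"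
  shows "\<exists>\<eta>>0. \<forall>A. tail_set f \<mu> A \<and> measure \<mu> A > 0 \<longrightarrow> \<eta> \<le> measure \<mu> A"
proof -
  interpret finite_measure m by fact
  interpret M: prob_space \<mu> by fact
  have spm: "space \<mu> = space m" using sets_eq_imp_space_eq[OF \<mu>(2)] .
  have f: "f \<in> measurable m m"
    using \<mu>(4) measurable_cong_sets[OF \<mu>(2) \<mu>(2)] by (simp add: invariant_under_def)
  have [measurable]: "f ^^ n \<in> measurable m m" for n by (rule measurable_funpow[OF f])
  define \<phi> where "\<phi> = RN_deriv m \<mu>"
  have [measurable]: "\<phi> \<in> borel_measurable m" by (auto simp: \<phi>_def)
  have dm: "density m \<phi> = \<mu>" unfolding \<phi>_def by (rule density_RN_deriv[OF \<mu>(3,2)])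
  have em: "emeasure \<mu> E = (\<integral>\<^sup>+x. \<phi> x * indicator E x \<partial>m)" if "E \<in> sets m" for E
    using that by (subst dm[symmetric]) (simp add: emeasure_density)
  define S where "S = {x \<in> space m. \<phi> x > 0}"
  have S[measurable]: "S \<in> sets m" unfolding S_def by measurable
  \<comment> \<open>The sets \<open>R n\<close> decrease to the empty set, so one of them has
    measure below \<delta> / 2. A subset of \<open>S\<close> of measure at least \<delta> then has
    measure at least \<delta> / 2 where the density is at least \<open>c\<close>.\<close>
  define R where "R n = {x \<in> space m. 0 < \<phi> x \<and> \<phi> x < ennreal (1 / real (Suc n))}" for n
  have R[measurable]: "R n \<in> sets m" for n unfolding R_def by measurable
  have "decseq R"
  proof (rule decseq_SucI)
    fix n
    have "ennreal (1 / real (Suc (Suc n))) \<le> ennreal (1 / real (Suc n))"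
      by (intro ennreal_leI) (simp add: field_simps)
    thus "R (Suc n) \<subseteq> R n" by (auto simp: R_def intro: less_le_trans)
  qed
  moreover have "(\<Inter>n. R n) = {}"
  proof (rule ccontr)
    assume "(\<Inter>n. R n) \<noteq> {}"
    then obtain x where x: "0 < \<phi> x" "\<And>n. \<phi> x < ennreal (1 / real (Suc n))" by (auto simp: R_def)
    hence fx: "\<phi> x \<noteq> \<top>" by (metis ennreal_less_top less_imp_neq order_less_trans)
    define r where "r = enn2real (\<phi> x)"
    have r: "\<phi> x = ennreal r" "r \<ge> 0" using fx by (auto simp: r_def less_top)
    hence "r > 0" using x(1) by (simp add: less_le ennreal_eq_0_iff)
    then obtain n where "1 / real (Suc n) < r" using nat_approx_posE by blast
    thus False using x(2)[of n] r by (simp add: ennreal_less_iff)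
  qed
  ultimately have "(\<lambda>n. measure m (R n)) \<longlonglongrightarrow> 0"
    using finite_Lim_measure_decseq[of R] R by (simp add: image_subset_iff)
  hence "eventually (\<lambda>n. measure m (R n) < \<delta> / 2) sequentially"
    using \<delta> by (intro order_tendstoD(2)) auto
  then obtain N where N: "measure m (R N) < \<delta> / 2" by (auto simp: eventually_sequentially)
  define c where "c = 1 / real (Suc N)"
  have c: "c > 0" by (simp add: c_def)
  have low: "c * (\<delta> / 2) \<le> measure \<mu> E" if E[measurable]: "E \<in> sets m" "E \<subseteq> S" "\<delta> \<le> measure m E" for E
  proof -
    have "\<delta> / 2 \<le> measure m E - measure m (E \<inter> R N)"
      using N that(3) finite_measure_mono[of "E \<inter> R N" "R N"] by (simp add: field_simps)
    also have "\<dots> = measure m (E - R N)" by (simp add: finite_measure_Diff')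
    finally have "ennreal (c * (\<delta> / 2)) \<le> ennreal c * emeasure m (E - R N)"
      using c \<delta> by (simp add: emeasure_eq_measure ennreal_mult[symmetric] ennreal_leI)
    also have "\<dots> = (\<integral>\<^sup>+x. ennreal c * indicator (E - R N) x \<partial>m)"
      by (simp add: nn_integral_cmult_indicator)
    also have "\<dots> \<le> (\<integral>\<^sup>+x. \<phi> x * indicator E x \<partial>m)"
      using that(2) by (intro nn_integral_mono) (auto simp: indicator_def S_def R_def c_def not_less)
    also have "\<dots> = ennreal (measure \<mu> E)" using em[OF E(1)] by (simp add: M.emeasure_eq_measure)
    finally show ?thesis by (simp add: ennreal_le_iff)
  qed
  \<comment> \<open>The points whose whole orbit stays where the density is positive carry all of
    \<mu>, and their images stay in \<open>S'\<close>. So the sets \<open>B n\<close> can be cut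
    down to \<open>S'\<close>, which puts them inside \<open>S\<close> as \<open>low\<close>
    requires.\<close>
  define S' where "S' = {x \<in> space m. \<forall>n. (f ^^ n) x \<in> S}"
  have S'[measurable]: "S' \<in> sets m" unfolding S'_def by measurable
  have "AE x in density m \<phi>. 0 < \<phi> x" by (simp add: AE_density)
  hence "AE x in \<mu>. x \<in> S" using AE_space[of \<mu>] unfolding dm by eventually_elim (auto simp: S_def spm)
  hence "AE x in \<mu>. \<forall>n. (f ^^ n) x \<in> S" unfolding AE_all_countable using AE_funpow[OF \<mu>(4)] by blast
  hence AES': "AE x in \<mu>. x \<in> S'" using AE_space[of \<mu>] by eventually_elim (auto simp: S'_def spm)
  have fS': "(f ^^ n) x \<in> S'" if "x \<in> S'" for x n
  proof -
    have "(f ^^ k) ((f ^^ n) x) = (f ^^ (k + n)) x" for k by (simp add: funpow_add)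
    thus ?thesis using that measurable_space[of "f ^^ n" m m x] by (auto simp: S'_def)
  qed
  have "c * (\<delta> / 2) \<le> measure \<mu> A" if A: "tail_set f \<mu> A" "measure \<mu> A > 0" for A
  proof -
    have "\<forall>n. \<exists>B\<in>sets m. A = (f ^^ n) -` B \<inter> space m" using A(1) by (simp add: tail_set_def \<mu>(2) spm)
    then obtain B where B: "\<And>n. B n \<in> sets m" "\<And>n. A = (f ^^ n) -` B n \<inter> space m" by metis
    have As[measurable]: "A \<in> sets m" using tail_set_in_sets[OF A(1)] by (simp add: \<mu>(2))
    note B(1)[measurable]
    have "measure \<mu> (A \<inter> S') = measure \<mu> A"
      by (rule measure_eq_AE) (use AES' in \<open>auto simp: \<mu>(2)\<close>)
    hence "A \<inter> S' \<notin> null_sets \<mu>" using A(2) by (auto simp: null_sets_def measure_def)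
    hence "A \<inter> S' \<notin> null_sets m" using \<mu>(3) by (auto simp: absolutely_continuous_def)
    hence "measure m (A \<inter> S') > 0" by (auto simp: null_sets_def emeasure_eq_measure zero_less_measure_iff)
    moreover have "A \<inter> S' \<subseteq> (f ^^ n) -` (B n \<inter> S')" for n using B(2)[of n] fS' by blast
    ultimately obtain n where n: "\<delta> \<le> measure m (B n \<inter> S')"
      using growth[of "A \<inter> S'" "\<lambda>n. B n \<inter> S'"] by auto
    have "S' \<subseteq> S" by (auto simp: S'_def dest: spec[of _ 0])
    hence "c * (\<delta> / 2) \<le> measure \<mu> (B n \<inter> S')" using n by (intro low) auto
    also have "\<dots> \<le> measure \<mu> (B n)" by (intro M.finite_measure_mono) (auto simp: \<mu>(2))
    also have "\<dots> = measure \<mu> A"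
      using measure_funpow_vimage[OF \<mu>(4), of "B n" n] B(2)[of n] by (simp add: \<mu>(2) spm)
    finally show ?thesis .
  qed
  thus ?thesis using c \<delta> by (intro exI[of _ "c * (\<delta> / 2)"]) auto
qed

section \<open>Piecewise affine expanding maps of an interval\<close>

text \<open>A list of triples \<open>(w, a, b)\<close> stands for the step density \<open>\<Sum> w * indicator {a<..<b}\<close>.\<close>

definition step_weight :: "(real \<times> real \<times> real) list \<Rightarrow> real" where
  "step_weight J = (\<Sum>(w, a, b)\<leftarrow>J. w)"

definition step_measure :: "(real \<times> real \<times> real) list \<Rightarrow> real set \<Rightarrow> real" where
  "step_measure J E = (\<Sum>(w, a, b)\<leftarrow>J. w * measure lborel ({a<..<b} \<inter> E))"

definition valid_steps :: "real \<Rightarrow> (real \<times> real \<times> real) list \<Rightarrow> bool" where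
  "valid_steps L J \<longleftrightarrow> (\<forall>(w, a, b)\<in>set J. 0 \<le> w \<and> a < b \<and> 0 \<le> a \<and> b \<le> L)"

text \<open>This says that \<open>J\<close> is the image of the indicator of the interval under the
  transfer operator of \<open>g\<close>. The number \<open>step_weight J\<close> bounds this density
  from above and also controls its variation, since every step contributes one jump up and one jump
  down of its weight.\<close>

definition pushes :: "(real \<Rightarrow> real) \<Rightarrow> real \<Rightarrow> real \<Rightarrow> (real \<times> real \<times> real) list \<Rightarrow> bool" where
  "pushes g a b J \<longleftrightarrow> (\<forall>E\<in>sets borel. {a<..<b} \<inter> g -` E \<in> sets borel \<and>
     measure lborel ({a<..<b} \<inter> g -` E) = step_measure J E)"

lemma step_simps [simp]:
  "step_weight [] = 0" "step_measure [] E = 0" "valid_steps L []"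
  "step_weight ((w, a, b) # J) = w + step_weight J"
  "step_measure ((w, a, b) # J) E = w * measure lborel ({a<..<b} \<inter> E) + step_measure J E"
  "valid_steps L ((w, a, b) # J) \<longleftrightarrow> 0 \<le> w \<and> a < b \<and> 0 \<le> a \<and> b \<le> L \<and> valid_steps L J"
  "step_weight (J @ K) = step_weight J + step_weight K"
  "step_measure (J @ K) E = step_measure J E + step_measure K E"
  "valid_steps L (J @ K) \<longleftrightarrow> valid_steps L J \<and> valid_steps L K"
  unfolding step_weight_def step_measure_def valid_steps_def by (simp_all add: ball_Un)

lemma step_scale:
  "step_weight (map (\<lambda>(w, ab). (c * w, ab)) J) = c * step_weight J"
  "step_measure (map (\<lambda>(w, ab). (c * w, ab)) J) E = c * step_measure J E"
  "0 \<le> c \<Longrightarrow> valid_steps L J \<Longrightarrow> valid_steps L (map (\<lambda>(w, ab). (c * w, ab)) J)"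
  by (induction J) (auto simp: algebra_simps)

lemma fmeasurable_Int_interval:
  "E \<in> sets borel \<Longrightarrow> {a<..<b::real} \<inter> E \<in> fmeasurable lborel"
  using emeasure_bounded_finite[OF bounded_Int[of "{a<..<b}" E]] by (intro fmeasurableI) auto

lemma fmeasurable_subset_interval:
  fixes E :: "real set"
  assumes "E \<in> sets borel" "E \<subseteq> {a..b}"
  shows "E \<in> fmeasurable lborel"
  using assms emeasure_bounded_finite[OF bounded_subset[OF bounded_closed_interval assms(2)]]
  by (intro fmeasurableI) auto

lemma measure_affine_vimage:
  fixes \<sigma> \<tau> :: real
  assumes "\<sigma> \<noteq> 0" "B \<in> sets borel"
  shows "measure lborel ((\<lambda>x. \<sigma> * x + \<tau>) -` B) = measure lborel B / \<bar>\<sigma>\<bar>"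
proof -
  have "emeasure lborel B = emeasure (density (distr lborel borel (\<lambda>x. \<tau> + \<sigma> * x)) (\<lambda>_. ennreal \<bar>\<sigma>\<bar>)) B"
    by (subst lborel_real_affine[OF assms(1), of \<tau>]) simp
  also have "\<dots> = ennreal \<bar>\<sigma>\<bar> * emeasure lborel ((\<lambda>x. \<tau> + \<sigma> * x) -` B)"
    using assms(2) by (subst emeasure_density_const) (auto simp: emeasure_distr)
  finally have "measure lborel B = \<bar>\<sigma>\<bar> * measure lborel ((\<lambda>x. \<sigma> * x + \<tau>) -` B)"
    by (simp add: measure_def enn2real_mult add.commute)
  thus ?thesis using assms(1) by simp
qed

lemma pushes_affine:
  assumes ab: "a < b" and \<sigma>: "\<sigma> \<noteq> 0" and g: "\<And>x. x \<in> {a<..<b} \<Longrightarrow> g x = \<sigma> * x + \<tau>"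
  defines "c \<equiv> min (\<sigma> * a + \<tau>) (\<sigma> * b + \<tau>)" and "d \<equiv> max (\<sigma> * a + \<tau>) (\<sigma> * b + \<tau>)"
  shows "c < d" "d - c = \<bar>\<sigma>\<bar> * (b - a)" "g ` {a<..<b} = {c<..<d}" "pushes g a b [(1 / \<bar>\<sigma>\<bar>, c, d)]"
proof -
  have mem: "\<sigma> * x + \<tau> \<in> {c<..<d} \<longleftrightarrow> x \<in> {a<..<b}" for x
  proof (cases "\<sigma> > 0")
    case True
    thus ?thesis using ab by (auto simp: c_def d_def min_def max_def)
  next
    case False
    hence "\<sigma> < 0" using \<sigma> by simp
    thus ?thesis using ab by (auto simp: c_def d_def min_def max_def)
  qed
  show "d - c = \<bar>\<sigma>\<bar> * (b - a)"
  proof -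
    have "d - c = \<bar>(\<sigma> * b + \<tau>) - (\<sigma> * a + \<tau>)\<bar>" by (simp add: c_def d_def max_def min_def abs_if)
    also have "\<dots> = \<bar>\<sigma> * (b - a)\<bar>" by (simp add: algebra_simps)
    finally show ?thesis using ab by (simp add: abs_mult)
  qed
  moreover have "\<bar>\<sigma>\<bar> * (b - a) > 0" using \<sigma> ab by simp
  ultimately show "c < d" by linarith
  show "g ` {a<..<b} = {c<..<d}"
  proof
    show "g ` {a<..<b} \<subseteq> {c<..<d}"
    proof
      fix y assume "y \<in> g ` {a<..<b}"
      then obtain x where "x \<in> {a<..<b}" "y = g x" by blast
      thus "y \<in> {c<..<d}" using mem[of x] g by simp
    qed
    show "{c<..<d} \<subseteq> g ` {a<..<b}"
    proof
      fix y assume y: "y \<in> {c<..<d}"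
      have "\<sigma> * ((y - \<tau>) / \<sigma>) + \<tau> = y" using \<sigma> by simp
      hence "(y - \<tau>) / \<sigma> \<in> {a<..<b}" "g ((y - \<tau>) / \<sigma>) = y" using mem[of "(y - \<tau>) / \<sigma>"] y g by auto
      thus "y \<in> g ` {a<..<b}" by (metis imageI)
    qed
  qed
  show "pushes g a b [(1 / \<bar>\<sigma>\<bar>, c, d)]"
    unfolding pushes_def
  proof (intro ballI conjI)
    fix E :: "real set" assume E: "E \<in> sets borel"
    have eq: "{a<..<b} \<inter> g -` E = (\<lambda>x. \<sigma> * x + \<tau>) -` ({c<..<d} \<inter> E)"
      using mem g by auto
    have B: "{c<..<d} \<inter> E \<in> sets borel" using E by auto
    show "{a<..<b} \<inter> g -` E \<in> sets borel"
      unfolding eq by (rule measurable_sets_borel[OF _ B]) measurable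
    show "measure lborel ({a<..<b} \<inter> g -` E) = step_measure [(1 / \<bar>\<sigma>\<bar>, c, d)] E"
      unfolding eq by (simp add: measure_affine_vimage[OF \<sigma> B] del: vimage_Int)
  qed
qed

text \<open>Statements about affine branches are extended to intervals with cuts by splitting at one
  cut at a time; the number of interior cuts drops in both halves.\<close>

lemma interval_split_induct:
  fixes P :: "real \<Rightarrow> real \<Rightarrow> bool"
  assumes F: "finite F"
    and base: "\<And>a b. \<lbrakk>a < b; {a<..<b} \<inter> F = {}\<rbrakk> \<Longrightarrow> P a b"
    and step: "\<And>a c b. \<lbrakk>a < c; c < b; c \<in> F; P a c; P c b\<rbrakk> \<Longrightarrow> P a b"
    and ab: "a < b"
  shows "P a b"
  using ab
proof (induction "card ({a<..<b} \<inter> F)" arbitrary: a b rule: less_induct)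
  case less
  show ?case
  proof (cases "{a<..<b} \<inter> F = {}")
    case True
    thus ?thesis using base less by blast
  next
    case False
    then obtain c where c: "a < c" "c < b" "c \<in> F" by auto
    have "card ({a<..<c} \<inter> F) < card ({a<..<b} \<inter> F)" "card ({c<..<b} \<inter> F) < card ({a<..<b} \<inter> F)"
      by (rule psubset_card_mono; use F c in auto)+
    thus ?thesis using less c by (intro step[of a c b]) auto
  qed
qed

lemma pushes_split:
  assumes c: "a < c" "c < b" and J: "pushes g a c J" and K: "pushes g c b K"
  shows "pushes g a b (J @ K)"
  unfolding pushes_def
proof (intro ballI conjI)
  fix E :: "real set" assume E: "E \<in> sets borel"
  have eq: "{a<..<b} \<inter> g -` E = ({a<..<c} \<inter> g -` E) \<union> ({c<..<b} \<inter> g -` E) \<union> ({c} \<inter> g -` E)"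
    using c by auto
  have s: "{a<..<c} \<inter> g -` E \<in> sets borel" "{c<..<b} \<inter> g -` E \<in> sets borel" "{c} \<inter> g -` E \<in> sets borel"
    using J K E by (auto simp: pushes_def intro: sets.countable)
  show "{a<..<b} \<inter> g -` E \<in> sets borel" unfolding eq using s by auto
  have fm: "{a<..<c} \<inter> g -` E \<in> fmeasurable lborel" "{c<..<b} \<inter> g -` E \<in> fmeasurable lborel"
    using fmeasurable_Int_interval[OF s(1), of a c] fmeasurable_Int_interval[OF s(2), of c b] by simp_all
  have z: "emeasure lborel ({c} \<inter> g -` E) = 0"
    by (rule emeasure_eq_0[of "{c}"]) auto
  have "measure lborel ({a<..<b} \<inter> g -` E) = measure lborel (({a<..<c} \<inter> g -` E) \<union> ({c<..<b} \<inter> g -` E))"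
    unfolding eq by (rule measure_Un_null_set) (use s z in \<open>auto simp: null_sets_def\<close>)
  also have "\<dots> = measure lborel ({a<..<c} \<inter> g -` E) + measure lborel ({c<..<b} \<inter> g -` E)"
    using measure_Un2[OF fm] by (simp add: Diff_triv disjoint_iff)
  finally show "measure lborel ({a<..<b} \<inter> g -` E) = step_measure (J @ K) E"
    using J K E by (simp add: pushes_def)
qed

text \<open>A weak form of the density theorem by covering: take nonoverlapping closed intervals
  that cover \<open>A\<close> and exceed it by at most \<open>e * M / 2\<close> in total measure. If
  each of them missed \<open>A\<close> in more than the fraction \<open>e\<close> of its length, the
  total excess would be at least \<open>e * M\<close>.\<close>

lemma lebesgue_dense_interval:
  fixes L :: real
  assumes L: "0 < L" and A: "A \<in> sets borel" "A \<subseteq> {0..L}" "measure lborel A > 0" and e: "e > 0"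
  shows "\<exists>a b. a < b \<and> 0 \<le> a \<and> b \<le> L \<and> measure lborel ({a<..<b} - A) \<le> e * (b - a)"
proof (rule ccontr)
  assume "\<not> ?thesis"
  hence no: "e * (b - a) < measure lborel ({a<..<b} - A)" if "a < b" "0 \<le> a" "b \<le> L" for a b
    using that by (meson not_le)
  define M where "M = measure lborel A"
  have mA: "measure lebesgue A = M" using A(1) by (simp add: M_def)
  have "A \<in> lmeasurable"
    using A by (intro bounded_set_imp_lmeasurable) (auto intro: bounded_subset[OF bounded_closed_interval])
  moreover have "A \<subseteq> cbox 0 L" using A(2) by (simp add: cbox_interval)
  moreover have "e * M / 2 > 0" using e A(3) by (simp add: M_def)
  ultimately obtain D where D: "countable D"
    "\<And>K. K \<in> D \<Longrightarrow> K \<subseteq> cbox 0 L \<and> K \<noteq> {} \<and> (\<exists>c d. K = cbox c d)"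
    "pairwise (\<lambda>A B. interior A \<inter> interior B = {}) D"
    "\<And>K. \<lbrakk>K \<in> D; box 0 L \<noteq> {}\<rbrakk> \<Longrightarrow> interior K \<noteq> {}"
    "A \<subseteq> \<Union>D" "\<Union>D \<in> lmeasurable" "measure lebesgue (\<Union>D) \<le> measure lebesgue A + e * M / 2"
    using measurable_outer_intervals_bounded[of A 0 L "e * M / 2"] by metis
  have K: "\<exists>c d. K = {c..d} \<and> interior K = {c<..<d} \<and> c < d \<and> 0 \<le> c \<and> d \<le> L" if KD: "K \<in> D" for K
  proof -
    obtain c d where cd: "K = {c..d}" using D(2)[OF KD] by (auto simp: cbox_interval)
    moreover have "interior K \<noteq> {}" using D(4)[OF KD] L by auto
    moreover have "K \<subseteq> {0..L}" using D(2)[OF KD] by (simp add: cbox_interval)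
    ultimately show ?thesis by (intro exI[of _ c] exI[of _ d]) auto
  qed
  have Kl: "interior K \<in> sets borel" for K :: "real set" by auto
  define V where "V = (\<Union>K\<in>D. interior K)"
  have V: "V \<in> sets borel" unfolding V_def by (intro borel_open open_UN) auto
  have UD: "\<Union>D \<in> sets borel"
  proof (intro sets.countable_Union D(1) subsetI)
    fix K assume "K \<in> D"
    then obtain c d where "K = {c..d}" using K by blast
    thus "K \<in> sets borel" by simp
  qed
  have djf: "disjoint_family_on interior D"
    using D(3) by (auto simp: disjoint_family_on_def pairwise_def)
  have "ennreal e * emeasure lborel V = ennreal e * (\<integral>\<^sup>+K. emeasure lborel (interior K) \<partial>count_space D)"
    unfolding V_def using djf D(1) by (subst emeasure_UN_countable) auto
  also have "\<dots> = (\<integral>\<^sup>+K. ennreal e * emeasure lborel (interior K) \<partial>count_space D)"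
    by (rule nn_integral_cmult[symmetric]) auto
  also have "\<dots> \<le> (\<integral>\<^sup>+K. emeasure lborel (interior K - A) \<partial>count_space D)"
  proof (rule nn_integral_mono)
    fix K assume "K \<in> space (count_space D)"
    hence "K \<in> D" by simp
    from K[OF this] obtain c d where cd: "interior K = {c<..<d}" "c < d" "0 \<le> c" "d \<le> L" by blast
    have "ennreal e * emeasure lborel (interior K) = ennreal (e * (d - c))"
      using cd e by (simp add: ennreal_mult)
    also have "\<dots> \<le> ennreal (measure lborel ({c<..<d} - A))"
      using no[of c d] cd by (intro ennreal_leI) auto
    also have "\<dots> = emeasure lborel (interior K - A)"
      unfolding cd(1) using fmeasurable_Int_interval[of "- A" c d] A(1)
      by (simp add: Diff_eq emeasure_eq_measure2)
    finally show "ennreal e * emeasure lborel (interior K) \<le> emeasure lborel (interior K - A)" .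
  qed
  also have "\<dots> = emeasure lborel (\<Union>K\<in>D. interior K - A)"
    using djf D(1) A(1) by (subst emeasure_UN_countable) (auto simp: disjoint_family_on_def)
  also have "\<dots> \<le> emeasure lborel (\<Union>D - A)"
    using interior_subset UD A(1) by (intro emeasure_mono) auto
  finally have 1: "ennreal e * emeasure lborel V \<le> emeasure lborel (\<Union>D - A)" .
  have sub: "\<Union>D \<subseteq> {0..L}" using K by force
  have UDf: "\<Union>D \<in> fmeasurable lborel" "A \<in> fmeasurable lborel"
    using fmeasurable_subset_interval UD A sub by blast+
  have "emeasure lborel (\<Union>D - A) = ennreal (measure lborel (\<Union>D) - M)"
    using UDf D(5) A(1) measurable_measure_Diff[OF UDf(1), of A] fmeasurable_Diff[OF UDf(1), of A]
    by (simp add: M_def emeasure_eq_measure2)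
  also have "\<dots> \<le> ennreal (e * M / 2)" using D(7) mA UD by (intro ennreal_leI) simp
  finally have 2: "emeasure lborel (\<Union>D - A) \<le> ennreal (e * M / 2)" .
  \<comment> \<open>The cover consists of closed intervals while the estimate is made with their
    interiors; the endpoints form a countable null set.\<close>
  define Z where "Z = (\<Union>K\<in>D. K - interior K)"
  have "countable (K - interior K)" if KD: "K \<in> D" for K
  proof -
    obtain c d where "K = {c..d}" "interior K = {c<..<d}" using K[OF KD] by blast
    hence "K - interior K \<subseteq> {c, d}" by auto
    thus ?thesis by (meson countable_finite countable_subset finite.emptyI finite.insertI)
  qed
  hence "countable Z" unfolding Z_def using D(1) by (intro countable_UN) auto
  hence "emeasure lborel Z = 0" and Zs: "Z \<in> sets borel"
    by (auto simp: emeasure_lborel_countable sets.countable)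
  have "ennreal M = emeasure lborel A" using UDf by (simp add: M_def emeasure_eq_measure2)
  also have "\<dots> \<le> emeasure lborel (V \<union> Z)"
    using V Zs D(5) by (intro emeasure_mono) (auto simp: V_def Z_def)
  also have "\<dots> \<le> emeasure lborel V + emeasure lborel Z"
    using V Zs by (intro emeasure_subadditive) auto
  finally have "ennreal M \<le> emeasure lborel V" using \<open>emeasure lborel Z = 0\<close> by simp
  hence "ennreal e * ennreal M \<le> ennreal e * emeasure lborel V" by (rule mult_left_mono) simp
  with 1 2 have "ennreal e * ennreal M \<le> ennreal (e * M / 2)" by (meson order_trans)
  hence "e * M \<le> e * M / 2" using e A(3) by (simp add: M_def ennreal_mult[symmetric] ennreal_le_iff)
  thus False using e A(3) by (simp add: M_def)
qed

section \<open>Piecewise affine maps and their iterates\<close>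

lemma step_measure_le:
  assumes "valid_steps L J" "E \<in> sets borel" "E \<in> fmeasurable lborel"
  shows "step_measure J E \<le> step_weight J * measure lborel E"
  using assms(1)
proof (induction J)
  case (Cons t J)
  obtain w a b where t: "t = (w, a, b)" by (cases t)
  have "measure lborel ({a<..<b} \<inter> E) \<le> measure lborel E"
    using assms by (intro measure_mono_fmeasurable) auto
  hence "w * measure lborel ({a<..<b} \<inter> E) \<le> w * measure lborel E"
    using Cons.prems by (intro mult_left_mono) (auto simp: t)
  thus ?case using Cons by (simp add: t distrib_right)
qed simp

text \<open>The lower bound for the slopes is merely positive here, so that \<open>f ^^ 0\<close>,
  \<open>f\<close> and all further iterates are instances with the bounds \<open>lam ^ n\<close>. At
  the cuts the values are arbitrary points of the interval.\<close>

locale pw_affine_map =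
  fixes L :: real and f :: "real \<Rightarrow> real" and F :: "real set" and lam :: real
  assumes L_pos: "0 < L" and lam_pos: "0 < lam" and finite_cuts: "finite F"
    and maps: "\<And>x. x \<in> {0..L} \<Longrightarrow> f x \<in> {0..L}"
    and affine: "\<And>a b. \<lbrakk>a < b; 0 \<le> a; b \<le> L; {a<..<b} \<inter> F = {}\<rbrakk> \<Longrightarrow>
      \<exists>\<sigma> \<tau>. lam \<le> \<bar>\<sigma>\<bar> \<and> (\<forall>x\<in>{a<..<b}. f x = \<sigma> * x + \<tau>)"
begin

lemma affine_image:
  assumes ab: "a < b" "0 \<le> a" "b \<le> L" "{a<..<b} \<inter> F = {}"
  obtains \<sigma> \<tau> c d where "lam \<le> \<bar>\<sigma>\<bar>" "\<And>x. x \<in> {a<..<b} \<Longrightarrow> f x = \<sigma> * x + \<tau>"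
    "c < d" "0 \<le> c" "d \<le> L" "d - c = \<bar>\<sigma>\<bar> * (b - a)" "f ` {a<..<b} = {c<..<d}"
    "pushes f a b [(1 / \<bar>\<sigma>\<bar>, c, d)]"
proof -
  obtain \<sigma> \<tau> where st: "lam \<le> \<bar>\<sigma>\<bar>" "\<And>x. x \<in> {a<..<b} \<Longrightarrow> f x = \<sigma> * x + \<tau>"
    using affine[OF ab] by blast
  have s0: "\<sigma> \<noteq> 0" using st(1) lam_pos by auto
  define c where "c = min (\<sigma> * a + \<tau>) (\<sigma> * b + \<tau>)"
  define d where "d = max (\<sigma> * a + \<tau>) (\<sigma> * b + \<tau>)"
  note p = pushes_affine[OF ab(1) s0 st(2), folded c_def d_def]
  have "f ` {a<..<b} \<subseteq> {0..L}" using maps ab by force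
  hence "0 \<le> c" "d \<le> L" using p(1,3) by (auto simp: greaterThanLessThan_subseteq_atLeastAtMost_iff)
  thus ?thesis using that st p by blast
qed

text \<open>The cuts inside the interval leave one more affine piece than there are cuts, and the
  image of a piece with slope \<sigma> has weight 1 / \<bar>\<sigma>\<bar>, at most
  \<open>1 / lam\<close>.\<close>

lemma split_push:
  assumes "a < b" "0 \<le> a" "b \<le> L"
  shows "\<exists>J. valid_steps L J \<and> pushes f a b J \<and> step_weight J \<le> (real (card ({a<..<b} \<inter> F)) + 1) / lam"
proof -
  define Q where "Q a b \<longleftrightarrow>
    (\<exists>J. valid_steps L J \<and> pushes f a b J \<and> step_weight J \<le> (real (card ({a<..<b} \<inter> F)) + 1) / lam)" for a b
  have "0 \<le> a \<longrightarrow> b \<le> L \<longrightarrow> Q a b"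
  proof (rule interval_split_induct[OF finite_cuts _ _ assms(1)])
    fix a b :: real assume ab: "a < b" "{a<..<b} \<inter> F = {}"
    show "0 \<le> a \<longrightarrow> b \<le> L \<longrightarrow> Q a b"
    proof (intro impI)
      assume "0 \<le> a" "b \<le> L"
      then obtain \<sigma> \<tau> c d where s: "lam \<le> \<bar>\<sigma>\<bar>" "c < d" "0 \<le> c" "d \<le> L" "pushes f a b [(1 / \<bar>\<sigma>\<bar>, c, d)]"
        using affine_image[OF ab(1) _ _ ab(2)] by metis
      thus "Q a b"
        using lam_pos ab(2) unfolding Q_def by (intro exI[of _ "[(1 / \<bar>\<sigma>\<bar>, c, d)]"]) (auto simp: frac_le)
    qed
  next
    fix a c b
    assume c: "a < c" "c < b" "c \<in> F"
      and 1: "0 \<le> a \<longrightarrow> c \<le> L \<longrightarrow> Q a c"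
      and 2: "0 \<le> c \<longrightarrow> b \<le> L \<longrightarrow> Q c b"
    show "0 \<le> a \<longrightarrow> b \<le> L \<longrightarrow> Q a b"
    proof (intro impI)
      assume "0 \<le> a" "b \<le> L"
      then obtain J K where J: "valid_steps L J" "pushes f a c J" "step_weight J \<le> (real (card ({a<..<c} \<inter> F)) + 1) / lam"
        and K: "valid_steps L K" "pushes f c b K" "step_weight K \<le> (real (card ({c<..<b} \<inter> F)) + 1) / lam"
        using 1 2 c unfolding Q_def by auto
      have "{a<..<b} \<inter> F = insert c (({a<..<c} \<inter> F) \<union> ({c<..<b} \<inter> F))" using c by auto
      also have "card \<dots> = Suc (card (({a<..<c} \<inter> F) \<union> ({c<..<b} \<inter> F)))"
        using finite_cuts by (subst card_insert_disjoint) auto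
      also have "card (({a<..<c} \<inter> F) \<union> ({c<..<b} \<inter> F)) = card ({a<..<c} \<inter> F) + card ({c<..<b} \<inter> F)"
        using finite_cuts by (intro card_Un_disjoint) auto
      finally have "step_weight (J @ K) \<le> (real (card ({a<..<b} \<inter> F)) + 1) / lam"
        using J(3) K(3) by (simp add: add_divide_distrib)
      thus "Q a b"
        using J K pushes_split[OF c(1,2) J(2) K(2)] unfolding Q_def by (intro exI[of _ "J @ K"]) auto
    qed
  qed
  thus ?thesis using assms unfolding Q_def by blast
qed

lemma borel_vimage:
  assumes "E \<in> sets borel"
  shows "{0..L} \<inter> f -` E \<in> sets borel"
proof -
  have "{0..L} \<inter> f -` E = ({0<..<L} \<inter> f -` E) \<union> ({0, L} \<inter> f -` E)" using L_pos by auto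
  moreover have "{0<..<L} \<inter> f -` E \<in> sets borel"
    using split_push[of 0 L] L_pos assms by (auto simp: pushes_def)
  moreover have "finite ({0, L} \<inter> f -` E)" by simp
  hence "{0, L} \<inter> f -` E \<in> sets borel" by (rule sets.countable[OF _ countable_finite, rotated]) simp
  ultimately show ?thesis by (simp only: sets.Un)
qed

lemma measurable: "f \<in> measurable (restrict_space lborel {0..L}) (restrict_space lborel {0..L})"
proof (rule measurableI)
  fix A assume "A \<in> sets (restrict_space lborel {0..L})"
  hence "A \<in> sets borel" by (auto simp: sets_restrict_space_iff)
  thus "f -` A \<inter> space (restrict_space lborel {0..L}) \<in> sets (restrict_space lborel {0..L})"
    using borel_vimage by (simp add: sets_restrict_space_iff Int_commute)
qed (use maps in simp)

text \<open>An affine branch takes each value at most once. This keeps the set of cuts of every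
  iterate finite.\<close>

lemma finite_preimages:
  assumes "finite G"
  shows "finite {x \<in> {0..L} - F. f x \<in> G}"
proof -
  have "0 \<le> a \<longrightarrow> b \<le> L \<longrightarrow> finite {x \<in> {a<..<b} - F. f x \<in> G}" if "a < b" for a b
  proof (rule interval_split_induct[OF finite_cuts _ _ that])
    fix a b :: real assume ab: "a < b" "{a<..<b} \<inter> F = {}"
    show "0 \<le> a \<longrightarrow> b \<le> L \<longrightarrow> finite {x \<in> {a<..<b} - F. f x \<in> G}"
    proof (intro impI)
      assume b: "0 \<le> a" "b \<le> L"
      obtain \<sigma> \<tau> where st: "lam \<le> \<bar>\<sigma>\<bar>" "\<forall>x\<in>{a<..<b}. f x = \<sigma> * x + \<tau>"
        using affine[OF ab(1) b ab(2)] by blast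
      have "{x \<in> {a<..<b} - F. f x \<in> G} \<subseteq> (\<lambda>y. (y - \<tau>) / \<sigma>) ` G"
      proof
        fix x assume x: "x \<in> {x \<in> {a<..<b} - F. f x \<in> G}"
        hence "x = (f x - \<tau>) / \<sigma>" using st lam_pos by (auto simp: field_simps)
        thus "x \<in> (\<lambda>y. (y - \<tau>) / \<sigma>) ` G" using x by blast
      qed
      thus "finite {x \<in> {a<..<b} - F. f x \<in> G}" using assms finite_surj by blast
    qed
  next
    fix a c b assume c: "a < c" "c < b" "c \<in> F"
      "0 \<le> a \<longrightarrow> c \<le> L \<longrightarrow> finite {x \<in> {a<..<c} - F. f x \<in> G}"
      "0 \<le> c \<longrightarrow> b \<le> L \<longrightarrow> finite {x \<in> {c<..<b} - F. f x \<in> G}"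
    have "{x \<in> {a<..<b} - F. f x \<in> G} \<subseteq> {x \<in> {a<..<c} - F. f x \<in> G} \<union> {x \<in> {c<..<b} - F. f x \<in> G}"
    proof
      fix x assume "x \<in> {x \<in> {a<..<b} - F. f x \<in> G}"
      moreover from this c(3) have "x < c \<or> c < x" by (auto simp: neq_iff[symmetric])
      ultimately show "x \<in> {x \<in> {a<..<c} - F. f x \<in> G} \<union> {x \<in> {c<..<b} - F. f x \<in> G}" by auto
    qed
    thus "0 \<le> a \<longrightarrow> b \<le> L \<longrightarrow> finite {x \<in> {a<..<b} - F. f x \<in> G}"
      using c by (auto intro: finite_subset)
  qed
  from this[of 0 L] have "finite {x \<in> {0<..<L} - F. f x \<in> G}" using L_pos by simp
  moreover have "{x \<in> {0..L} - F. f x \<in> G} \<subseteq> {x \<in> {0<..<L} - F. f x \<in> G} \<union> {0, L}" by auto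
  ultimately show ?thesis by (auto intro: finite_subset)
qed

lemma funpow_maps: "x \<in> {0..L} \<Longrightarrow> (f ^^ n) x \<in> {0..L}"
  by (induction n) (use maps in auto)

lemma pw_affine_funpow: "\<exists>G. pw_affine_map L (f ^^ n) G (lam ^ n)"
proof (induction n)
  case 0
  have "pw_affine_map L (f ^^ 0) {} (lam ^ 0)"
  proof
    fix a b :: real
    have "lam ^ 0 \<le> \<bar>1\<bar> \<and> (\<forall>x\<in>{a<..<b}. (f ^^ 0) x = 1 * x + 0)" by simp
    thus "\<exists>\<sigma> \<tau>. lam ^ 0 \<le> \<bar>\<sigma>\<bar> \<and> (\<forall>x\<in>{a<..<b}. (f ^^ 0) x = \<sigma> * x + \<tau>)" by blast
  qed (use L_pos in auto)
  thus ?case by blast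
next
  case (Suc n)
  then obtain G where "pw_affine_map L (f ^^ n) G (lam ^ n)" by blast
  then interpret g: pw_affine_map L "f ^^ n" G "lam ^ n" .
  \<comment> \<open>Away from these points \<open>f\<close> is affine and its image interval
    contains no cut of \<open>f ^^ n\<close>, so two affine maps are composed and their slopes
    multiply.\<close>
  have "pw_affine_map L (f ^^ Suc n) (F \<union> {x \<in> {0..L} - F. f x \<in> G}) (lam ^ Suc n)"
  proof
    show "finite (F \<union> {x \<in> {0..L} - F. f x \<in> G})"
      using finite_cuts finite_preimages[OF g.finite_cuts] by simp
    show "(f ^^ Suc n) x \<in> {0..L}" if "x \<in> {0..L}" for x using that by (rule funpow_maps)
    fix a b assume ab: "a < b" "0 \<le> a" "b \<le> L" "{a<..<b} \<inter> (F \<union> {x \<in> {0..L} - F. f x \<in> G}) = {}"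
    hence "{a<..<b} \<inter> F = {}" by blast
    then obtain \<sigma> \<tau> c d where 1: "lam \<le> \<bar>\<sigma>\<bar>" "\<And>x. x \<in> {a<..<b} \<Longrightarrow> f x = \<sigma> * x + \<tau>"
      "c < d" "0 \<le> c" "d \<le> L" "f ` {a<..<b} = {c<..<d}"
      using affine_image[OF ab(1-3)] by metis
    have "f x \<notin> G" if "x \<in> {a<..<b}" for x
      using that ab by auto
    hence "{c<..<d} \<inter> G = {}" using 1(6)[symmetric] by auto
    then obtain \<sigma>' \<tau>' where 2: "lam ^ n \<le> \<bar>\<sigma>'\<bar>" "\<And>x. x \<in> {c<..<d} \<Longrightarrow> (f ^^ n) x = \<sigma>' * x + \<tau>'"
      using g.affine[OF 1(3-5)] by blast
    have "lam ^ Suc n \<le> \<bar>\<sigma>' * \<sigma>\<bar>"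
      using mult_mono[OF 1(1) 2(1)] lam_pos by (simp add: abs_mult mult.commute)
    moreover have "(f ^^ Suc n) x = (\<sigma>' * \<sigma>) * x + (\<sigma>' * \<tau> + \<tau>')" if "x \<in> {a<..<b}" for x
    proof -
      have "f x \<in> {c<..<d}" using 1(6) that by blast
      thus ?thesis using 2(2)[of "f x"] 1(2)[OF that] by (simp only: funpow_Suc_right o_def) (simp add: algebra_simps)
    qed
    ultimately show "\<exists>\<sigma> \<tau>. lam ^ Suc n \<le> \<bar>\<sigma>\<bar> \<and> (\<forall>x\<in>{a<..<b}. (f ^^ Suc n) x = \<sigma> * x + \<tau>)" by blast
  qed (use L_pos lam_pos in auto)
  thus ?case by blast
qed

lemma measure_vimage_le:
  assumes E: "E \<in> sets borel" "E \<subseteq> {0..L}"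
  shows "measure lborel ({0..L} \<inter> f -` E) \<le> ((real (card F) + 1) / lam) * measure lborel E"
proof -
  obtain J where J: "valid_steps L J" "pushes f 0 L J" "step_weight J \<le> (real (card ({0<..<L} \<inter> F)) + 1) / lam"
    using split_push[of 0 L] L_pos by auto
  have fm: "E \<in> fmeasurable lborel"
    using E by (rule fmeasurable_subset_interval)
  have "step_measure J E \<le> step_weight J * measure lborel E"
    by (rule step_measure_le[OF J(1) E(1) fm])
  moreover have "measure lborel ({0..L} \<inter> f -` E) = measure lborel ({0<..<L} \<inter> f -` E)"
  proof -
    have "{0..L} \<inter> f -` E = ({0<..<L} \<inter> f -` E) \<union> ({0, L} \<inter> f -` E)" using L_pos by auto
    moreover have "{0, L} \<inter> f -` E \<in> null_sets lborel"
      by (intro countable_imp_null_set_lborel countable_finite) auto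
    ultimately show ?thesis using J(2) E(1) by (auto simp: pushes_def measure_Un_null_set)
  qed
  moreover have "step_weight J \<le> (real (card F) + 1) / lam"
  proof -
    have "card ({0<..<L} \<inter> F) \<le> card F" using finite_cuts by (intro card_mono) auto
    hence "(real (card ({0<..<L} \<inter> F)) + 1) / lam \<le> (real (card F) + 1) / lam"
      using lam_pos by (intro divide_right_mono) auto
    thus ?thesis using J(3) by linarith
  qed
  ultimately show ?thesis
    using J(2) E(1) mult_right_mono[of "step_weight J" "(real (card F) + 1) / lam" "measure lborel E"]
    by (simp add: pushes_def)
qed

text \<open>The Lasota--Yorke inequality for step densities: a short interval contains at most one cut,
  so its image has at most two pieces, of total weight at most \<open>1/2\<close> when the slopes are at least 4.\<close>

lemma lasota_yorke:
  assumes lam4: "4 \<le> lam"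
  shows "\<exists>C>0. \<forall>a b. a < b \<and> 0 \<le> a \<and> b \<le> L \<longrightarrow>
    (\<exists>J. valid_steps L J \<and> pushes f a b J \<and> step_weight J \<le> 1 / 2 + C * (b - a))"
proof -
  \<comment> \<open>\<delta> is at most the least distance between two cuts; the entry 1 covers the
    case of fewer than two cuts.\<close>
  define D where "D = insert 1 ((\<lambda>(x, y). \<bar>x - y\<bar>) ` {(x, y) \<in> F \<times> F. x \<noteq> y})"
  define \<delta> where "\<delta> = Min D"
  have "finite {(x, y) \<in> F \<times> F. x \<noteq> y}"
    by (rule finite_subset[of _ "F \<times> F"]) (use finite_cuts in auto)
  hence D: "finite D" "D \<noteq> {}" by (simp_all add: D_def)
  have "\<delta> \<in> D" unfolding \<delta>_def using D by (rule Min_in)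
  hence \<delta>: "\<delta> > 0" by (auto simp: D_def)
  have sep: "\<delta> \<le> \<bar>x - y\<bar>" if "x \<in> F" "y \<in> F" "x \<noteq> y" for x y
    unfolding \<delta>_def by (rule Min_le[OF D(1)]) (use that in \<open>auto simp: D_def\<close>)
  \<comment> \<open>\<open>C * \<delta>\<close> bounds the number of pieces of any interval, which
    serves the intervals longer than \<delta>.\<close>
  define C where "C = (real (card F) + 1) / \<delta>"
  have C: "C > 0" using \<delta> by (simp add: C_def)
  have "\<exists>J. valid_steps L J \<and> pushes f a b J \<and> step_weight J \<le> 1 / 2 + C * (b - a)"
    if ab: "a < b" "0 \<le> a" "b \<le> L" for a b
  proof -
    obtain J where J: "valid_steps L J" "pushes f a b J" "step_weight J \<le> (real (card ({a<..<b} \<inter> F)) + 1) / lam"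
      using split_push[OF ab] by blast
    have "(real (card ({a<..<b} \<inter> F)) + 1) / lam \<le> (real (card ({a<..<b} \<inter> F)) + 1) / 4"
      using lam4 by (intro divide_left_mono) auto
    moreover have "(real (card ({a<..<b} \<inter> F)) + 1) / 4 \<le> 1 / 2 + C * (b - a)"
    proof (cases "b - a \<le> \<delta>")
      case True
      have "card ({a<..<b} \<inter> F) \<le> Suc 0"
        unfolding card_le_Suc0_iff_eq[OF finite_Int[OF disjI2[OF finite_cuts]]]
      proof (intro ballI, rule ccontr)
        fix x y assume "x \<in> {a<..<b} \<inter> F" "y \<in> {a<..<b} \<inter> F" "x \<noteq> y"
        thus False using sep[of x y] True by (auto simp: abs_if split: if_splits)
      qed
      moreover have "0 \<le> C * (b - a)" using C ab by simp
      ultimately show ?thesis by (simp add: field_simps)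
    next
      case False
      have "card ({a<..<b} \<inter> F) \<le> card F" using finite_cuts by (intro card_mono) auto
      hence "(real (card ({a<..<b} \<inter> F)) + 1) / 4 \<le> real (card F) + 1" by simp
      also have "\<dots> = C * \<delta>" using \<delta> by (simp add: C_def)
      also have "\<dots> \<le> C * (b - a)" using C False by (intro mult_left_mono) auto
      finally show ?thesis by simp
    qed
    ultimately show ?thesis using J by (meson order_trans)
  qed
  thus ?thesis using C by blast
qed

text \<open>A triple contributes at most w / 2 + C * w * (b - a), and the second terms add up to
  \<open>C\<close> times the mass of the step density. So the weight is halved up to a multiple of a
  quantity that \<open>f\<close> conserves.\<close>

lemma steps_push:
  assumes C: "\<And>a b. \<lbrakk>a < b; 0 \<le> a; b \<le> L\<rbrakk> \<Longrightarrow>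
      \<exists>J. valid_steps L J \<and> pushes f a b J \<and> step_weight J \<le> 1 / 2 + C * (b - a)"
    and J: "valid_steps L J"
  shows "\<exists>K. valid_steps L K \<and> step_weight K \<le> step_weight J / 2 + C * step_measure J UNIV \<and>
    (\<forall>E\<in>sets borel. step_measure K E = step_measure J ({0..L} \<inter> f -` E))"
  using J
proof (induction J)
  case Nil
  show ?case by (rule exI[of _ "[]"]) simp
next
  case (Cons t J)
  obtain w a b where t: "t = (w, a, b)" by (cases t)
  obtain K where K: "valid_steps L K" "step_weight K \<le> step_weight J / 2 + C * step_measure J UNIV"
    "\<And>E. E \<in> sets borel \<Longrightarrow> step_measure K E = step_measure J ({0..L} \<inter> f -` E)"
    using Cons by (auto simp: t)
  have w: "0 \<le> w" "a < b" "0 \<le> a" "b \<le> L" using Cons.prems by (auto simp: t)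
  obtain I where I: "valid_steps L I" "pushes f a b I" "step_weight I \<le> 1 / 2 + C * (b - a)"
    using C[OF w(2-4)] by blast
  define I' where "I' = map (\<lambda>(v, ab). (w * v, ab)) I"
  have "valid_steps L (I' @ K)" using step_scale(3)[OF w(1) I(1)] K(1) by (simp add: I'_def)
  moreover have "step_weight I' = w * step_weight I" by (simp only: I'_def step_scale)
  hence "step_weight (I' @ K) \<le> step_weight (t # J) / 2 + C * step_measure (t # J) UNIV"
    using K(2) mult_left_mono[OF I(3) w(1)] w by (simp add: t algebra_simps add_divide_distrib)
  moreover have "step_measure (I' @ K) E = step_measure (t # J) ({0..L} \<inter> f -` E)" if "E \<in> sets borel" for E
  proof -
    have "{a<..<b} \<inter> ({0..L} \<inter> f -` E) = {a<..<b} \<inter> f -` E" using w by auto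
    thus ?thesis using I(2) K(3) that by (simp add: t I'_def step_scale pushes_def)
  qed
  ultimately show ?case by blast
qed

lemma lasota_yorke_iterated:
  assumes lam4: "4 \<le> lam"
  shows "\<exists>C>0. \<forall>n a b. a < b \<and> 0 \<le> a \<and> b \<le> L \<longrightarrow>
    (\<exists>J. valid_steps L J \<and> pushes (f ^^ n) a b J \<and> step_weight J \<le> (1 / 2) ^ n + C * (b - a))"
proof -
  obtain C where C: "C > 0" "\<And>a b. \<lbrakk>a < b; 0 \<le> a; b \<le> L\<rbrakk> \<Longrightarrow>
      \<exists>J. valid_steps L J \<and> pushes f a b J \<and> step_weight J \<le> 1 / 2 + C * (b - a)"
    using lasota_yorke[OF lam4] by blast
  \<comment> \<open>The mass stays equal to b - a, so the added terms form a geometric series with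
    sum at most \<open>2 * C * (b - a)\<close>.\<close>
  have "\<exists>J. valid_steps L J \<and> pushes (f ^^ n) a b J \<and> step_weight J \<le> (1 / 2) ^ n + 2 * C * (b - a)"
    if ab: "a < b" "0 \<le> a" "b \<le> L" for n a b
  proof (induction n)
    case 0
    have "pushes (\<lambda>x. x) a b [(1, a, b)]" by (simp add: pushes_def)
    thus ?case using ab C(1) by (intro exI[of _ "[(1, a, b)]"]) (auto simp: id_def)
  next
    case (Suc n)
    then obtain J where J: "valid_steps L J" "pushes (f ^^ n) a b J" "step_weight J \<le> (1 / 2) ^ n + 2 * C * (b - a)"
      by blast
    obtain K where K: "valid_steps L K" "step_weight K \<le> step_weight J / 2 + C * step_measure J UNIV"
      "\<And>E. E \<in> sets borel \<Longrightarrow> step_measure K E = step_measure J ({0..L} \<inter> f -` E)"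
      using steps_push[OF C(2) J(1)] by blast
    have mass: "step_measure J UNIV = b - a"
      using J(2) ab by (auto simp: pushes_def dest!: bspec[of _ _ UNIV])
    have "pushes (f ^^ Suc n) a b K"
      unfolding pushes_def
    proof (intro ballI)
      fix E :: "real set" assume E: "E \<in> sets borel"
      have "(f ^^ n) x \<in> {0..L}" if "x \<in> {a<..<b}" for x using that ab by (intro funpow_maps) auto
      hence eq: "{a<..<b} \<inter> (f ^^ Suc n) -` E = {a<..<b} \<inter> (f ^^ n) -` ({0..L} \<inter> f -` E)" by auto
      have "{0..L} \<inter> f -` E \<in> sets borel" using E by (rule borel_vimage)
      thus "{a<..<b} \<inter> (f ^^ Suc n) -` E \<in> sets borel \<and>
        measure lborel ({a<..<b} \<inter> (f ^^ Suc n) -` E) = step_measure K E"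
        unfolding eq using J(2) K(3)[OF E] unfolding pushes_def by auto
    qed
    moreover have "step_weight K \<le> (1 / 2) ^ Suc n + 2 * C * (b - a)"
      using K(2) J(3) mass by (simp add: algebra_simps)
    ultimately show ?case using K(1) by blast
  qed
  thus ?thesis using C(1) by (intro exI[of _ "2 * C"]) auto
qed

end

section \<open>Expanding maps: bounded image densities and growth of images\<close>

locale expanding_map = pw_affine_map +
  assumes expanding: "1 < lam"
begin

text \<open>Some power of \<open>lam\<close> exceeds 4, so the inequality holds for an iterate of
  \<open>f\<close>; the estimates below run along the multiples of \<open>N\<close>.\<close>

lemma lasota_yorke_power:
  obtains N C where "N \<ge> 1" "C > 0"
    "\<And>n a b. \<lbrakk>a < b; 0 \<le> a; b \<le> L\<rbrakk> \<Longrightarrow> \<exists>J. valid_steps L J \<and> pushes (f ^^ (N * n)) a b J \<and>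
       step_weight J \<le> (1 / 2) ^ n + C * (b - a)"
proof -
  obtain N where N: "4 < lam ^ N" using real_arch_pow[OF expanding] by blast
  hence "N \<ge> 1" by (cases N) auto
  obtain G where "pw_affine_map L (f ^^ N) G (lam ^ N)" using pw_affine_funpow by blast
  then interpret g: pw_affine_map L "f ^^ N" G "lam ^ N" .
  show ?thesis
    using g.lasota_yorke_iterated N \<open>N \<ge> 1\<close> that unfolding funpow_mult by (metis less_imp_le)
qed

text \<open>Along the multiples of \<open>N\<close> the weight, and with it the density, is at most
  \<open>1 + C * L\<close>. The remaining steps, fewer than \<open>N\<close>, are covered by the
  crude bound for a single step.\<close>

lemma bounded_pushforward:
  "\<exists>K. \<forall>n. \<forall>E\<in>sets borel. E \<subseteq> {0..L} \<longrightarrow>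
     measure lborel ({0..L} \<inter> (f ^^ n) -` E) \<le> K * measure lborel E"
proof -
  obtain N C where NC: "N \<ge> 1" "C > 0"
    "\<And>n a b. \<lbrakk>a < b; 0 \<le> a; b \<le> L\<rbrakk> \<Longrightarrow> \<exists>J. valid_steps L J \<and> pushes (f ^^ (N * n)) a b J \<and>
       step_weight J \<le> (1 / 2) ^ n + C * (b - a)"
    using lasota_yorke_power by blast
  \<comment> \<open>The maximum with 1 gives \<open>K1 ^ r \<le> K1 ^ N\<close> for the remainder
    \<open>r\<close>.\<close>
  define K1 where "K1 = max 1 ((real (card F) + 1) / lam)"
  have K1: "K1 \<ge> 1" by (simp add: K1_def)
  define K where "K = (1 + C * L) * K1 ^ N"
  have main: "measure lborel ({0..L} \<inter> (f ^^ (N * n)) -` E) \<le> (1 + C * L) * measure lborel E"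
    if E: "E \<in> sets borel" "E \<subseteq> {0..L}" for n E
  proof -
    obtain J where J: "valid_steps L J" "pushes (f ^^ (N * n)) 0 L J" "step_weight J \<le> (1 / 2) ^ n + C * (L - 0)"
      using NC(3)[of 0 L n] L_pos by auto
    have fm: "E \<in> fmeasurable lborel"
      using E by (rule fmeasurable_subset_interval)
    have "step_measure J E \<le> step_weight J * measure lborel E"
      by (rule step_measure_le[OF J(1) E(1) fm])
    moreover have "measure lborel ({0..L} \<inter> (f ^^ (N * n)) -` E) = measure lborel ({0<..<L} \<inter> (f ^^ (N * n)) -` E)"
    proof -
      have "{0..L} \<inter> (f ^^ (N * n)) -` E = ({0<..<L} \<inter> (f ^^ (N * n)) -` E) \<union> ({0, L} \<inter> (f ^^ (N * n)) -` E)"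
        using L_pos by auto
      moreover have "{0, L} \<inter> (f ^^ (N * n)) -` E \<in> null_sets lborel"
        by (intro countable_imp_null_set_lborel countable_finite) auto
      ultimately show ?thesis using J(2) E(1) by (auto simp: pushes_def measure_Un_null_set)
    qed
    moreover have "(1 / 2 :: real) ^ n \<le> 1" by (rule power_le_one) auto
    hence "step_weight J \<le> 1 + C * L" using J(3) by simp
    ultimately show ?thesis
      using J(2) E(1) mult_right_mono[of "step_weight J" "1 + C * L" "measure lborel E"]
      by (simp add: pushes_def)
  qed
  have rest: "{0..L} \<inter> (f ^^ r) -` E \<in> sets borel \<and> {0..L} \<inter> (f ^^ r) -` E \<subseteq> {0..L} \<and>
    measure lborel ({0..L} \<inter> (f ^^ r) -` E) \<le> K1 ^ r * measure lborel E"
    if E: "E \<in> sets borel" "E \<subseteq> {0..L}" for r E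
  proof (induction r)
    case 0
    then show ?case using E by (simp add: Int_absorb1)
  next
    case (Suc r)
    define E' where "E' = {0..L} \<inter> (f ^^ r) -` E"
    have eq: "{0..L} \<inter> (f ^^ Suc r) -` E = {0..L} \<inter> f -` E'"
      using maps by (auto simp: E'_def funpow_swap1)
    have E': "E' \<in> sets borel" "E' \<subseteq> {0..L}" "measure lborel E' \<le> K1 ^ r * measure lborel E"
      using Suc by (auto simp: E'_def)
    have "measure lborel ({0..L} \<inter> f -` E') \<le> ((real (card F) + 1) / lam) * measure lborel E'"
      by (rule measure_vimage_le[OF E'(1,2)])
    also have "\<dots> \<le> K1 * measure lborel E'" by (intro mult_right_mono) (auto simp: K1_def)
    also have "\<dots> \<le> K1 * (K1 ^ r * measure lborel E)" using E'(3) K1 by (intro mult_left_mono) auto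
    finally show ?case unfolding eq using borel_vimage[OF E'(1)] by (simp add: mult.assoc)
  qed
  have "measure lborel ({0..L} \<inter> (f ^^ n) -` E) \<le> K * measure lborel E"
    if E: "E \<in> sets borel" "E \<subseteq> {0..L}" for n E
  proof -
    define r where "r = n mod N"
    define E' where "E' = {0..L} \<inter> (f ^^ r) -` E"
    have n: "n = r + N * (n div N)" by (simp add: r_def)
    have "(f ^^ n) x = (f ^^ r) ((f ^^ (N * (n div N))) x)" for x
      by (subst n) (simp only: funpow_add o_def)
    hence eq: "{0..L} \<inter> (f ^^ n) -` E = {0..L} \<inter> (f ^^ (N * (n div N))) -` E'"
      using funpow_maps by (auto simp: E'_def)
    have E': "E' \<in> sets borel" "E' \<subseteq> {0..L}" "measure lborel E' \<le> K1 ^ r * measure lborel E"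
      using rest[OF E, of r] by (auto simp: E'_def)
    have "r \<le> N" using NC(1) by (simp add: r_def less_imp_le)
    have "measure lborel ({0..L} \<inter> (f ^^ n) -` E) \<le> (1 + C * L) * measure lborel E'"
      unfolding eq by (rule main[OF E'(1,2)])
    also have "\<dots> \<le> (1 + C * L) * (K1 ^ r * measure lborel E)"
      using E'(3) NC(2) L_pos by (intro mult_left_mono) auto
    also have "\<dots> \<le> (1 + C * L) * (K1 ^ N * measure lborel E)"
      using NC(2) L_pos power_increasing[OF \<open>r \<le> N\<close> K1] by (intro mult_left_mono mult_right_mono) auto
    finally show ?thesis by (simp add: K_def mult.assoc)
  qed
  thus ?thesis by blast
qed

text \<open>Start from an interval in which \<open>A\<close> is dense. After many steps at least half of its mass
  is carried by images of length at least \<open>\<delta>\<close>, so one of these is nearly contained in \<open>E n\<close>.\<close>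

lemma growth:
  "\<exists>\<delta>>0. \<forall>A E. A \<in> sets borel \<and> A \<subseteq> {0..L} \<and> measure lborel A > 0 \<and>
     (\<forall>n. E n \<in> sets borel \<and> A \<subseteq> (f ^^ n) -` E n) \<longrightarrow>
     (\<forall>\<epsilon>>0. \<exists>n c d. 0 \<le> c \<and> d \<le> L \<and> \<delta> \<le> d - c \<and> measure lborel ({c<..<d} - E n) \<le> \<epsilon> * (d - c))"
proof -
  obtain N C where NC: "N \<ge> 1" "C > 0"
    "\<And>n a b. \<lbrakk>a < b; 0 \<le> a; b \<le> L\<rbrakk> \<Longrightarrow> \<exists>J. valid_steps L J \<and> pushes (f ^^ (N * n)) a b J \<and>
       step_weight J \<le> (1 / 2) ^ n + C * (b - a)"
    using lasota_yorke_power by blast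
  \<comment> \<open>Once the weight is at most \<open>2 * C * (b - a)\<close>, the pieces shorter
    than \<open>1 / (8 * C)\<close> carry at most a quarter of the mass b - a.\<close>
  define \<delta> where "\<delta> = 1 / (8 * C)"
  have \<delta>: "\<delta> > 0" using NC(2) by (simp add: \<delta>_def)
  have "\<exists>n c d. 0 \<le> c \<and> d \<le> L \<and> \<delta> \<le> d - c \<and> measure lborel ({c<..<d} - E n) \<le> \<epsilon> * (d - c)"
    if A: "A \<in> sets borel" "A \<subseteq> {0..L}" "measure lborel A > 0"
      and E: "\<And>n. E n \<in> sets borel" "\<And>n. A \<subseteq> (f ^^ n) -` E n" and \<epsilon>: "\<epsilon> > 0" for A E \<epsilon>
  proof (rule ccontr)
    assume no: "\<not> ?thesis"
    \<comment> \<open>If every long image missed \<open>E (N * n)\<close> at the rate \<epsilon>,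
      the interval would miss \<open>A\<close> in at least 3 / 4 * \<epsilon> of its length; it is
      therefore chosen with a loss of at most \<epsilon> / 2.\<close>
    obtain a b where ab: "a < b" "0 \<le> a" "b \<le> L" "measure lborel ({a<..<b} - A) \<le> (\<epsilon> / 2) * (b - a)"
      using lebesgue_dense_interval[OF L_pos A, of "\<epsilon> / 2"] \<epsilon> by auto
    obtain n where n: "(1 / 2 :: real) ^ n < C * (b - a)"
      using real_arch_pow_inv[of "C * (b - a)" "1 / 2"] NC(2) ab(1) by auto
    obtain J where J: "valid_steps L J" "pushes (f ^^ (N * n)) a b J" "step_weight J \<le> (1 / 2) ^ n + C * (b - a)"
      using NC(3)[OF ab(1-3)] by blast
    define B where "B = - E (N * n)"
    have B: "B \<in> sets borel" using E(1) by (simp add: B_def)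
    have mass: "step_measure J UNIV = b - a"
      using J(2) ab by (auto simp: pushes_def dest!: bspec[of _ _ UNIV])
    \<comment> \<open>\<open>step_measure J UNIV - \<delta> * step_weight J\<close> underestimates
      the mass of the long pieces, because a piece shorter than \<delta> enters it with a
      nonpositive term.\<close>
    have "\<epsilon> * (step_measure J UNIV - \<delta> * step_weight J) \<le> step_measure J B"
      using J(1)
    proof (induction J)
      case (Cons t J)
      obtain w c d where t: "t = (w, c, d)" by (cases t)
      have w: "0 \<le> w" "c < d" "0 \<le> c" "d \<le> L" using Cons.prems by (auto simp: t)
      have "\<epsilon> * (d - c - \<delta>) \<le> measure lborel ({c<..<d} \<inter> B)"
      proof (cases "\<delta> \<le> d - c")
        case True
        hence "\<epsilon> * (d - c) < measure lborel ({c<..<d} - E (N * n))"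
          using no w by (meson not_le)
        moreover have "\<epsilon> * (d - c - \<delta>) \<le> \<epsilon> * (d - c)" using \<epsilon> \<delta> by simp
        ultimately show ?thesis by (simp add: B_def Diff_eq)
      next
        case False
        hence "\<epsilon> * (d - c - \<delta>) \<le> 0" using \<epsilon> by (intro mult_nonneg_nonpos) auto
        thus ?thesis using measure_nonneg order_trans by blast
      qed
      from mult_left_mono[OF this w(1)] show ?case
        using Cons w by (simp add: t algebra_simps)
    qed simp
    also have "step_measure J B = measure lborel ({a<..<b} \<inter> (f ^^ (N * n)) -` B)"
      using J(2) B by (simp add: pushes_def)
    also have "\<dots> \<le> measure lborel ({a<..<b} - A)"
    proof (rule measure_mono_fmeasurable)
      show "{a<..<b} \<inter> (f ^^ (N * n)) -` B \<subseteq> {a<..<b} - A" using E(2)[of "N * n"] by (auto simp: B_def)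
      show "{a<..<b} - A \<in> fmeasurable lborel"
        using fmeasurable_Int_interval[of "- A" a b] A(1) by (simp add: Diff_eq)
      show "{a<..<b} \<inter> (f ^^ (N * n)) -` B \<in> sets lborel" using J(2) B by (simp add: pushes_def)
    qed
    finally have "\<epsilon> * (step_measure J UNIV - \<delta> * step_weight J) \<le> (\<epsilon> / 2) * (b - a)"
      using ab(4) by (rule order_trans)
    hence 1: "\<epsilon> * (b - a - \<delta> * step_weight J) \<le> (\<epsilon> / 2) * (b - a)" by (simp only: mass)
    have "\<delta> * step_weight J \<le> \<delta> * (2 * C * (b - a))" using J(3) n \<delta> by (intro mult_left_mono) auto
    also have "\<dots> = (b - a) / 4" using NC(2) by (simp add: \<delta>_def)
    finally have "\<epsilon> * ((3 / 4) * (b - a)) \<le> \<epsilon> * (b - a - \<delta> * step_weight J)"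
      using \<epsilon> by (intro mult_left_mono) auto
    with 1 have "\<epsilon> * ((3 / 4) * (b - a)) \<le> \<epsilon> * ((1 / 2) * (b - a))" by simp
    thus False using \<epsilon> ab(1) by simp
  qed
  thus ?thesis using \<delta> by (intro exI[of _ \<delta>]) blast
qed

end

text \<open>The complement of the support is covered by those sets of a countable base that are
  null.\<close>

lemma AE_measure_support:
  fixes M :: "'a::second_countable_topology measure"
  assumes sets: "sets M = sets (restrict_space borel S)"
  shows "AE x in M. x \<in> measure_support M"
proof -
  obtain B :: "'a set set" where B: "countable B" "\<And>U. open U \<Longrightarrow> \<exists>A\<subseteq>B. U = \<Union>A" "\<And>U. U \<in> B \<Longrightarrow> open U"
    using univ_second_countable by metis
  define N where "N = (\<Union>U\<in>{U \<in> B. emeasure M (U \<inter> space M) = 0}. U \<inter> space M)"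
  have sp: "space M = S" using sets_eq_imp_space_eq[OF sets] by (simp add: space_restrict_space)
  have s: "U \<inter> space M \<in> sets M" if "open U" for U
  proof -
    have "U \<in> sets borel" using that by simp
    thus ?thesis unfolding sets sp sets_restrict_space by (auto simp: Int_commute)
  qed
  have "N \<in> null_sets M"
    unfolding N_def using B(1,3) s by (intro null_sets_UN') (auto simp: null_sets_def)
  thus ?thesis
  proof (rule AE_I', intro subsetI)
    fix x assume "x \<in> {x \<in> space M. x \<notin> measure_support M}"
    then obtain U where U: "open U" "x \<in> U" "emeasure M (U \<inter> space M) = 0" "x \<in> space M"
      by (auto simp: measure_support_def)
    obtain \<A> where "\<A> \<subseteq> B" "U = \<Union>\<A>" using B(2)[OF U(1)] by blast
    with U(2) obtain V where V: "V \<in> B" "x \<in> V" "V \<subseteq> U" by blast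
    have "emeasure M (V \<inter> space M) = 0"
      by (rule emeasure_eq_0[OF s[OF U(1)] U(3)]) (use V in auto)
    thus "x \<in> N" using V U by (auto simp: N_def)
  qed
qed

text \<open>The points whose orbit is eventually in \<open>X\<close> at even times and in \<open>Y\<close> at odd times form a
  tail set, and so do those with \<open>X\<close> and \<open>Y\<close> interchanged. An odd iterate of \<open>f\<close> interchanges the
  two tail sets, so it is not exact.\<close>

lemma even_mixing_period:
  fixes \<mu> :: "'a::topological_space measure"
  assumes prob: "prob_space \<mu>" and inv: "invariant_under f \<mu>"
    and supp: "AE x in \<mu>. x \<in> measure_support \<mu>"
    and XY: "X \<in> sets \<mu>" "Y \<in> sets \<mu>" "X \<inter> Y = {}"
    and alt: "AE x in \<mu>. x \<in> X \<and> f x \<in> Y \<or> x \<in> Y \<and> f x \<in> X"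
    and mix: "mixing_components f \<mu> k \<Sigma>"
  shows "even k"
proof (rule ccontr)
  assume odd: "odd k"
  interpret prob_space \<mu> by fact
  have f: "f \<in> measurable \<mu> \<mu>" using inv by (simp add: invariant_under_def)
  have fn[measurable]: "f ^^ n \<in> measurable \<mu> \<mu>" for n by (rule measurable_funpow[OF f])
  note XY(1,2)[measurable]
  have k: "k \<ge> 1" and \<Sigma>[measurable]: "\<And>j. j < k \<Longrightarrow> \<Sigma> j \<in> sets \<mu>"
    and un: "AE x in \<mu>. x \<in> measure_support \<mu> \<longleftrightarrow> x \<in> (\<Union>j<k. \<Sigma> j)"
    and cyc: "\<And>j. j < k \<Longrightarrow> AE x in \<mu>. x \<in> \<Sigma> j \<longleftrightarrow> f x \<in> \<Sigma> (Suc j mod k)"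
    and ex: "exact (f ^^ k) (uniform_measure \<mu> (\<Sigma> 0))"
    using mix by (auto simp: mixing_components_def)
  have eq: "measure \<mu> (\<Sigma> j) = measure \<mu> (\<Sigma> 0)" if "j < k" for j
    using that
  proof (induction j)
    case (Suc j)
    have "measure \<mu> (\<Sigma> j) = measure \<mu> ((f ^^ 1) -` \<Sigma> (Suc j) \<inter> space \<mu>)"
    proof (rule measure_eq_AE)
      show "AE x in \<mu>. x \<in> \<Sigma> j \<longleftrightarrow> x \<in> (f ^^ 1) -` \<Sigma> (Suc j) \<inter> space \<mu>"
        using cyc[OF Suc_lessD[OF Suc.prems]] AE_space by eventually_elim (use Suc.prems in auto)
    qed (use Suc.prems \<Sigma> f in \<open>auto intro!: measurable_sets\<close>)
    also have "\<dots> = measure \<mu> (\<Sigma> (Suc j))" using Suc.prems by (intro measure_funpow_vimage[OF inv] \<Sigma>)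
    finally show ?case using Suc by simp
  qed simp
  \<comment> \<open>All components have the same measure, so a null \<open>\<Sigma> 0\<close> would
    make the support null.\<close>
  have pos: "measure \<mu> (\<Sigma> 0) > 0"
  proof (rule ccontr)
    assume "\<not> ?thesis"
    hence "\<Sigma> j \<in> null_sets \<mu>" if "j < k" for j
      using eq[OF that] that \<Sigma> by (auto simp: null_sets_def emeasure_eq_measure zero_less_measure_iff)
    hence "(\<Union>j<k. \<Sigma> j) \<in> null_sets \<mu>" by (intro null_sets_UN' countable_finite) auto
    hence "AE x in \<mu>. x \<notin> (\<Union>j<k. \<Sigma> j)" by (rule AE_not_in)
    with supp un have "AE x in \<mu>. False" by eventually_elim auto
    thus False by simp
  qed
  \<comment> \<open>Eventual membership makes the preimage of \<open>A\<close> equal to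
    \<open>B\<close> and conversely, exactly and not only almost everywhere, as the equations in the
    definition of the tail algebra demand.\<close>
  define A where "A = {x \<in> space \<mu>. \<exists>N. \<forall>n\<ge>N. (f ^^ (2 * n)) x \<in> X \<and> (f ^^ Suc (2 * n)) x \<in> Y}"
  define B where "B = {x \<in> space \<mu>. \<exists>N. \<forall>n\<ge>N. (f ^^ (2 * n)) x \<in> Y \<and> (f ^^ Suc (2 * n)) x \<in> X}"
  have [measurable]: "A \<in> sets \<mu>" "B \<in> sets \<mu>" unfolding A_def B_def by measurable
  have shift: "(\<exists>N. \<forall>n\<ge>N. (f ^^ (2 * n)) (f x) \<in> U \<and> (f ^^ Suc (2 * n)) (f x) \<in> V) \<longleftrightarrow>
      (\<exists>N. \<forall>n\<ge>N. (f ^^ (2 * n)) x \<in> V \<and> (f ^^ Suc (2 * n)) x \<in> U)" for U V x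
  proof
    assume "\<exists>N. \<forall>n\<ge>N. (f ^^ (2 * n)) (f x) \<in> U \<and> (f ^^ Suc (2 * n)) (f x) \<in> V"
    then obtain N where N: "\<And>n. n \<ge> N \<Longrightarrow> (f ^^ (2 * n)) (f x) \<in> U \<and> (f ^^ Suc (2 * n)) (f x) \<in> V" by blast
    have "(f ^^ (2 * n)) x \<in> V \<and> (f ^^ Suc (2 * n)) x \<in> U" if nN: "n \<ge> Suc N" for n
    proof -
      obtain l where l: "n = Suc l" using nN by (cases n) auto
      have 1: "(f ^^ Suc (2 * l)) (f x) \<in> V" using N[of l] nN l by auto
      have 2: "(f ^^ (2 * n)) (f x) \<in> U" using N[of n] nN by auto
      have "(f ^^ (2 * n)) x = (f ^^ Suc (2 * l)) (f x)" "(f ^^ Suc (2 * n)) x = (f ^^ (2 * n)) (f x)"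
        unfolding l by (simp_all only: funpow_Suc_right o_def mult_Suc_right add_2_eq_Suc)
      thus ?thesis using 1 2 by simp
    qed
    thus "\<exists>N. \<forall>n\<ge>N. (f ^^ (2 * n)) x \<in> V \<and> (f ^^ Suc (2 * n)) x \<in> U" by blast
  next
    assume "\<exists>N. \<forall>n\<ge>N. (f ^^ (2 * n)) x \<in> V \<and> (f ^^ Suc (2 * n)) x \<in> U"
    then obtain N where N: "\<And>n. n \<ge> N \<Longrightarrow> (f ^^ (2 * n)) x \<in> V \<and> (f ^^ Suc (2 * n)) x \<in> U" by blast
    have "(f ^^ (2 * n)) (f x) \<in> U \<and> (f ^^ Suc (2 * n)) (f x) \<in> V" if "n \<ge> N" for n
    proof -
      have "(f ^^ Suc (2 * n)) x = (f ^^ (2 * n)) (f x)" "(f ^^ (2 * Suc n)) x = (f ^^ Suc (2 * n)) (f x)"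
        by (simp_all only: funpow_Suc_right o_def mult_Suc_right add_2_eq_Suc)
      thus ?thesis using N[of n] N[of "Suc n"] that by simp
    qed
    thus "\<exists>N. \<forall>n\<ge>N. (f ^^ (2 * n)) (f x) \<in> U \<and> (f ^^ Suc (2 * n)) (f x) \<in> V" by blast
  qed
  have fA: "f x \<in> A \<longleftrightarrow> x \<in> B" and fB: "f x \<in> B \<longleftrightarrow> x \<in> A" if "x \<in> space \<mu>" for x
    using that measurable_space[OF f that] shift[of x X Y] shift[of x Y X] by (simp_all add: A_def B_def)
  have fnA: "(f ^^ n) -` A \<inter> space \<mu> = (if even n then A else B)" for n
  proof -
    have "(f ^^ n) x \<in> A \<longleftrightarrow> x \<in> (if even n then A else B)" if "x \<in> space \<mu>" for x
    proof (induction n)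
      case (Suc n)
      have "(f ^^ n) x \<in> B \<longleftrightarrow> x \<in> (if even n then B else A)" if "x \<in> space \<mu>" for x n
        using that
      proof (induction n arbitrary: x)
        case (Suc n)
        thus ?case using fA fB measurable_space[OF f] by (auto simp: funpow_swap1 simp del: funpow.simps)
          (auto simp: funpow_swap1)
      qed simp
      from this[of x n] show ?case using fA[of "(f ^^ n) x"] that measurable_space[OF fn that] by auto
    qed simp
    thus ?thesis using sets.sets_into_space[of A \<mu>] sets.sets_into_space[of B \<mu>] by auto
  qed
  have AB0: "A \<inter> B = {}"
  proof (rule equals0I)
    fix x assume "x \<in> A \<inter> B"
    then obtain N M where "\<forall>n\<ge>N. (f ^^ (2 * n)) x \<in> X" "\<forall>n\<ge>M. (f ^^ (2 * n)) x \<in> Y"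
      unfolding A_def B_def by blast
    hence "(f ^^ (2 * max N M)) x \<in> X \<inter> Y" by auto
    thus False using XY(3) by auto
  qed
  have AEAB: "AE x in \<mu>. x \<in> A \<union> B"
  proof -
    have "AE x in \<mu>. \<forall>n. (f ^^ n) x \<in> X \<and> f ((f ^^ n) x) \<in> Y \<or> (f ^^ n) x \<in> Y \<and> f ((f ^^ n) x) \<in> X"
      unfolding AE_all_countable using AE_funpow[OF inv alt] by blast
    thus ?thesis
    proof (rule AE_mp, intro AE_I2 impI)
      fix x assume x: "x \<in> space \<mu>"
        and al: "\<forall>n. (f ^^ n) x \<in> X \<and> f ((f ^^ n) x) \<in> Y \<or> (f ^^ n) x \<in> Y \<and> f ((f ^^ n) x) \<in> X"
      have st: "(f ^^ n) x \<in> X \<Longrightarrow> (f ^^ Suc n) x \<in> Y" "(f ^^ n) x \<in> Y \<Longrightarrow> (f ^^ Suc n) x \<in> X" for n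
        using al[rule_format, of n] XY(3) by auto
      have "x \<in> X \<or> x \<in> Y" using al[rule_format, of 0] by auto
      thus "x \<in> A \<union> B"
      proof
        assume "x \<in> X"
        hence "(f ^^ (2 * n)) x \<in> X \<and> (f ^^ Suc (2 * n)) x \<in> Y" for n
        proof (induction n)
          case 0
          thus ?case using st(1)[of 0] by simp
        next
          case (Suc n)
          hence "(f ^^ Suc (Suc (2 * n))) x \<in> X" using st(2) by blast
          thus ?case using st(1)[of "Suc (Suc (2 * n))"] by simp
        qed
        thus ?thesis using x by (auto simp: A_def)
      next
        assume "x \<in> Y"
        hence "(f ^^ (2 * n)) x \<in> Y \<and> (f ^^ Suc (2 * n)) x \<in> X" for n
        proof (induction n)
          case 0
          thus ?case using st(2)[of 0] by simp
        next
          case (Suc n)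
          hence "(f ^^ Suc (Suc (2 * n))) x \<in> Y" using st(1) by blast
          thus ?case using st(2)[of "Suc (Suc (2 * n))"] by simp
        qed
        thus ?thesis using x by (auto simp: B_def)
      qed
    qed
  qed
  define U where "U = uniform_measure \<mu> (\<Sigma> 0)"
  have S0: "\<Sigma> 0 \<in> sets \<mu>" using k by (intro \<Sigma>) simp
  have Us: "sets U = sets \<mu>" "space U = space \<mu>" by (simp_all add: U_def)
  have mU: "measure U C = measure \<mu> (\<Sigma> 0 \<inter> C) / measure \<mu> (\<Sigma> 0)" if "C \<in> sets \<mu>" for C
  proof -
    have "emeasure U C = ennreal (measure \<mu> (\<Sigma> 0 \<inter> C) / measure \<mu> (\<Sigma> 0))"
      using that S0 pos by (simp add: U_def emeasure_eq_measure divide_ennreal)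
    thus ?thesis by (simp add: measure_def[of U])
  qed
  have "measure \<mu> (\<Sigma> 0) = measure \<mu> ((\<Sigma> 0 \<inter> A) \<union> (\<Sigma> 0 \<inter> B))"
    by (rule measure_eq_AE) (use AEAB S0 in auto)
  also have "\<dots> = measure \<mu> (\<Sigma> 0 \<inter> A) + measure \<mu> (\<Sigma> 0 \<inter> B)"
    using S0 AB0 by (intro finite_measure_Union) auto
  finally have one: "measure U A + measure U B = 1"
    using pos by (simp add: mU add_divide_distrib[symmetric])
  have invU: "invariant_under (f ^^ k) U" using ex by (simp add: exact_def U_def)
  \<comment> \<open>For odd \<open>k\<close> the preimage of \<open>A\<close> is \<open>B\<close>,
    so the invariant measure \<open>U\<close> gives both sets the mass 1 / 2, against the zero-one
    law for tail sets.\<close>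
  have "measure U (((f ^^ k) ^^ 1) -` A \<inter> space U) = measure U A"
    by (rule measure_funpow_vimage[OF invU]) (simp add: Us)
  hence "measure U B = measure U A" using fnA[of k] odd by (simp add: Us)
  moreover have "measure U A = 0 \<or> measure U A = 1"
  proof -
    have "\<forall>n. \<exists>C\<in>sets U. A = ((f ^^ k) ^^ n) -` C \<inter> space U"
    proof
      fix n
      have *: "(f ^^ (k * n)) -` B \<inter> space \<mu> = (if even (k * n) then B else A)"
      proof -
        have "f -` A \<inter> space \<mu> = B" using fnA[of 1] by simp
        hence "(f ^^ (k * n)) -` B \<inter> space \<mu> = (f ^^ Suc (k * n)) -` A \<inter> space \<mu>"
          using measurable_space[OF fn] by auto
        also have "\<dots> = (if even (k * n) then B else A)" using fnA[of "Suc (k * n)"] by simp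
        finally show ?thesis .
      qed
      show "\<exists>C\<in>sets U. A = ((f ^^ k) ^^ n) -` C \<inter> space U"
        unfolding funpow_mult Us
        using fnA[of "k * n"] * by (intro bexI[of _ "if even (k * n) then A else B"]) (auto split: if_splits)
    qed
    thus ?thesis using ex unfolding exact_def U_def by blast
  qed
  ultimately show False using one by auto
qed

section \<open>Acips and invariant sets of expanding maps\<close>

context expanding_map
begin

abbreviation leb :: "real measure" where "leb \<equiv> restrict_space lborel {0..L}"

lemma leb_simps:
  "space leb = {0..L}" "finite_measure leb"
  "E \<in> sets leb \<longleftrightarrow> E \<in> sets borel \<and> E \<subseteq> {0..L}"
  "E \<subseteq> {0..L} \<Longrightarrow> measure leb E = measure lborel E"
proof -
  show "space leb = {0..L}" by (simp add: space_restrict_space)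
  show "E \<in> sets leb \<longleftrightarrow> E \<in> sets borel \<and> E \<subseteq> {0..L}" by (auto simp: sets_restrict_space_iff)
  show "finite_measure leb"
    using L_pos by (intro finite_measureI) (simp add: emeasure_restrict_space space_restrict_space)
  show "E \<subseteq> {0..L} \<Longrightarrow> measure leb E = measure lborel E"
    by (rule measure_restrict_space) auto
qed

lemma leb_sets: "sets leb = sets (restrict_space borel {0..L})"
  by (rule sets_restrict_space_cong) simp

lemma ex_acip: "\<exists>\<mu>. acip {0..L} f \<mu>"
proof -
  obtain K where K: "\<And>n E. \<lbrakk>E \<in> sets borel; E \<subseteq> {0..L}\<rbrakk> \<Longrightarrow>
     measure lborel ({0..L} \<inter> (f ^^ n) -` E) \<le> K * measure lborel E"
    using bounded_pushforward by blast
  have "measure leb ((f ^^ n) -` E \<inter> space leb) \<le> K * measure leb E" if "E \<in> sets leb" for n E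
    using K[of E n] that by (simp add: leb_simps Int_commute)
  moreover have "measure leb (space leb) > 0" using L_pos by (simp add: leb_simps)
  ultimately show ?thesis
    using ex_acip_of_bounded_pushforward[OF leb_simps(2) measurable, of K]
    unfolding acip_def leb_sets by blast
qed

text \<open>Growth with \<epsilon> = 1 / 2 gives a set that fills at least half of an interval of
  length at least \<delta>, so \<delta> / 2 is a size that the images of every set of positive
  measure reach.\<close>

lemma tail_bound:
  assumes "acip {0..L} f \<mu>"
  shows "\<exists>\<eta>>0. \<forall>A. tail_set f \<mu> A \<and> measure \<mu> A > 0 \<longrightarrow> \<eta> \<le> measure \<mu> A"
proof -
  obtain \<delta> where \<delta>: "\<delta> > 0" and g: "\<And>A E \<epsilon>. \<lbrakk>A \<in> sets borel; A \<subseteq> {0..L}; measure lborel A > 0;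
     \<And>n. E n \<in> sets borel; \<And>n. A \<subseteq> (f ^^ n) -` E n; \<epsilon> > 0\<rbrakk> \<Longrightarrow>
     \<exists>n c d. 0 \<le> c \<and> d \<le> L \<and> \<delta> \<le> d - c \<and> measure lborel ({c<..<d} - E n) \<le> \<epsilon> * (d - c)"
    using growth by metis
  show ?thesis
  proof (rule tail_bound_of_growth[OF leb_simps(2), of "\<delta> / 2"])
    fix A and E :: "nat \<Rightarrow> real set"
    assume A: "A \<in> sets leb" "measure leb A > 0" "\<And>n. E n \<in> sets leb" "\<And>n. A \<subseteq> (f ^^ n) -` E n"
    have A': "A \<in> sets borel" "A \<subseteq> {0..L}" "measure lborel A > 0" "\<And>n. E n \<in> sets borel"
      using A(1-3) by (auto simp: leb_simps)
    obtain n c d where n: "0 \<le> c" "d \<le> L" "\<delta> \<le> d - c" "measure lborel ({c<..<d} - E n) \<le> 1 / 2 * (d - c)"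
      using g[OF A' A(4), of "1 / 2"] by auto
    have E: "E n \<in> sets borel" "E n \<subseteq> {0..L}" using A(3) by (auto simp: leb_simps)
    have "measure lborel {c<..<d} \<le> measure lborel ({c<..<d} - E n) + measure lborel ({c<..<d} \<inter> E n)"
      using measure_Un_le[of "{c<..<d} - E n" lborel "{c<..<d} \<inter> E n"] E by (simp add: Un_Diff_Int)
    hence "\<delta> / 2 \<le> measure lborel ({c<..<d} \<inter> E n)" using n \<delta> by simp
    also have "\<dots> \<le> measure lborel (E n)"
      using E fmeasurable_subset_interval[OF E] by (intro measure_mono_fmeasurable) auto
    finally have "\<delta> / 2 \<le> measure leb (E n)" using E by (simp add: leb_simps)
    thus "\<exists>n. \<delta> / 2 \<le> measure leb (E n)" by blast
  qed (use \<delta> assms in \<open>auto simp: acip_def leb_sets\<close>)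
qed

lemma ex_mixing_components:
  assumes "acip {0..L} f \<mu>" "ergodic f \<mu>"
  shows "\<exists>k \<Sigma>. mixing_components f \<mu> k \<Sigma>"
proof -
  obtain \<eta> where "\<eta> > 0" "\<And>A. \<lbrakk>tail_set f \<mu> A; measure \<mu> A > 0\<rbrakk> \<Longrightarrow> \<eta> \<le> measure \<mu> A"
    using tail_bound[OF assms(1)] by blast
  moreover have "AE x in \<mu>. x \<in> measure_support \<mu>"
    using assms(1) by (intro AE_measure_support) (auto simp: acip_def)
  ultimately show ?thesis
    using assms by (intro mixing_components_of_tail_bound) (auto simp: acip_def)
qed

text \<open>For every \<epsilon> the invariant set fills, up to the fraction \<epsilon>, some
  interval of length at least \<delta>, and each such interval contains one of finitely many grid
  intervals of length \<delta> / 2. If no grid interval were full, a positive lower bound \<eta> for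
  the missing measures would contradict a small \<epsilon>.\<close>

lemma full_interval:
  assumes A: "A \<in> sets borel" "A \<subseteq> {0..L}" "measure lborel A > 0" and inv: "f -` A \<inter> {0..L} = A"
  shows "\<exists>c d. c < d \<and> 0 \<le> c \<and> d \<le> L \<and> measure lborel ({c<..<d} - A) = 0"
proof (rule ccontr)
  assume no: "\<not> ?thesis"
  obtain \<delta> where \<delta>: "\<delta> > 0" and g: "\<And>A E \<epsilon>. \<lbrakk>A \<in> sets borel; A \<subseteq> {0..L}; measure lborel A > 0;
     \<And>n. E n \<in> sets borel; \<And>n. A \<subseteq> (f ^^ n) -` E n; \<epsilon> > 0\<rbrakk> \<Longrightarrow>
     \<exists>n c d. 0 \<le> c \<and> d \<le> L \<and> \<delta> \<le> d - c \<and> measure lborel ({c<..<d} - E n) \<le> \<epsilon> * (d - c)"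
    using growth by metis
  have orb: "(f ^^ n) x \<in> A" if "x \<in> A" for n x
    by (induction n) (use that inv in auto)
  define u where "u i = real i * (\<delta> / 2)" for i :: nat
  define I where "I = {i. u (Suc i) \<le> L}"
  have "i \<le> nat \<lceil>2 * L / \<delta>\<rceil>" if "i \<in> I" for i
  proof -
    have "real i * (\<delta> / 2) \<le> L" using that \<delta> by (simp add: I_def u_def algebra_simps)
    hence "real i \<le> 2 * L / \<delta>" using \<delta> by (simp add: field_simps)
    thus ?thesis by linarith
  qed
  hence finI: "finite I" by (meson finite_nat_set_iff_bounded_le)
  define \<eta> where "\<eta> = Min (insert 1 ((\<lambda>i. measure lborel ({u i<..<u (Suc i)} - A)) ` I))"
  have "measure lborel ({u i<..<u (Suc i)} - A) > 0" if "i \<in> I" for i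
    using no that \<delta> by (auto simp: I_def u_def zero_less_measure_iff)
  hence \<eta>: "\<eta> > 0" using finI by (simp add: \<eta>_def)
  have "A \<subseteq> (f ^^ n) -` A" for n using orb by blast
  moreover have "0 < \<eta> / (2 * L)" using \<eta> L_pos by simp
  ultimately obtain c d where cd: "0 \<le> c" "d \<le> L" "\<delta> \<le> d - c" "measure lborel ({c<..<d} - A) \<le> \<eta> / (2 * L) * (d - c)"
    using g[of A "\<lambda>_. A" "\<eta> / (2 * L)"] A by blast
  \<comment> \<open>This is the index of the first grid point not left of \<open>c\<close>; the grid
    interval that starts there ends before c + \<delta>.\<close>
  define i where "i = nat \<lceil>2 * c / \<delta>\<rceil>"
  have ri: "2 * c / \<delta> \<le> real i" "real i < 2 * c / \<delta> + 1" using cd(1) \<delta> by (auto simp: i_def) linarith+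
  have i: "c \<le> u i" "u (Suc i) \<le> d"
  proof -
    show "c \<le> u i" using ri(1) \<delta> by (simp add: u_def field_simps)
    have "real (Suc i) * (\<delta> / 2) \<le> (2 * c / \<delta> + 2) * (\<delta> / 2)"
      using ri(2) \<delta> by (intro mult_right_mono) auto
    also have "\<dots> = c + \<delta>" using \<delta> by (simp add: field_simps)
    finally show "u (Suc i) \<le> d" using cd(3) by (simp add: u_def)
  qed
  hence "i \<in> I" using cd by (simp add: I_def)
  have "\<eta> \<le> measure lborel ({u i<..<u (Suc i)} - A)"
    unfolding \<eta>_def using finI \<open>i \<in> I\<close> by (intro Min_le) auto
  also have "\<dots> \<le> measure lborel ({c<..<d} - A)"
    using i A(1) fmeasurable_Int_interval[of "- A" c d]
    by (intro measure_mono_fmeasurable) (auto simp: Diff_eq)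
  also have "\<dots> \<le> \<eta> / (2 * L) * L"
    using cd \<eta> L_pos by (intro order_trans[OF cd(4)] mult_left_mono) auto
  also have "\<dots> = \<eta> / 2" using L_pos by simp
  finally show False using \<eta> by simp
qed

lemma null_diff_image:
  assumes A: "A \<in> sets borel" and inv: "f -` A \<inter> {0..L} = A"
    and cd: "c < d" "0 \<le> c" "d \<le> L" "measure lborel ({c<..<d} - A) = 0"
    and push: "pushes f c d [(w, a, b)]" and w: "w \<noteq> 0"
  shows "measure lborel ({a<..<b} - A) = 0"
proof -
  have "measure lborel ({c<..<d} \<inter> f -` (- A)) = w * measure lborel ({a<..<b} \<inter> - A)"
    and s: "{c<..<d} \<inter> f -` (- A) \<in> sets borel"
    using push A by (auto simp: pushes_def)
  moreover have "measure lborel ({c<..<d} \<inter> f -` (- A)) \<le> measure lborel ({c<..<d} - A)"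
    using s cd inv fmeasurable_Int_interval[of "- A" c d] A
    by (intro measure_mono_fmeasurable) (auto simp: Diff_eq)
  hence "measure lborel ({c<..<d} \<inter> f -` (- A)) = 0" using cd(4) by (simp add: measure_le_0_iff)
  ultimately show ?thesis using w by (simp add: Diff_eq)
qed

text \<open>An interval that is contained in an invariant set modulo null sets and avoids \<open>V\<close> is mapped
  to a longer one of this kind, unless it contains the cut \<open>h\<close>.\<close>

lemma full_neighbourhood_of_cut:
  assumes V: "finite V" "F = insert h V" "\<And>x. x \<in> {0..L} - F \<Longrightarrow> f x \<notin> V"
    and A: "A \<in> sets borel" "A \<subseteq> {0..L}" "measure lborel A > 0" and inv: "f -` A \<inter> {0..L} = A"
  shows "\<exists>c d. c < h \<and> h < d \<and> measure lborel ({c<..<d} - A) = 0"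
proof (rule ccontr)
  assume no: "\<not> ?thesis"
  define full where "full c d \<longleftrightarrow> c < d \<and> 0 \<le> c \<and> d \<le> L \<and> {c<..<d} \<inter> V = {} \<and>
     measure lborel ({c<..<d} - A) = 0" for c d
  obtain c0 d0 where cd0: "c0 < d0" "0 \<le> c0" "d0 \<le> L" "measure lborel ({c0<..<d0} - A) = 0"
    using full_interval[OF A inv] by blast
  \<comment> \<open>The full interval is shortened once so that it avoids \<open>V\<close>; its
    images then avoid \<open>V\<close> by the third assumption on \<open>V\<close>.\<close>
  have "\<exists>c d. c0 \<le> c \<and> c < d \<and> d \<le> d0 \<and> {c<..<d} \<inter> V = {}"
    by (rule interval_split_induct[OF V(1) _ _ cd0(1)]) (blast intro: order_trans less_imp_le)+
  then obtain c1 d1 where cd1: "c0 \<le> c1" "c1 < d1" "d1 \<le> d0" "{c1<..<d1} \<inter> V = {}" by blast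
  have "measure lborel ({c1<..<d1} - A) \<le> measure lborel ({c0<..<d0} - A)"
    using cd1 A(1) fmeasurable_Int_interval[of "- A" c0 d0]
    by (intro measure_mono_fmeasurable) (auto simp: Diff_eq)
  hence f1: "full c1 d1" using cd0 cd1 by (simp add: full_def measure_le_0_iff)
  have step: "\<exists>c' d'. full c' d' \<and> lam * (d - c) \<le> d' - c'" if fu: "full c d" for c d
  proof -
    have "h \<notin> {c<..<d}" using no fu by (auto simp: full_def)
    hence "{c<..<d} \<inter> F = {}" using fu V(2) by (auto simp: full_def)
    then obtain \<sigma> \<tau> c' d' where s: "lam \<le> \<bar>\<sigma>\<bar>" "c' < d'" "0 \<le> c'" "d' \<le> L" "d' - c' = \<bar>\<sigma>\<bar> * (d - c)"
      "f ` {c<..<d} = {c'<..<d'}" "pushes f c d [(1 / \<bar>\<sigma>\<bar>, c', d')]"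
      using affine_image[of c d] fu unfolding full_def by metis
    have "f x \<notin> V" if "x \<in> {c<..<d}" for x
    proof (rule V(3))
      have "x \<notin> F" using that \<open>{c<..<d} \<inter> F = {}\<close> by blast
      thus "x \<in> {0..L} - F" using that fu by (simp add: full_def)
    qed
    hence "{c'<..<d'} \<inter> V = {}" unfolding s(6)[symmetric] by auto
    moreover have "measure lborel ({c'<..<d'} - A) = 0"
      by (rule null_diff_image[OF A(1) inv _ _ _ _ s(7)]) (use fu s(1) lam_pos in \<open>auto simp: full_def\<close>)
    moreover have "lam * (d - c) \<le> d' - c'"
      unfolding s(5) using s(1) fu by (intro mult_right_mono) (auto simp: full_def)
    ultimately show ?thesis using s(2-4) by (auto simp: full_def)
  qed
  have "\<exists>c d. full c d \<and> lam ^ n * (d1 - c1) \<le> d - c" for n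
  proof (induction n)
    case 0
    show ?case using f1 by auto
  next
    case (Suc n)
    then obtain c d where "full c d" "lam ^ n * (d1 - c1) \<le> d - c" by blast
    moreover from this(1) obtain c' d' where "full c' d'" "lam * (d - c) \<le> d' - c'" using step by blast
    moreover have "lam * (lam ^ n * (d1 - c1)) \<le> lam * (d - c)"
      using calculation(2) lam_pos by (intro mult_left_mono) auto
    ultimately show ?case by (auto simp: mult.assoc intro: order_trans)
  qed
  hence bd: "lam ^ n * (d1 - c1) \<le> L" for n
  proof -
    obtain c d where "full c d" "lam ^ n * (d1 - c1) \<le> d - c"
      using \<open>\<And>n. \<exists>c d. full c d \<and> lam ^ n * (d1 - c1) \<le> d - c\<close> by blast
    thus ?thesis unfolding full_def by linarith
  qed
  obtain n where "L / (d1 - c1) < lam ^ n" using real_arch_pow[OF expanding] by blast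
  thus False using bd[of n] cd1(2) by (simp add: field_simps)
qed

text \<open>If neither \<open>A\<close> nor its complement were null, both would contain almost all
  points near the cut \<open>h\<close>.\<close>

lemma lebesgue_ergodic:
  assumes V: "finite V" "F = insert h V" "\<And>x. x \<in> {0..L} - F \<Longrightarrow> f x \<notin> V"
    and A: "A \<in> sets leb" "f -` A \<inter> space leb = A"
  shows "measure leb A = 0 \<or> measure leb (space leb - A) = 0"
proof (rule ccontr)
  assume no: "\<not> ?thesis"
  define B where "B = {0..L} - A"
  have A': "A \<in> sets borel" "A \<subseteq> {0..L}" "f -` A \<inter> {0..L} = A" using A by (auto simp: leb_simps)
  have B': "B \<in> sets borel" "B \<subseteq> {0..L}" "f -` B \<inter> {0..L} = B" using A' maps by (auto simp: B_def)
  have "measure lborel A > 0" "measure lborel B > 0"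
    using no A' B'(2) by (auto simp: leb_simps B_def zero_less_measure_iff)
  then obtain c d c' d' where cd: "c < h" "h < d" "measure lborel ({c<..<d} - A) = 0"
    and cd': "c' < h" "h < d'" "measure lborel ({c'<..<d'} - B) = 0"
    using full_neighbourhood_of_cut[OF V A'(1,2) _ A'(3)] full_neighbourhood_of_cut[OF V B'(1,2) _ B'(3)]
    by blast
  define l where "l = max c c'"
  define r where "r = min d d'"
  have lr: "l < r" using cd cd' by (auto simp: l_def r_def)
  have fm: "{c<..<d} - A \<in> fmeasurable lborel" "{c'<..<d'} - B \<in> fmeasurable lborel"
    using fmeasurable_Int_interval[of "- A" c d] fmeasurable_Int_interval[of "- B" c' d'] A'(1) B'(1)
    by (auto simp: Diff_eq)
  have "measure lborel {l<..<r} \<le> measure lborel (({c<..<d} - A) \<union> ({c'<..<d'} - B))"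
    using fm by (intro measure_mono_fmeasurable fmeasurable.Un) (auto simp: l_def r_def B_def)
  also have "\<dots> \<le> measure lborel ({c<..<d} - A) + measure lborel ({c'<..<d'} - B)"
    using fm by (intro measure_Un_le) auto
  finally show False using cd cd' lr by simp
qed

end

text \<open>Absolute continuity carries the zero-one law of Lebesgue measure over to every acip, and
  the same law makes any two acips equal.\<close>

lemma (in expanding_map) unique_ergodic_acip:
  assumes erg: "\<And>A. \<lbrakk>A \<in> sets leb; f -` A \<inter> space leb = A\<rbrakk> \<Longrightarrow>
    measure leb A = 0 \<or> measure leb (space leb - A) = 0"
  shows "\<exists>!\<mu>. acip {0..L} f \<mu> \<and> ergodic f \<mu>"
proof -
  obtain \<mu> where \<mu>: "acip {0..L} f \<mu>" using ex_acip by blast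
  interpret finite_measure leb by (rule leb_simps(2))
  interpret M: prob_space \<mu> using \<mu> by (simp add: acip_def)
  have s: "sets \<mu> = sets leb" and ac: "absolutely_continuous leb \<mu>" using \<mu> by (auto simp: acip_def leb_sets)
  have sp: "space \<mu> = space leb" using sets_eq_imp_space_eq[OF s] .
  have "ergodic f \<mu>"
    unfolding ergodic_def
  proof (intro conjI ballI impI)
    show "invariant_under f \<mu>" using \<mu> by (simp add: acip_def)
    fix A assume A: "A \<in> sets \<mu>" "f -` A \<inter> space \<mu> = A"
    hence "measure leb A = 0 \<or> measure leb (space leb - A) = 0" using erg by (simp add: s sp)
    moreover have "A \<in> sets leb" "space leb - A \<in> sets leb" using A(1) unfolding s by blast+
    ultimately have "A \<in> null_sets leb \<or> space leb - A \<in> null_sets leb"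
      unfolding null_sets_def emeasure_eq_measure by force
    hence "A \<in> null_sets \<mu> \<or> space \<mu> - A \<in> null_sets \<mu>"
      using ac unfolding sp absolutely_continuous_def by blast
    hence "measure \<mu> A = 0 \<or> measure \<mu> (space \<mu> - A) = 0"
      unfolding null_sets_def measure_def by force
    thus "measure \<mu> A = 0 \<or> measure \<mu> A = 1"
      using M.prob_compl[OF A(1)] by auto
  qed
  moreover have "\<nu> = \<mu>" if "acip {0..L} f \<nu>" for \<nu>
    using that \<mu> by (intro acip_unique_of_nonsingular_ergodic[OF leb_simps(2) erg])
      (auto simp: acip_def leb_sets)
  ultimately show ?thesis using \<mu> by blast
qed

section \<open>The slap map of a triangle\<close>

lemma noncollinear_indep:
  fixes P Q R :: "'a::euclidean_space"
  assumes "\<not> collinear {P, Q, R}" and eq: "a *\<^sub>R (Q - P) + b *\<^sub>R (R - P) = 0"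
  shows "a = 0 \<and> b = 0"
proof -
  have nc: "\<not> collinear {0, Q - P, R - P}"
    using assms(1) collinear_3[of Q P R] by (simp add: insert_commute)
  have "b = 0"
  proof (rule ccontr)
    assume b: "b \<noteq> 0"
    have "b *\<^sub>R (R - P) = (- a) *\<^sub>R (Q - P)" using eq by (simp add: add_eq_0_iff)
    hence "(1 / b) *\<^sub>R (b *\<^sub>R (R - P)) = (1 / b) *\<^sub>R ((- a) *\<^sub>R (Q - P))" by simp
    hence "R - P = (- a / b) *\<^sub>R (Q - P)" using b by simp
    thus False using nc collinear_lemma by blast
  qed
  moreover have "Q - P \<noteq> 0" using nc collinear_lemma by blast
  ultimately show ?thesis using eq by simp
qed

text \<open>In the coordinate along the edge \<open>P Q\<close> the ray is constant, and each of the other two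
  edges crosses that coordinate once.\<close>

lemma normal_ray_meets_triangle:
  fixes P Q R :: "'a::euclidean_space"
  assumes nc: "\<not> collinear {P, Q, R}"
    and v: "norm v = 1" "orthogonal v (Q - P)"
    and t: "0 < t" "t < dist P Q"
    and y: "y \<in> {P + t *\<^sub>R sgn (Q - P) + \<tau> *\<^sub>R v | \<tau>. 0 \<le> \<tau>}" "y \<noteq> P + t *\<^sub>R sgn (Q - P)"
      "y \<in> closed_segment P Q \<union> closed_segment Q R \<union> closed_segment R P"
  defines "r \<equiv> (R - P) \<bullet> sgn (Q - P)"
  shows "t < r \<Longrightarrow> y = P + (t / r) *\<^sub>R (R - P)"
    and "r < t \<Longrightarrow> y = Q + ((dist P Q - t) / (dist P Q - r)) *\<^sub>R (R - Q)"
proof -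
  define u where "u = sgn (Q - P)"
  define l where "l = dist P Q"
  have l: "l > 0" using t unfolding l_def by linarith
  have "P \<noteq> Q"
  proof
    assume "P = Q"
    thus False using t by simp
  qed
  hence QP: "Q - P = l *\<^sub>R u" "norm u = 1"
    by (simp_all add: u_def l_def sgn_div_norm dist_norm norm_minus_commute)
  hence uu: "u \<bullet> u = 1" by (simp add: norm_eq_1)
  have vu: "v \<bullet> u = 0" using v(2) QP l by (simp add: orthogonal_def)
  obtain \<tau> where tau: "0 \<le> \<tau>" "y = P + t *\<^sub>R u + \<tau> *\<^sub>R v" using y(1) by (auto simp: u_def)
  have "\<tau> \<noteq> 0" using tau y(2) by (auto simp: u_def)
  have yu: "(y - P) \<bullet> u = t" using tau(2) uu vu by (simp add: inner_add_left)
  have yv: "(y - P) \<bullet> v = \<tau>" using tau(2) v(1) vu by (simp add: inner_add_left inner_add_right inner_commute norm_eq_1)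
  have r: "r = (R - P) \<bullet> u" by (simp add: r_def u_def)
  have cases: "(t \<le> r \<and> y = P + (t / r) *\<^sub>R (R - P)) \<or>
     (r \<le> t \<and> y = Q + ((l - t) / (l - r)) *\<^sub>R (R - Q))"
    using y(3)
  proof (elim UnE)
    \<comment> \<open>Excluded: points of this edge have coordinate 0 along \<open>v\<close>, while
      \<tau> is not 0.\<close>
    assume "y \<in> closed_segment P Q"
    then obtain s where "y - P = s *\<^sub>R (Q - P)" by (auto simp: in_segment algebra_simps)
    hence "(y - P) \<bullet> v = 0" using vu QP by (simp add: inner_commute)
    thus ?thesis using yv \<open>\<tau> \<noteq> 0\<close> by simp
  next
    assume "y \<in> closed_segment Q R"
    then obtain s where s: "0 \<le> s" "s \<le> 1" "y = Q + s *\<^sub>R (R - Q)" by (auto simp: in_segment algebra_simps)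
    have "y - P = (Q - P) + s *\<^sub>R ((R - P) - (Q - P))" using s(3) by simp
    hence "(y - P) \<bullet> u = l + s * (r - l)"
      using QP uu by (simp only: inner_add_left inner_scaleR_left inner_diff_left[of "R - P"] r[symmetric]) simp
    hence e: "s * (l - r) = l - t" using yu by (simp add: algebra_simps)
    hence "s * (l - r) > 0" using t by (simp add: l_def)
    hence lr: "l - r > 0" using s(1) by (simp add: zero_less_mult_iff)
    hence "s = (l - t) / (l - r)" using e by (simp add: field_simps)
    moreover have "r \<le> t" using e s(2) lr mult_right_mono[of s 1 "l - r"] by simp
    ultimately show ?thesis using s(3) by simp
  next
    assume "y \<in> closed_segment R P"
    then obtain s where s: "0 \<le> s" "s \<le> 1" "y = R + s *\<^sub>R (P - R)" by (auto simp: in_segment algebra_simps)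
    define q where "q = 1 - s"
    have q: "0 \<le> q" "q \<le> 1" "y = P + q *\<^sub>R (R - P)" using s by (auto simp: q_def algebra_simps)
    have e: "q * r = t" using yu q(3) by (simp add: r)
    hence "q * r > 0" using t by simp
    hence r0: "r > 0" using q(1) by (simp add: zero_less_mult_iff)
    hence "q = t / r" using e by (simp add: field_simps)
    moreover have "t \<le> r" using e q(2) r0 mult_right_mono[of q 1 r] by simp
    ultimately show ?thesis using q(3) by simp
  qed
  show "t < r \<Longrightarrow> y = P + (t / r) *\<^sub>R (R - P)" using cases by auto
  show "r < t \<Longrightarrow> y = Q + ((dist P Q - t) / (dist P Q - r)) *\<^sub>R (R - Q)" using cases by (auto simp: l_def)
qed

section \<open>Geometry of the triangle and the formula for the slap map\<close>

locale triangle =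
  fixes A B C :: "real^2"
  assumes nc: "\<not> collinear {A, B, C}"
begin

abbreviation V :: "nat \<Rightarrow> real^2" where "V i \<equiv> vertex [A, B, C] i"
abbreviation arc :: "nat \<Rightarrow> real" where "arc i \<equiv> arc_pos [A, B, C] i"
definition len :: "nat \<Rightarrow> real" where "len i = dist (V i) (V (Suc i))"
text \<open>The side \<open>len (i + 2)\<close> ends at \<open>V i\<close>, so this is the cosine of
  the angle at \<open>V i\<close>. Indices are read modulo 3 through \<open>vertex\<close>, whereas
  \<open>arc\<close> keeps growing by the perimeter.\<close>

definition cosine :: "nat \<Rightarrow> real" where
  "cosine i = ((V (i + 1) - V i) \<bullet> (V (i + 2) - V i)) / (len i * len (i + 2))"

lemma V_simps: "V 0 = A" "V (Suc 0) = B" "V 1 = B" "V 2 = C" "V 3 = A" "V 4 = B"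
  by (simp_all add: vertex_def)

lemma V_add3: "V (i + 3) = V i"
  by (simp add: vertex_def)

lemma mod3_cases: "(i::nat) mod 3 = 0 \<or> i mod 3 = 1 \<or> i mod 3 = 2"
  by linarith

lemma V_nc: "\<not> collinear {V i, V (i + 1), V (i + 2)}"
proof -
  have "{V i, V (i + 1), V (i + 2)} = {A, B, C}"
    using mod3_cases[of i] by (elim disjE) (auto simp: vertex_def mod_Suc mod_add_eq[of i 3, symmetric] numeral_2_eq_2)
  thus ?thesis using nc by simp
qed

lemma V_neq: "V i \<noteq> V (Suc i)"
  using V_nc[of i] by (auto simp: insert_commute)

lemma len_pos: "len i > 0"
  using V_neq[of i] by (simp add: len_def)

lemma len_add3: "len (i + 3) = len i"
  using V_add3[of i] V_add3[of "Suc i"] by (simp add: len_def)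

lemma len2: "len (i + 2) = dist (V i) (V (i + 2))"
  using V_add3[of i] by (simp add: len_def dist_commute numeral_3_eq_3)

lemma arc_Suc: "arc (Suc i) = arc i + len i"
  by (simp add: arc_pos_def len_def)

lemma arc_0: "arc 0 = 0"
  by (simp add: arc_pos_def)

lemma arc_strict_mono: "strict_mono arc"
  unfolding strict_mono_Suc_iff using len_pos by (simp add: arc_Suc)

lemma perimeter_eq: "perimeter [A, B, C] = arc 3"
  by (simp add: perimeter_def numeral_3_eq_3)

lemma edge_eq: "V (Suc i) - V i = len i *\<^sub>R sgn (V (Suc i) - V i)"
  using V_neq[of i] by (simp add: len_def sgn_div_norm dist_norm norm_minus_commute)

lemma projection_eq: "(V (i + 2) - V i) \<bullet> sgn (V (Suc i) - V i) = len (i + 2) * cosine i"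
proof -
  have "len i * ((V (i + 2) - V i) \<bullet> sgn (V (Suc i) - V i)) = (V (i + 2) - V i) \<bullet> (V (Suc i) - V i)"
    using arg_cong[OF edge_eq[of i], of "(\<bullet>) (V (i + 2) - V i)"] by (simp only: inner_scaleR_right)
  thus ?thesis using len_pos[of i] len_pos[of "i + 2"] by (simp add: cosine_def inner_commute field_simps)
qed

lemma cosine_abs_less_1: "\<bar>cosine i\<bar> < 1"
proof -
  define x where "x = V (i + 1) - V i"
  define y where "y = V (i + 2) - V i"
  have "\<not> collinear {0, x, y}"
    using V_nc[of i] collinear_3[of "V (i + 1)" "V i" "V (i + 2)"] by (simp add: insert_commute x_def y_def)
  hence "\<bar>x \<bullet> y\<bar> \<noteq> norm x * norm y" using norm_cauchy_schwarz_equal by blast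
  hence "\<bar>x \<bullet> y\<bar> < norm x * norm y" using Cauchy_Schwarz_ineq2[of x y] by simp
  moreover have "norm x = len i" "norm y = len (i + 2)"
    using len2[of i] by (simp_all add: x_def y_def len_def dist_norm norm_minus_commute)
  ultimately show ?thesis
    using len_pos[of i] len_pos[of "i + 2"] by (simp add: cosine_def x_def y_def abs_mult)
qed

text \<open>A side is the sum of the signed projections of the other two sides; the first summand is
  the signed distance from \<open>V i\<close> to the foot of the altitude on this side.\<close>

lemma len_eq: "len i = len (i + 2) * cosine i + len (i + 1) * cosine (i + 1)"
proof -
  define u where "u = sgn (V (Suc i) - V i)"
  have 3: "V (i + 3) = V i" "len (i + 3) = len i" by (rule V_add3 len_add3)+
  have uu: "u \<bullet> u = 1" using V_neq[of i] by (simp add: u_def norm_eq_1[symmetric] norm_sgn)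
  have "len (i + 1) * cosine (i + 1) * len i = (V (i + 2) - V (i + 1)) \<bullet> (V i - V (i + 1))"
    using len_pos[of i] len_pos[of "i + 1"] 3 by (simp add: cosine_def numeral_3_eq_3)
  also have "V i - V (i + 1) = - (len i *\<^sub>R u)" using edge_eq[of i] by (simp add: u_def algebra_simps)
  also have "(V (i + 2) - V (i + 1)) \<bullet> - (len i *\<^sub>R u) = len i * (len i - (V (i + 2) - V i) \<bullet> u)"
  proof -
    have e: "V (i + 2) - V (i + 1) = (V (i + 2) - V i) - len i *\<^sub>R u"
      using edge_eq[of i] by (simp add: u_def algebra_simps)
    show ?thesis unfolding e using uu
      by (simp only: inner_diff_left inner_minus_right inner_scaleR_left inner_scaleR_right) (simp add: algebra_simps)
  qed
  also have "(V (i + 2) - V i) \<bullet> u = len (i + 2) * cosine i" unfolding u_def by (rule projection_eq)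
  finally have "len i * (len (i + 1) * cosine (i + 1)) = len i * (len i - len (i + 2) * cosine i)"
    by (simp add: mult.commute)
  hence "len (i + 1) * cosine (i + 1) = len i - len (i + 2) * cosine i"
    using len_pos[of i] by simp
  thus ?thesis by simp
qed

text \<open>At a vertex the least index selects the edge that ends there; hence the strict
  inequality for all edges but the first.\<close>

lemma boundary_point_eq:
  assumes "arc k \<le> s" "s \<le> arc (Suc k)" "k = 0 \<or> arc k < s"
  shows "boundary_point [A, B, C] s = V k + (s - arc k) *\<^sub>R sgn (V (Suc k) - V k)"
proof -
  have "(LEAST i. s \<le> arc (Suc i)) = k"
  proof (rule Least_equality)
    fix i assume i: "s \<le> arc (Suc i)"
    show "k \<le> i"
    proof (rule ccontr)
      assume "\<not> k \<le> i"
      hence "Suc i \<le> k" "k \<noteq> 0" by auto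
      hence "arc (Suc i) \<le> arc k" using strict_mono_less_eq[OF arc_strict_mono] by blast
      thus False using i assms(3) \<open>k \<noteq> 0\<close> by auto
    qed
  qed (rule assms(2))
  thus ?thesis unfolding boundary_point_def by (simp add: Let_def)
qed

lemma boundary_point_cases:
  assumes "s \<in> {0..arc 3}"
  obtains k where "k < 3" "arc k \<le> s" "s \<le> arc (Suc k)"
    "boundary_point [A, B, C] s = V k + (s - arc k) *\<^sub>R sgn (V (Suc k) - V k)"
proof -
  have le: "s \<le> arc (Suc 2)" "0 \<le> s" using assms by (simp_all add: numeral_3_eq_3 numeral_2_eq_2)
  consider "s \<le> arc (Suc 0)" | "arc 1 < s" "s \<le> arc 2" | "arc 2 < s" by fastforce
  thus ?thesis
  proof cases
    case 1
    thus ?thesis using assms by (intro that[of 0] boundary_point_eq) (auto simp: arc_0)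
  next
    case 2
    hence "s \<le> arc (Suc 1)" by (simp add: numeral_2_eq_2)
    thus ?thesis using 2 by (intro that[of 1] boundary_point_eq) simp_all
  next
    case 3
    thus ?thesis using le by (intro that[of 2] boundary_point_eq) simp_all
  qed
qed

text \<open>Since \<eta> is arbitrary, this concerns whole lines: an inner point of an edge lies on
  neither of the lines through the other two edges, by linear independence of the two edge vectors
  at \<open>V i\<close>.\<close>

lemma edge_point_disjoint:
  assumes x: "0 < \<xi>" "\<xi> < 1" and d: "d = 1 \<or> d = 2"
  shows "V i + \<xi> *\<^sub>R (V (i + 1) - V i) \<noteq> V (i + d) + \<eta> *\<^sub>R (V (i + d + 1) - V (i + d))"
proof
  assume eq: "V i + \<xi> *\<^sub>R (V (i + 1) - V i) = V (i + d) + \<eta> *\<^sub>R (V (i + d + 1) - V (i + d))"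
  define p where "p = V (i + 1) - V i"
  define q where "q = V (i + 2) - V i"
  have pq: "a = 0 \<and> b = 0" if "a *\<^sub>R p + b *\<^sub>R q = 0" for a b
    using noncollinear_indep[OF V_nc[of i]] that unfolding p_def q_def by blast
  from d show False
  proof
    assume "d = 1"
    have "(\<xi> - 1 + \<eta>) *\<^sub>R p + (- \<eta>) *\<^sub>R q = 0"
      using eq by (simp add: \<open>d = 1\<close> p_def q_def algebra_simps)
    from pq[OF this] show False using x by simp
  next
    assume "d = 2"
    have "V (i + d + 1) = V i" using V_add3[of i] by (simp add: \<open>d = 2\<close> numeral_3_eq_3)
    hence "\<xi> *\<^sub>R p + (\<eta> - 1) *\<^sub>R q = 0"
      using eq by (simp add: \<open>d = 2\<close> p_def q_def algebra_simps)
    from pq[OF this] show False using x by simp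
  qed
qed

text \<open>\<open>slap_map\<close> constrains only the boundary point that belongs to the image; in
  the interior of an edge this determines the parameter.\<close>

lemma boundary_point_inj:
  assumes s: "s \<in> {0..arc 3}" and j: "j < 3" and x: "0 < x" "x < len j"
    and eq: "boundary_point [A, B, C] s = V j + x *\<^sub>R sgn (V (Suc j) - V j)"
  shows "s = arc j + x"
proof -
  obtain k where k: "k < 3" "arc k \<le> s" "s \<le> arc (Suc k)"
    "boundary_point [A, B, C] s = V k + (s - arc k) *\<^sub>R sgn (V (Suc k) - V k)"
    using boundary_point_cases[OF s] by blast
  have sg: "y *\<^sub>R sgn (V (Suc i) - V i) = (y / len i) *\<^sub>R (V (i + 1) - V i)" for y i
    using arg_cong[OF edge_eq[of i], of "scaleR (y / len i)"] len_pos[of i] by simp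
  show ?thesis
  proof (cases "k = j")
    case True
    hence "(x - (s - arc j)) *\<^sub>R sgn (V (Suc j) - V j) = 0" using eq k(4) by (simp add: algebra_simps)
    thus ?thesis using V_neq[of j] by (simp add: sgn_zero_iff)
  next
    case False
    \<comment> \<open>\<open>d\<close> is the cyclic distance from the edge \<open>j\<close> to the
      edge \<open>k\<close>.\<close>
    define d where "d = (if j < k then k - j else k + 3 - j)"
    have d: "d = 1 \<or> d = 2" using False j k(1) by (auto simp: d_def)
    have "V (j + d) = V k" "V (j + d + 1) = V (k + 1)"
      using V_add3[of k] V_add3[of "k + 1"] j k(1) by (auto simp: d_def)
    moreover have "0 < x / len j" "x / len j < 1" using x len_pos[of j] by auto
    ultimately have "V j + (x / len j) *\<^sub>R (V (j + 1) - V j) \<noteq> V k + ((s - arc k) / len k) *\<^sub>R (V (k + 1) - V k)"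
      using edge_point_disjoint[OF _ _ d, of "x / len j" j] by metis
    thus ?thesis using eq k(4) by (simp add: sg)
  qed
qed

text \<open>By similar right triangles, a ray that starts before the foot of the altitude hits the
  edge ending at \<open>V i\<close> at distance t / cosine i from \<open>V i\<close>, and that edge
  is parametrized towards \<open>V i\<close>. A ray that starts after the foot hits the next edge at
  distance (len i - t) / cosine (i + 1) from its origin. The indices are reduced modulo 3 because
  \<open>arc\<close> is not periodic.\<close>

lemma slap_map_formula:
  assumes slap: "slap_map [A, B, C] \<psi>" and i: "i < 3" and t: "0 < t" "t < len i"
  shows "t < len (i + 2) * cosine i \<Longrightarrow> \<psi> (arc i + t) = arc ((i + 2) mod 3) + (len (i + 2) - t / cosine i)"
    and "len (i + 2) * cosine i < t \<Longrightarrow> \<psi> (arc i + t) = arc ((i + 1) mod 3) + (len i - t) / cosine (i + 1)"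
proof -
  define s where "s = arc i + t"
  define r where "r = len (i + 2) * cosine i"
  have s: "arc i < s" "s < arc (Suc i)" using t by (auto simp: s_def arc_Suc)
  note mono = strict_mono_less[OF arc_strict_mono] strict_mono_less_eq[OF arc_strict_mono]
  have only: "k = i" if "arc k < s" "s < arc (Suc k)" for k
  proof -
    have "arc k < arc (Suc i)" "arc i < arc (Suc k)" using that s by linarith+
    thus ?thesis by (simp add: mono)
  qed
  have "s \<notin> arc ` {..length [A, B, C]}"
  proof
    assume "s \<in> arc ` {..length [A, B, C]}"
    then obtain k where "s = arc k" by blast
    hence "i < k" "k < Suc i" using s by (auto simp: mono)
    thus False by simp
  qed
  moreover have "s \<in> {0..arc 3}"
  proof -
    have "arc 0 \<le> arc i" "arc (Suc i) \<le> arc 3" using i by (simp_all add: mono)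
    thus ?thesis using s by (simp add: arc_0)
  qed
  ultimately have sp: "slap_point [A, B, C] s (boundary_point [A, B, C] (\<psi> s))" and ps: "\<psi> s \<in> {0..arc 3}"
    using slap unfolding slap_map_def perimeter_eq by (blast, blast)
  define y where "y = boundary_point [A, B, C] (\<psi> s)"
  have bs: "boundary_point [A, B, C] s = V i + t *\<^sub>R sgn (V (Suc i) - V i)"
    using boundary_point_eq[of i s] s by (simp add: s_def)
  have pb: "polygon_boundary [A, B, C] = closed_segment (V i) (V (i + 1)) \<union>
      closed_segment (V (i + 1)) (V (i + 2)) \<union> closed_segment (V (i + 2)) (V i)"
  proof -
    have "{..<length [A, B, C]} = {0, 1, 2}" by auto
    hence "polygon_boundary [A, B, C] = closed_segment A B \<union> closed_segment B C \<union> closed_segment C A"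
      by (simp add: polygon_boundary_def V_simps eval_nat_numeral) (simp add: vertex_def Un_assoc)
    moreover have "i = 0 \<or> i = 1 \<or> i = 2" using i by auto
    ultimately show ?thesis by (elim disjE) (auto simp: vertex_def)
  qed
  obtain v where v: "inward_normal [A, B, C] s v"
    "y \<in> {V i + t *\<^sub>R sgn (V (Suc i) - V i) + \<tau> *\<^sub>R v | \<tau>. 0 \<le> \<tau>} \<inter> polygon_boundary [A, B, C]
       - {V i + t *\<^sub>R sgn (V (Suc i) - V i)}"
    using sp unfolding slap_point_def Let_def bs y_def[symmetric] by blast
  obtain k where "arc k < s" "s < arc (Suc k)" "norm v = 1" "orthogonal v (V (Suc k) - V k)"
    using v(1) by (auto simp: inward_normal_def)
  hence n: "norm v = 1" "orthogonal v (V (i + 1) - V i)" using only[of k] by auto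
  have t': "0 < t" "t < dist (V i) (V (i + 1))" using t by (auto simp: len_def)
  have r: "(V (i + 2) - V i) \<bullet> sgn (V (i + 1) - V i) = r" using projection_eq[of i] by (simp add: r_def)
  note hit = normal_ray_meets_triangle[OF V_nc[of i] n t', of y, unfolded r]
  have y: "y \<in> {V i + t *\<^sub>R sgn (V (i + 1) - V i) + \<tau> *\<^sub>R v | \<tau>. 0 \<le> \<tau>}"
    "y \<noteq> V i + t *\<^sub>R sgn (V (i + 1) - V i)"
    "y \<in> closed_segment (V i) (V (i + 1)) \<union> closed_segment (V (i + 1)) (V (i + 2)) \<union> closed_segment (V (i + 2)) (V i)"
    using v(2) pb by auto
  have arcm: "V (k mod 3) = V k" "V (Suc (k mod 3)) = V (Suc k)" "len (k mod 3) = len k" for k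
    by (simp_all add: vertex_def len_def mod_Suc_eq)
  show "\<psi> (arc i + t) = arc ((i + 2) mod 3) + (len (i + 2) - t / cosine i)"
    if lt: "t < len (i + 2) * cosine i"
  proof -
    have c: "cosine i > 0" using lt t len_pos[of "i + 2"] by (smt (verit) mult_nonneg_nonpos)
    have yy: "y = V i + (t / r) *\<^sub>R (V (i + 2) - V i)" using hit(1)[OF y] lt by (simp add: r_def)
    have 3: "V (Suc (i + 2)) = V i" using V_add3[of i] by (simp add: numeral_3_eq_3)
    have "V i = V (i + 2) + len (i + 2) *\<^sub>R sgn (V (Suc (i + 2)) - V (i + 2))"
      using edge_eq[of "i + 2"] unfolding 3 by (simp add: algebra_simps)
    hence "y = V (i + 2) + (1 - t / r) *\<^sub>R (len (i + 2) *\<^sub>R sgn (V (Suc (i + 2)) - V (i + 2)))"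
      unfolding yy by (simp add: algebra_simps)
    also have "(1 - t / r) *\<^sub>R (len (i + 2) *\<^sub>R sgn (V (Suc (i + 2)) - V (i + 2))) =
        (len (i + 2) - t / cosine i) *\<^sub>R sgn (V (Suc (i + 2)) - V (i + 2))"
    proof -
      have "(1 - t / r) * len (i + 2) = len (i + 2) - t / cosine i"
        using len_pos[of "i + 2"] c by (simp add: r_def field_simps)
      thus ?thesis by (simp add: mult.commute)
    qed
    finally have eq: "y = V (i + 2) + (len (i + 2) - t / cosine i) *\<^sub>R sgn (V (Suc (i + 2)) - V (i + 2))" .
    have "0 < len (i + 2) - t / cosine i" "len (i + 2) - t / cosine i < len (i + 2)"
      using lt t c by (simp_all add: pos_divide_less_eq)
    hence "\<psi> s = arc ((i + 2) mod 3) + (len (i + 2) - t / cosine i)"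
      using eq by (intro boundary_point_inj[OF ps]) (simp_all only: arcm y_def)
    thus ?thesis by (simp add: s_def)
  qed
  show "\<psi> (arc i + t) = arc ((i + 1) mod 3) + (len i - t) / cosine (i + 1)"
    if gt: "len (i + 2) * cosine i < t"
  proof -
    have l: "len i - r = len (i + 1) * cosine (i + 1)" using len_eq[of i] by (simp add: r_def)
    have "0 < len (i + 1) * cosine (i + 1)" using gt t(2) unfolding l[symmetric] by (simp add: r_def)
    hence c: "cosine (i + 1) > 0" using len_pos[of "i + 1"] by (simp add: zero_less_mult_iff)
    have yy: "y = V (i + 1) + ((len i - t) / (len i - r)) *\<^sub>R (V (i + 2) - V (i + 1))"
      using hit(2)[OF y] gt by (simp add: r_def len_def)
    have e: "V (i + 2) - V (i + 1) = len (i + 1) *\<^sub>R sgn (V (Suc (i + 1)) - V (i + 1))"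
      using edge_eq[of "i + 1"] by simp
    have "y = V (i + 1) + (((len i - t) / (len i - r)) * len (i + 1)) *\<^sub>R sgn (V (Suc (i + 1)) - V (i + 1))"
      unfolding yy by (simp only: e scaleR_scaleR)
    also have "((len i - t) / (len i - r)) * len (i + 1) = (len i - t) / cosine (i + 1)"
      unfolding l using len_pos[of "i + 1"] by simp
    finally have eq: "y = V (i + 1) + ((len i - t) / cosine (i + 1)) *\<^sub>R sgn (V (Suc (i + 1)) - V (i + 1))" .
    have "0 < (len i - t) / cosine (i + 1)" "(len i - t) / cosine (i + 1) < len (i + 1)"
      using gt t c l by (simp_all add: pos_divide_less_eq r_def)
    hence "\<psi> s = arc ((i + 1) mod 3) + (len i - t) / cosine (i + 1)"
      using eq by (intro boundary_point_inj[OF ps]) (simp_all only: arcm y_def)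
    thus ?thesis by (simp add: s_def)
  qed
qed

lemma acute_iff: "acute_triangle A B C \<longleftrightarrow> cosine 0 > 0 \<and> cosine 1 > 0 \<and> cosine 2 > 0"
proof -
  have acos: "arccos x < pi / 2 \<longleftrightarrow> 0 < x" if "\<bar>x\<bar> < 1" for x
    using that arccos_less_mono[of x 0] by simp
  have V5: "V (Suc (Suc 0)) = C" "V (Suc (Suc (Suc 0))) = A" "V (Suc (Suc (Suc (Suc 0)))) = B"
    "V (Suc 2) = A" "V (Suc 3) = B" "V (Suc 4) = C" "V 5 = C"
    by (simp_all add: vertex_def)
  have 0: "angle_at A B C = arccos (cosine 0)"
    by (simp add: angle_at_def cosine_def len_def V_simps V5 dist_norm norm_minus_commute)
  have 1: "angle_at B C A = arccos (cosine 1)"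
    by (simp add: angle_at_def cosine_def len_def V_simps V5 dist_norm norm_minus_commute)
  have 2: "angle_at C A B = arccos (cosine 2)"
    by (simp add: angle_at_def cosine_def len_def V_simps V5 dist_norm norm_minus_commute)
  show ?thesis
    unfolding acute_triangle_def 0 1 2 acos[OF cosine_abs_less_1] ..
qed

end

section \<open>The slap map in terms of side lengths and cosines\<close>

locale slap_model =
  fixes l c a :: "nat \<Rightarrow> real" and f :: "real \<Rightarrow> real"
  assumes l_pos: "0 < l i" and c_abs: "\<bar>c i\<bar> < 1"
    and l_mod: "l (i mod 3) = l i" and c_mod: "c (i mod 3) = c i"
    and l_eq: "l i = l (i + 2) * c i + l (i + 1) * c (i + 1)"
    and a_0: "a 0 = 0" and a_Suc: "a (Suc i) = a i + l i"
    and f_maps: "x \<in> {0..a 3} \<Longrightarrow> f x \<in> {0..a 3}"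
    and f_back: "\<lbrakk>i < 3; 0 < t; t < l i; t < l (i + 2) * c i\<rbrakk> \<Longrightarrow>
      f (a i + t) = a ((i + 2) mod 3) + (l (i + 2) - t / c i)"
    and f_forward: "\<lbrakk>i < 3; 0 < t; t < l i; l (i + 2) * c i < t\<rbrakk> \<Longrightarrow>
      f (a i + t) = a ((i + 1) mod 3) + (l i - t) / c (i + 1)"
begin

text \<open>The signed distance from the start of side \<open>i\<close> to the foot of the altitude
  on it. It leaves the range between 0 and \<open>l i\<close> when an angle at this side is
  obtuse.\<close>

definition foot :: "nat \<Rightarrow> real" where "foot i = l (i + 2) * c i"

definition side :: "nat \<Rightarrow> real set" where "side i = {a i<..<a i + l i}"

definition cuts :: "real set" where
  "cuts = a ` {..3} \<union> {a i + foot i | i. i < 3 \<and> 0 < foot i \<and> foot i < l i}"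

text \<open>A branch has slope - 1 / c for one of the three cosines, so this bounds all slopes from
  below in modulus; the entry 1 / 2 keeps the maximum positive.\<close>

definition rate :: real where "rate = 1 / Max {1 / 2, \<bar>c 0\<bar>, \<bar>c 1\<bar>, \<bar>c 2\<bar>}"

lemma foot_compl: "l i - foot i = l (i + 1) * c (i + 1)"
  using l_eq[of i] by (simp add: foot_def)

lemma less_3: "i < 3 \<longleftrightarrow> i = 0 \<or> i = 1 \<or> i = (2::nat)"
  by auto

lemma a_simps: "a 0 = 0" "a (Suc 0) = l 0" "a 1 = l 0" "a 2 = l 0 + l 1" "a 3 = l 0 + l 1 + l 2"
  using a_Suc[of 0] a_Suc[of 1] a_Suc[of 2] by (simp_all add: a_0 eval_nat_numeral)

lemma l_mod': "l 3 = l 0" "l 4 = l 1" "l 5 = l 2" "c 3 = c 0" "c 4 = c 1" "c 5 = c 2"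
  using l_mod[of 3] l_mod[of 4] l_mod[of 5] c_mod[of 3] c_mod[of 4] c_mod[of 5] by simp_all

lemma finite_a: "finite (a ` {..3})" by simp

lemma finite_cuts': "finite cuts"
proof -
  have "{a i + foot i | i. i < 3 \<and> 0 < foot i \<and> foot i < l i} \<subseteq> (\<lambda>i. a i + foot i) ` {..<3}" by auto
  thus ?thesis unfolding cuts_def by (intro finite_UnI finite_a) (rule finite_subset, auto)
qed

lemma c_le_rate: "\<bar>c i\<bar> \<le> 1 / rate" and rate_gt_1: "1 < rate"
proof -
  define k where "k = Max {1 / 2, \<bar>c 0\<bar>, \<bar>c 1\<bar>, \<bar>c 2\<bar>}"
  have k: "1 / 2 \<le> k" "\<bar>c 0\<bar> \<le> k" "\<bar>c 1\<bar> \<le> k" "\<bar>c 2\<bar> \<le> k"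
    unfolding k_def by (intro Max_ge; simp)+
  have "k < 1" unfolding k_def using c_abs[of 0] c_abs[of 1] c_abs[of 2] by (subst Max_less_iff) auto
  moreover have rk: "rate = 1 / k" by (simp only: rate_def k_def)
  ultimately show "1 < rate" using k(1) by simp
  have "i mod 3 < 3" by simp
  hence "\<bar>c (i mod 3)\<bar> \<le> k" unfolding less_3 using k by auto
  thus "\<bar>c i\<bar> \<le> 1 / rate" by (simp add: c_mod rk)
qed

lemma side_cases:
  assumes "x < y" "0 \<le> x" "y \<le> a 3" "{x<..<y} \<inter> a ` {..3} = {}"
  obtains i where "i < 3" "a i \<le> x" "y \<le> a i + l i"
proof -
  have no: "\<not> (x < a i \<and> a i < y)" if "i \<le> 3" for i
    using assms(4) that by auto
  consider "y \<le> a 1" | "a 1 \<le> x" "y \<le> a 2" | "a 2 \<le> x"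
    using no[of 1] no[of 2] assms(1) by fastforce
  thus ?thesis
  proof cases
    case 1
    thus ?thesis using assms by (intro that[of 0]) (auto simp: a_simps)
  next
    case 2
    thus ?thesis using assms by (intro that[of 1]) (auto simp: a_simps)
  next
    case 3
    thus ?thesis using assms by (intro that[of 2]) (auto simp: a_simps)
  qed
qed

lemma point_cases:
  assumes "x \<in> {0..a 3}" "x \<notin> a ` {..3}"
  obtains i where "i < 3" "x \<in> side i"
proof -
  have no: "x \<noteq> a i" if "i \<le> 3" for i using assms(2) that by auto
  consider "x < a 1" | "a 1 < x" "x < a 2" | "a 2 < x"
    using no[of 1] no[of 2] by fastforce
  thus ?thesis
  proof cases
    case 1
    thus ?thesis using assms no[of 0] by (intro that[of 0]) (auto simp: a_simps side_def)
  next
    case 2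
    thus ?thesis using assms by (intro that[of 1]) (auto simp: a_simps side_def)
  next
    case 3
    thus ?thesis using assms no[of 3] by (intro that[of 2]) (auto simp: a_simps side_def)
  qed
qed

lemma side_subset: "i < 3 \<Longrightarrow> side i \<subseteq> {0..a 3}"
  unfolding less_3 using l_pos[of 0] l_pos[of 1] l_pos[of 2] by (auto simp: side_def a_simps)

lemma side_disjoint: "i < 3 \<Longrightarrow> j < 3 \<Longrightarrow> i \<noteq> j \<Longrightarrow> side i \<inter> side j = {}"
  unfolding less_3 using l_pos[of 0] l_pos[of 1] l_pos[of 2] by (auto simp: side_def a_simps)

lemma side_not_vertex: "i < 3 \<Longrightarrow> x \<in> side i \<Longrightarrow> x \<notin> a ` {..3}"
proof
  assume "i < 3" "x \<in> side i" "x \<in> a ` {..3}"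
  then obtain k where "k \<le> 3" "x = a k" by auto
  hence "k = 0 \<or> k = 1 \<or> k = 2 \<or> k = 3" by auto
  thus False using \<open>i < 3\<close> \<open>x \<in> side i\<close> \<open>x = a k\<close> l_pos[of 0] l_pos[of 1] l_pos[of 2]
    unfolding less_3 by (elim disjE) (auto simp: side_def a_simps)
qed

lemma back_side:
  assumes "i < 3" "x \<in> side i" "x < a i + foot i"
  shows "0 < c i" "f x = a ((i + 2) mod 3) + (l (i + 2) - (x - a i) / c i)" "f x \<in> side ((i + 2) mod 3)"
proof -
  define t where "t = x - a i"
  have t: "0 < t" "t < l i" "t < l (i + 2) * c i" "x = a i + t" using assms by (auto simp: t_def side_def foot_def)
  have "0 < l (i + 2) * c i" using t by linarith
  thus c: "0 < c i" using l_pos[of "i + 2"] by (simp add: zero_less_mult_iff)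
  show eq: "f x = a ((i + 2) mod 3) + (l (i + 2) - (x - a i) / c i)"
    using f_back[OF assms(1) t(1-3)] t(4) by simp
  have "0 < l (i + 2) - t / c i" "l (i + 2) - t / c i < l (i + 2)"
    using t c by (simp_all add: pos_divide_less_eq)
  thus "f x \<in> side ((i + 2) mod 3)"
    unfolding side_def eq t_def[symmetric] l_mod by simp
qed

lemma forward_side:
  assumes "i < 3" "x \<in> side i" "a i + foot i < x"
  shows "0 < c (i + 1)" "f x = a ((i + 1) mod 3) + (l i - (x - a i)) / c (i + 1)" "f x \<in> side ((i + 1) mod 3)"
proof -
  define t where "t = x - a i"
  have t: "0 < t" "t < l i" "l (i + 2) * c i < t" "x = a i + t" using assms by (auto simp: t_def side_def foot_def)
  have lt: "l i - t < l (i + 1) * c (i + 1)" using t foot_compl[of i] by (simp add: foot_def)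
  hence "0 < l (i + 1) * c (i + 1)" using t by linarith
  thus c: "0 < c (i + 1)" using l_pos[of "i + 1"] by (simp add: zero_less_mult_iff)
  show eq: "f x = a ((i + 1) mod 3) + (l i - (x - a i)) / c (i + 1)"
    using f_forward[OF assms(1) t(1-3)] t(4) by simp
  have "0 < (l i - t) / c (i + 1)" "(l i - t) / c (i + 1) < l (i + 1)"
    using t c lt by (simp_all add: pos_divide_less_eq)
  thus "f x \<in> side ((i + 1) mod 3)"
    unfolding side_def eq t_def[symmetric] l_mod by simp
qed

lemma not_cut_cases:
  assumes "i < 3" "x \<in> side i" "x \<notin> cuts"
  shows "x < a i + foot i \<or> a i + foot i < x"
proof (rule ccontr)
  assume "\<not> ?thesis"
  hence "x = a i + foot i" by simp
  thus False using assms by (auto simp: cuts_def side_def)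
qed

text \<open>An interval without cuts lies in a single side and does not contain the foot of its
  altitude, so a single branch applies, with slope - 1 / c.\<close>

sublocale expanding_map "a 3" f cuts rate
proof
  show "0 < a 3" using l_pos[of 0] l_pos[of 1] l_pos[of 2] by (simp add: a_simps)
  show "0 < rate" using rate_gt_1 by simp
  show "finite cuts" by (rule finite_cuts')
  show "f x \<in> {0..a 3}" if "x \<in> {0..a 3}" for x using that by (rule f_maps)
  show "1 < rate" by (rule rate_gt_1)
  have slope: "rate \<le> \<bar>- 1 / c i\<bar>" if "0 < c i" for i
  proof -
    have "c i \<le> 1 / rate" using c_le_rate[of i] that by simp
    hence "c i * rate \<le> 1" using rate_gt_1 by (simp add: field_simps)
    thus ?thesis using that by (simp add: abs_divide field_simps)
  qed
  fix x y assume xy: "x < y" "0 \<le> x" "y \<le> a 3" "{x<..<y} \<inter> cuts = {}"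
  hence "{x<..<y} \<inter> a ` {..3} = {}" by (auto simp: cuts_def)
  then obtain i where i: "i < 3" "a i \<le> x" "y \<le> a i + l i" using side_cases[OF xy(1-3)] by metis
  hence sub: "z \<in> side i" if "z \<in> {x<..<y}" for z using that by (auto simp: side_def)
  have "\<not> (x < a i + foot i \<and> a i + foot i < y)"
  proof
    assume *: "x < a i + foot i \<and> a i + foot i < y"
    hence "0 < foot i" "foot i < l i" using i by auto
    hence "a i + foot i \<in> cuts" using i(1) by (auto simp: cuts_def)
    thus False using * xy(4) by auto
  qed
  then consider "y \<le> a i + foot i" | "a i + foot i \<le> x" by linarith
  thus "\<exists>\<sigma> \<tau>. rate \<le> \<bar>\<sigma>\<bar> \<and> (\<forall>z\<in>{x<..<y}. f z = \<sigma> * z + \<tau>)"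
  proof cases
    case 1
    have b: "0 < c i" "f z = a ((i + 2) mod 3) + (l (i + 2) - (z - a i) / c i)" if "z \<in> {x<..<y}" for z
      using back_side[OF i(1) sub[OF that]] that 1 by auto
    have "0 < c i" using b(1)[of "(x + y) / 2"] xy(1) by auto
    moreover have "f z = (- 1 / c i) * z + (a ((i + 2) mod 3) + l (i + 2) + a i / c i)" if "z \<in> {x<..<y}" for z
      using b(2)[OF that] by (simp add: diff_divide_distrib)
    ultimately show ?thesis using slope by blast
  next
    case 2
    have b: "0 < c (i + 1)" "f z = a ((i + 1) mod 3) + (l i - (z - a i)) / c (i + 1)" if "z \<in> {x<..<y}" for z
      using forward_side[OF i(1) sub[OF that]] that 2 by auto
    have "0 < c (i + 1)" using b(1)[of "(x + y) / 2"] xy(1) by auto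
    moreover have "f z = (- 1 / c (i + 1)) * z + (a ((i + 1) mod 3) + (l i + a i) / c (i + 1))" if "z \<in> {x<..<y}" for z
      using b(2)[OF that] by (simp add: diff_divide_distrib add_divide_distrib)
    ultimately show ?thesis using slope by blast
  qed
qed

lemma image_not_vertex:
  assumes "x \<in> {0..a 3} - cuts"
  shows "f x \<notin> a ` {..3}"
proof -
  have "x \<notin> a ` {..3}" using assms by (auto simp: cuts_def)
  then obtain i where i: "i < 3" "x \<in> side i" using point_cases[of x] assms by auto
  have "f x \<in> side ((i + 2) mod 3) \<or> f x \<in> side ((i + 1) mod 3)"
    using not_cut_cases[OF i] back_side(3)[OF i] forward_side(3)[OF i] assms by blast
  thus ?thesis using side_not_vertex[of "(i + 2) mod 3" "f x"] side_not_vertex[of "(i + 1) mod 3" "f x"] by auto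
qed

lemma AE_not_cut:
  assumes "acip {0..a 3} f \<mu>"
  shows "AE x in \<mu>. x \<notin> cuts"
proof (rule AE_I')
  have "cuts \<inter> {0..a 3} \<in> null_sets lborel"
    using finite_cuts' by (intro finite_imp_null_set_lborel) auto
  hence "cuts \<inter> {0..a 3} \<in> null_sets leb"
    by (subst null_sets_restrict_space) auto
  thus "cuts \<inter> {0..a 3} \<in> null_sets \<mu>"
    using assms by (auto simp: acip_def absolutely_continuous_def)
  have "space \<mu> = {0..a 3}"
    using assms sets_eq_imp_space_eq[of \<mu> "restrict_space borel {0..a 3}"]
    by (auto simp: acip_def space_restrict_space)
  thus "{x \<in> space \<mu>. \<not> x \<notin> cuts} \<subseteq> cuts \<inter> {0..a 3}" by blast
qed

section \<open>Triangles with a non-acute angle\<close>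

context
  fixes k assumes k: "k < 3" and obtuse: "c k \<le> 0"
begin

text \<open>The angle at vertex \<open>k\<close> is not acute, so the altitudes onto the two sides
  that meet there have their feet at this vertex or beyond it; each of these sides carries a single
  branch.\<close>

lemma foot_bounds: "foot k \<le> 0" "l (k + 2) \<le> foot (k + 2)"
proof -
  show "foot k \<le> 0" using obtuse l_pos[of "k + 2"] by (simp add: foot_def mult_nonneg_nonpos)
  have "l (k + 2) - foot (k + 2) = l (k + 3) * c (k + 3)" using foot_compl[of "k + 2"] by (simp add: numeral_3_eq_3)
  also have "\<dots> = l k * c k" using l_mod[of "k + 3"] c_mod[of "k + 3"] l_mod[of k] c_mod[of k] by simp
  also have "\<dots> \<le> 0" using obtuse l_pos[of k] by (simp add: mult_nonneg_nonpos)
  finally show "l (k + 2) \<le> foot (k + 2)" by simp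
qed

lemma foot_mod: "foot (i mod 3) = foot i"
proof -
  have "l ((i mod 3 + 2) mod 3) = l ((i + 2) mod 3)" by (simp only: mod_add_left_eq)
  hence "l (i mod 3 + 2) = l (i + 2)" by (simp only: l_mod)
  thus ?thesis by (simp add: foot_def c_mod)
qed

text \<open>Rays from the two sides at vertex \<open>k\<close> all reach the opposite side, forward
  from side \<open>k\<close> and back from side \<open>k + 2\<close>; a ray from the opposite side
  lands on one of these two, whichever branch applies.\<close>

lemma obtuse_swap:
  assumes x: "x \<in> {0..a 3}" "x \<notin> cuts"
  defines "X \<equiv> side ((k + 1) mod 3)" and "Y \<equiv> side k \<union> side ((k + 2) mod 3)"
  shows "x \<in> X \<and> f x \<in> Y \<or> x \<in> Y \<and> f x \<in> X"
proof -
  have "x \<notin> a ` {..3}" using x by (auto simp: cuts_def)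
  then obtain i where i: "i < 3" "x \<in> side i" using point_cases[of x] x by auto
  have "i = k \<or> i = (k + 1) mod 3 \<or> i = (k + 2) mod 3" using i(1) k unfolding less_3 by auto
  thus ?thesis
  proof (elim disjE)
    assume e: "i = k"
    hence "a i + foot i < x" using foot_bounds(1) i(2) by (auto simp: side_def)
    hence "f x \<in> side ((i + 1) mod 3)" using forward_side(3)[OF i] by blast
    thus ?thesis using e i by (auto simp: X_def Y_def)
  next
    assume e: "i = (k + 1) mod 3"
    have "(i + 2) mod 3 = k" "(i + 1) mod 3 = (k + 2) mod 3" using k e unfolding less_3 by auto
    hence "f x \<in> Y" using not_cut_cases[OF i x(2)] back_side(3)[OF i] forward_side(3)[OF i] by (auto simp: Y_def)
    thus ?thesis using e i by (auto simp: X_def)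
  next
    assume e: "i = (k + 2) mod 3"
    have "l i \<le> foot i" using foot_bounds(2) unfolding e by (simp add: l_mod foot_mod)
    hence "x < a i + foot i" using i(2) by (auto simp: side_def)
    hence "f x \<in> side ((i + 2) mod 3)" using back_side(3)[OF i] by blast
    moreover have "(i + 2) mod 3 = (k + 1) mod 3" using k e unfolding less_3 by auto
    ultimately show ?thesis using e i by (auto simp: X_def Y_def)
  qed
qed

lemma obtuse_cuts: "cuts \<subseteq> insert (a ((k + 1) mod 3) + foot (k + 1)) (a ` {..3})"
proof
  fix x assume "x \<in> cuts"
  moreover have "x \<in> insert (a ((k + 1) mod 3) + foot (k + 1)) (a ` {..3})"
    if i: "x = a i + foot i" "i < 3" "0 < foot i" "foot i < l i" for i
  proof -
    have "i = k \<or> i = (k + 1) mod 3 \<or> i = (k + 2) mod 3" using i(2) k unfolding less_3 by auto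
    thus ?thesis
    proof (elim disjE)
      assume "i = k"
      thus ?thesis using foot_bounds(1) i(3) by simp
    next
      assume "i = (k + 1) mod 3"
      thus ?thesis using i(1) by (simp add: foot_mod)
    next
      assume "i = (k + 2) mod 3"
      hence "l i \<le> foot i" using foot_bounds(2) by (simp add: l_mod foot_mod)
      thus ?thesis using i(4) by simp
    qed
  qed
  ultimately show "x \<in> insert (a ((k + 1) mod 3) + foot (k + 1)) (a ` {..3})" by (auto simp: cuts_def)
qed

text \<open>The other two cosines are positive by the projection formulas for the sides at vertex
  \<open>k\<close>, so the foot on the opposite side lies strictly inside it. The result, one extra
  cut besides the vertices, has the form that \<open>lebesgue_ergodic\<close> asks for.\<close>

lemma obtuse_cut_eq: "cuts = insert (a ((k + 1) mod 3) + foot (k + 1)) (a ` {..3})"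
proof -
  define i where "i = (k + 1) mod 3"
  have f: "foot i = foot (k + 1)" unfolding i_def by (rule foot_mod)
  have "l (k + 1) - foot (k + 1) = l (k + 2) * c (k + 2)" using foot_compl[of "k + 1"] by simp
  moreover have "0 < foot (k + 2)" using foot_bounds(2) l_pos[of "k + 2"] by linarith
  hence "0 < c (k + 2)" using l_pos[of "k + 2 + 2"] unfolding foot_def by (simp add: zero_less_mult_iff)
  hence "0 < l (k + 2) * c (k + 2)" using l_pos by simp
  ultimately have 1: "foot (k + 1) < l (k + 1)" by linarith
  have "l k - foot k = l (k + 1) * c (k + 1)" by (rule foot_compl)
  hence "0 < l (k + 1) * c (k + 1)" using foot_bounds(1) l_pos[of k] by linarith
  hence "0 < c (k + 1)" using l_pos[of "k + 1"] by (simp add: zero_less_mult_iff)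
  hence "0 < foot (k + 1)" using l_pos unfolding foot_def by simp
  hence "a i + foot i \<in> cuts"
    unfolding cuts_def using 1 f l_mod[of "k + 1"] by (intro UnI2 CollectI exI[of _ i]) (auto simp: i_def)
  thus ?thesis using obtuse_cuts f by (auto simp: i_def cuts_def)
qed

lemma obtuse_unique_ergodic_acip: "\<exists>!\<mu>. acip {0..a 3} f \<mu> \<and> ergodic f \<mu>"
  by (rule unique_ergodic_acip, rule lebesgue_ergodic[OF finite_a obtuse_cut_eq image_not_vertex]) auto

lemma obtuse_even_period:
  assumes "acip {0..a 3} f \<mu>" "mixing_components f \<mu> n \<Sigma>"
  shows "even n"
proof (rule even_mixing_period[OF _ _ _ _ _ _ _ assms(2)])
  have s: "sets \<mu> = sets (restrict_space borel {0..a 3})" using assms(1) by (simp add: acip_def)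
  have sp: "space \<mu> = {0..a 3}" using sets_eq_imp_space_eq[OF s] by (simp add: space_restrict_space)
  show "prob_space \<mu>" "invariant_under f \<mu>" using assms(1) by (auto simp: acip_def)
  show "AE x in \<mu>. x \<in> measure_support \<mu>" by (rule AE_measure_support[OF s])
  have side_sets: "side i \<in> sets \<mu>" if "i < 3" for i
    unfolding s sets_restrict_space_iff[of "{0..a 3}" borel, simplified]
    using side_subset[OF that] by (simp add: side_def)
  show "side ((k + 1) mod 3) \<in> sets \<mu>" by (rule side_sets) simp
  show "side k \<union> side ((k + 2) mod 3) \<in> sets \<mu>"
    using side_sets k by (intro sets.Un) auto
  show "side ((k + 1) mod 3) \<inter> (side k \<union> side ((k + 2) mod 3)) = {}"
    using k side_disjoint[of "(k + 1) mod 3" k] side_disjoint[of "(k + 1) mod 3" "(k + 2) mod 3"]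
    unfolding less_3 by auto
  show "AE x in \<mu>. x \<in> side ((k + 1) mod 3) \<and> f x \<in> side k \<union> side ((k + 2) mod 3) \<or>
      x \<in> side k \<union> side ((k + 2) mod 3) \<and> f x \<in> side ((k + 1) mod 3)"
    using AE_not_cut[OF assms(1)] AE_space[of \<mu>] by eventually_elim (use obtuse_swap in \<open>simp add: sp\<close>)
qed

end

end

section \<open>Acute triangles\<close>

text \<open>Once the perturbation is below (1 - k) * r / 2, the recursion preserves the bound r / 2,
  and the excess over it decays like k ^ n.\<close>

lemma null_of_contraction:
  fixes d e :: "nat \<Rightarrow> real"
  assumes k: "0 \<le> k" "k < 1" and d: "\<And>n. 0 \<le> d n" and rec: "\<And>n. d (Suc n) \<le> k * d n + e n"
    and e: "e \<longlonglongrightarrow> 0"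
  shows "d \<longlonglongrightarrow> 0"
proof (rule LIMSEQ_I)
  fix r :: real assume r: "0 < r"
  have "0 < (1 - k) * (r / 2)" using k r by simp
  then obtain N where N: "\<And>n. n \<ge> N \<Longrightarrow> norm (e n - 0) < (1 - k) * (r / 2)" using LIMSEQ_D[OF e] by blast
  have ind: "d (N + n) \<le> k ^ n * d N + r / 2" for n
  proof (induction n)
    case (Suc n)
    have "d (N + Suc n) \<le> k * d (N + n) + e (N + n)" using rec[of "N + n"] by simp
    also have "\<dots> \<le> k * (k ^ n * d N + r / 2) + (1 - k) * (r / 2)"
      using N[of "N + n"] mult_left_mono[OF Suc k(1)] by (simp add: abs_less_iff)
    also have "\<dots> = k ^ Suc n * d N + r / 2" by (simp add: field_simps)
    finally show ?case .
  qed (use r in simp)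
  have "(\<lambda>n. k ^ n * d N) \<longlonglongrightarrow> 0 * d N"
    using k by (intro tendsto_mult LIMSEQ_power_zero tendsto_const) auto
  hence "(\<lambda>n. k ^ n * d N) \<longlonglongrightarrow> 0" by simp
  then obtain K where K: "\<And>n. n \<ge> K \<Longrightarrow> norm (k ^ n * d N - 0) < r / 2"
    using LIMSEQ_D[of _ 0 "r / 2"] r by (meson half_gt_zero)
  have "norm (d n - 0) < r" if "n \<ge> N + K" for n
  proof -
    have "d n \<le> k ^ (n - N) * d N + r / 2" using ind[of "n - N"] that by simp
    moreover have "norm (k ^ (n - N) * d N - 0) < r / 2" using K[of "n - N"] that by simp
    ultimately show ?thesis using d[of n] by (simp add: abs_less_iff)
  qed
  thus "\<exists>no. \<forall>n\<ge>no. norm (d n - 0) < r" by blast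
qed

text \<open>The deficit B - y at one state passes with a factor of at least \<epsilon> to both other
  states. From \<open>j\<close> to \<open>i\<close> in two steps the route goes over a state
  \<open>k\<close> different from both, which also exists when i = j.\<close>

lemma three_state_two_steps:
  fixes y :: "nat \<Rightarrow> nat \<Rightarrow> real" and p :: "nat \<Rightarrow> real"
  assumes rec: "\<And>n i. i < 3 \<Longrightarrow> y (Suc n) i = p i * y n ((i + 1) mod 3) + (1 - p i) * y n ((i + 2) mod 3)"
    and p: "\<And>i. i < 3 \<Longrightarrow> \<epsilon> \<le> p i \<and> p i \<le> 1 - \<epsilon>" and \<epsilon>: "0 < \<epsilon>"
    and B: "\<And>i. i < 3 \<Longrightarrow> y n i \<le> B" and ij: "i < 3" "j < 3"
  shows "y (Suc n) i \<le> B" "\<epsilon>\<^sup>2 * (B - y n j) \<le> B - y (Suc (Suc n)) i"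
proof -
  have step: "y (Suc n) i \<le> B \<and> (\<forall>j<3. j \<noteq> i \<longrightarrow> \<epsilon> * (B - y n j) \<le> B - y (Suc n) i)"
    if i: "i < 3" and B: "\<And>i. i < 3 \<Longrightarrow> y n i \<le> B" for n i
  proof -
    define u where "u = B - y n ((i + 1) mod 3)"
    define v where "v = B - y n ((i + 2) mod 3)"
    have uv: "0 \<le> u" "0 \<le> v" using B[of "(i + 1) mod 3"] B[of "(i + 2) mod 3"] by (auto simp: u_def v_def)
    have e: "B - y (Suc n) i = p i * u + (1 - p i) * v" by (simp add: rec[OF i] u_def v_def algebra_simps)
    have pe: "\<epsilon> \<le> p i" "\<epsilon> \<le> 1 - p i" using p[OF i] by auto
    have 1: "\<epsilon> * u \<le> p i * u" "\<epsilon> * v \<le> (1 - p i) * v" using mult_right_mono[OF pe(1) uv(1)] mult_right_mono[OF pe(2) uv(2)] by blast+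
    have 2: "0 \<le> \<epsilon> * u" "0 \<le> \<epsilon> * v" using uv \<epsilon> by auto
    have "\<epsilon> * (B - y n j) \<le> B - y (Suc n) i" if "j < 3" "j \<noteq> i" for j
    proof -
      have "i = 0 \<or> i = 1 \<or> i = 2" "j = 0 \<or> j = 1 \<or> j = 2" using that(1) i by auto
      hence "j = (i + 1) mod 3 \<or> j = (i + 2) mod 3" using that(2) by (elim disjE) simp_all
      thus ?thesis
      proof
        assume "j = (i + 1) mod 3"
        hence j: "B - y n j = u" by (simp only: u_def)
        show ?thesis unfolding j e using 1 2 by linarith
      next
        assume "j = (i + 2) mod 3"
        hence j: "B - y n j = v" by (simp only: v_def)
        show ?thesis unfolding j e using 1 2 by linarith
      qed
    qed
    moreover have "0 \<le> B - y (Suc n) i" unfolding e using 1 2 by linarith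
    ultimately show ?thesis by auto
  qed
  show "y (Suc n) i \<le> B" using step[OF ij(1) B] by blast
  obtain k where k: "k < 3" "k \<noteq> i" "k \<noteq> j"
  proof -
    have "i = 0 \<or> i = 1 \<or> i = 2" "j = 0 \<or> j = 1 \<or> j = 2" using ij by auto
    thus ?thesis using that[of 0] that[of 1] that[of 2] by (elim disjE) simp_all
  qed
  have B': "y (Suc n) i \<le> B" if "i < 3" for i using step[OF that B] by blast
  have "\<epsilon>\<^sup>2 * (B - y n j) = \<epsilon> * (\<epsilon> * (B - y n j))" by (simp add: power2_eq_square)
  also have "\<dots> \<le> \<epsilon> * (B - y (Suc n) k)"
    using step[OF k(1) B] k(3) ij(2) \<epsilon> by (intro mult_left_mono) auto
  also have "\<dots> \<le> B - y (Suc (Suc n)) i" using step[OF ij(1) B'] k by auto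
  finally show "\<epsilon>\<^sup>2 * (B - y n j) \<le> B - y (Suc (Suc n)) i" .
qed

text \<open>Each new value is a proper average of the two others, so after two steps it is a proper
  average of all three, and their oscillation tends to zero.\<close>

lemma three_state_average_null:
  fixes y :: "nat \<Rightarrow> nat \<Rightarrow> real" and p w :: "nat \<Rightarrow> real"
  assumes rec: "\<And>n i. i < 3 \<Longrightarrow> y (Suc n) i = p i * y n ((i + 1) mod 3) + (1 - p i) * y n ((i + 2) mod 3)"
    and p: "\<And>i. i < 3 \<Longrightarrow> 0 < p i \<and> p i < 1" and w: "\<And>i. i < 3 \<Longrightarrow> 0 < w i"
    and mean: "\<And>n. (\<Sum>i<3. w i * y n i) = 0" and i: "i < 3"
  shows "(\<lambda>n. y n i) \<longlonglongrightarrow> 0"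
proof -
  define \<epsilon> where "\<epsilon> = Min ((\<lambda>i. min (p i) (1 - p i)) ` {..<3})"
  have \<epsilon>: "0 < \<epsilon>" unfolding \<epsilon>_def using p by (subst Min_gr_iff) (auto simp: lessThan_empty_iff)
  have pe: "\<epsilon> \<le> p i \<and> p i \<le> 1 - \<epsilon>" if "i < 3" for i
  proof -
    have "\<epsilon> \<le> min (p i) (1 - p i)" unfolding \<epsilon>_def using that by (intro Min_le) auto
    thus ?thesis by auto
  qed
  define M where "M n = Max (y n ` {..<3})" for n
  define m where "m n = Min (y n ` {..<3})" for n
  have ne: "y n ` {..<3} \<noteq> {}" "finite (y n ` {..<3})" for n by (auto simp: lessThan_empty_iff)
  have le: "y n i \<le> M n" "m n \<le> y n i" if "i < 3" for n i
    using that ne by (auto simp: M_def m_def intro!: Max_ge Min_le)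
  have att: "\<exists>i<3. M n = y n i" "\<exists>i<3. m n = y n i" for n
    using Max_in[OF ne(2,1)] Min_in[OF ne(2,1)] by (auto simp: M_def m_def)
  have rec': "- y (Suc n) i = p i * - y n ((i + 1) mod 3) + (1 - p i) * - y n ((i + 2) mod 3)" if "i < 3" for n i
    using rec[OF that, of n] by (simp add: algebra_simps)
  note up = three_state_two_steps[where y = y and p = p and \<epsilon> = \<epsilon>, OF rec pe \<epsilon>]
  note down = three_state_two_steps[where y = "\<lambda>n i. - y n i" and p = p and \<epsilon> = \<epsilon>, OF rec' pe \<epsilon>]
  define R where "R n = M n - m n" for n
  have R0: "0 \<le> R n" for n using le[of 0 n] by (simp add: R_def)
  have R1: "R (Suc n) \<le> R n" for n
  proof -
    obtain i j where ij: "i < 3" "M (Suc n) = y (Suc n) i" "j < 3" "m (Suc n) = y (Suc n) j"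
      using att[of "Suc n"] by blast
    have "y (Suc n) i \<le> M n"
      by (rule up(1)[of n "M n" i i]) (use le(1) ij in auto)
    moreover have "- y (Suc n) j \<le> - m n"
      by (rule down(1)[of n "- m n" j j]) (use le(2) ij in auto)
    ultimately show ?thesis using ij by (simp add: R_def)
  qed
  have R2: "R (Suc (Suc n)) \<le> R n - \<epsilon>\<^sup>2 * R n" for n
  proof -
    obtain i j i' j' where ij: "i < 3" "M (Suc (Suc n)) = y (Suc (Suc n)) i" "j < 3" "m (Suc (Suc n)) = y (Suc (Suc n)) j"
      "i' < 3" "m n = y n i'"
      using att[of "Suc (Suc n)"] att[of n] by blast
    have "\<epsilon>\<^sup>2 * (M n - y n i') \<le> M n - y (Suc (Suc n)) i"
      by (rule up(2)[of n "M n" i i']) (use le(1) ij in auto)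
    moreover have "m n \<le> y (Suc (Suc n)) j"
    proof -
      have "- y (Suc n) k \<le> - m n" if "k < 3" for k
        by (rule down(1)[of n "- m n" k k]) (use le(2) that in auto)
      hence "- y (Suc (Suc n)) j \<le> - m n"
        using ij by (intro down(1)[of "Suc n" "- m n" j j]) auto
      thus ?thesis by simp
    qed
    ultimately show ?thesis using ij by (simp add: R_def)
  qed
  have "decseq R" using R1 by (rule decseq_SucI)
  then obtain r where r: "R \<longlonglongrightarrow> r" using decseq_convergent[of R 0] R0 by blast
  have "r \<le> r - \<epsilon>\<^sup>2 * r"
  proof (rule LIMSEQ_le)
    show "(\<lambda>n. R (Suc (Suc n))) \<longlonglongrightarrow> r" using r by (intro LIMSEQ_Suc)
    show "(\<lambda>n. R n - \<epsilon>\<^sup>2 * R n) \<longlonglongrightarrow> r - \<epsilon>\<^sup>2 * r" by (intro tendsto_intros r)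
  qed (use R2 in blast)
  moreover have "0 \<le> r" using r R0 by (meson LIMSEQ_le_const)
  ultimately have "r = 0" using \<epsilon> by (auto simp: mult_le_0_iff)
  \<comment> \<open>A mean with positive weights vanishes, so 0 lies between the minimum and the
    maximum, and every value is bounded by the oscillation.\<close>
  have "norm (y n i) \<le> R n" for n
  proof -
    have "\<not> M n < 0"
    proof
      assume "M n < 0"
      hence "y n i < 0" if "i < 3" for i using le(1)[OF that, of n] by linarith
      hence "0 < (\<Sum>i<3. w i * - y n i)"
        using w by (intro sum_pos) (auto simp: mult_pos_neg lessThan_empty_iff)
      thus False using mean[of n] by (simp add: sum_negf)
    qed
    moreover have "\<not> 0 < m n"
    proof
      assume "0 < m n"
      hence "0 < y n i" if "i < 3" for i using le(2)[OF that, of n] by linarith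
      hence "0 < (\<Sum>i<3. w i * y n i)"
        using w by (intro sum_pos) (auto simp: lessThan_empty_iff)
      thus False using mean by simp
    qed
    ultimately show ?thesis using le[OF i, of n] by (auto simp: R_def abs_le_iff)
  qed
  hence "\<forall>\<^sub>F n in sequentially. norm (y n i) \<le> R n" by (intro always_eventually allI)
  moreover have "R \<longlonglongrightarrow> 0" using r \<open>r = 0\<close> by simp
  ultimately show ?thesis by (rule Lim_null_comparison)
qed

section \<open>Segments of the sides and the invariant density\<close>

context slap_model
begin

text \<open>Slices over initial segments of the sides determine the mass on every half-line, and the
  slices of a preimage are expressed by slices of the set itself, which yields recursions in the
  number of iterations.\<close>

definition slice :: "real set \<Rightarrow> nat \<Rightarrow> real \<Rightarrow> real" where
  "slice E i t = measure lborel ({a (i mod 3)<..<a (i mod 3) + t} \<inter> E)"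

definition preim :: "real set \<Rightarrow> real set" where "preim E = {0..a 3} \<inter> f -` E"

lemma slice_mod: "slice E (i mod 3) t = slice E i t"
  by (simp add: slice_def)

lemma slice_0 [simp]: "slice E i 0 = 0"
  by (simp add: slice_def)

lemma slice_nonneg: "0 \<le> slice E i t"
  by (simp add: slice_def)

lemma preim_sets: "E \<in> sets borel \<Longrightarrow> preim E \<in> sets borel"
  unfolding preim_def by (rule borel_vimage)

lemma measure_split:
  fixes x y z :: real
  assumes "x \<le> y" "y \<le> z" "E \<in> sets borel"
  shows "measure lborel ({x<..<z} \<inter> E) = measure lborel ({x<..<y} \<inter> E) + measure lborel ({y<..<z} \<inter> E)"
proof -
  have eq: "{x<..<z} \<inter> E - ({y} \<inter> E) = ({x<..<y} \<inter> E) \<union> ({y<..<z} \<inter> E)" using assms by auto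
  have "{y} \<inter> E \<in> null_sets lborel" by (intro finite_imp_null_set_lborel) auto
  hence "measure lborel ({x<..<z} \<inter> E) = measure lborel ({x<..<z} \<inter> E - ({y} \<inter> E))"
    using assms(3) by (intro measure_Diff_null_set[symmetric]) auto
  also have "\<dots> = measure lborel ({x<..<y} \<inter> E) + measure lborel ({y<..<z} \<inter> E)"
    unfolding eq using fmeasurable_Int_interval[OF assms(3)]
    by (subst measure_Un2) (auto intro!: arg_cong[of _ _ "measure lborel"])
  finally show ?thesis .
qed

lemma slice_bound: "E \<in> sets borel \<Longrightarrow> 0 \<le> t \<Longrightarrow> slice E i t \<le> t"
proof -
  assume E: "E \<in> sets borel" and t: "0 \<le> t"
  have "slice E i t \<le> measure lborel {a (i mod 3)<..<a (i mod 3) + t}"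
    unfolding slice_def using E fmeasurable_Int_interval[of UNIV] by (intro measure_mono_fmeasurable) auto
  thus ?thesis using t by simp
qed

context
  assumes acute: "\<And>i. 0 < c i"
begin

lemma foot_pos: "0 < foot i" "foot i < l i"
proof -
  show "0 < foot i" using l_pos acute by (simp add: foot_def)
  have "0 < l (i + 1) * c (i + 1)" using l_pos acute by simp
  thus "foot i < l i" using foot_compl[of i] by linarith
qed

text \<open>The branch before the foot reverses orientation and has slope - 1 / c i. The initial
  segment thus corresponds to a final segment of side \<open>i + 2\<close>, written as a difference
  of slices, and taking preimages multiplies lengths by \<open>c i\<close>.\<close>

lemma slice_back:
  assumes i: "i < 3" and t: "0 \<le> t" "t \<le> foot i" and E: "E \<in> sets borel"
  shows "slice (preim E) i t = c i * (slice E (i + 2) (l (i + 2)) - slice E (i + 2) (l (i + 2) - t / c i))"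
proof (cases "t = 0")
  case False
  hence t0: "a i < a i + t" using t by simp
  define A where "A = a ((i + 2) mod 3)"
  define s where "s = l (i + 2) - t / c i"
  have s: "0 \<le> s" "s \<le> l (i + 2)"
    using t acute[of i] by (auto simp: s_def foot_def pos_divide_le_eq)
  have c0: "- 1 / c i \<noteq> 0" using acute[of i] by simp
  have "f x = (- 1 / c i) * x + (A + l (i + 2) + a i / c i)" if "x \<in> {a i<..<a i + t}" for x
  proof -
    have "x \<in> side i" "x < a i + foot i" using that t foot_pos[of i] by (auto simp: side_def)
    thus ?thesis using back_side(2)[OF i] by (simp add: A_def diff_divide_distrib)
  qed
  note p = pushes_affine(4)[OF t0 c0 this]
  have e1: "(- 1 / c i) * a i + (A + l (i + 2) + a i / c i) = A + l (i + 2)" by simp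
  have e2: "(- 1 / c i) * (a i + t) + (A + l (i + 2) + a i / c i) = A + s"
    by (simp add: s_def add_divide_distrib)
  have e3: "1 / \<bar>- 1 / c i\<bar> = c i" using acute[of i] by simp
  have p: "pushes f (a i) (a i + t) [(c i, A + s, A + l (i + 2))]"
  proof -
    have "min (A + l (i + 2)) (A + s) = A + s" "max (A + l (i + 2)) (A + s) = A + l (i + 2)" using s(2) by auto
    thus ?thesis using p unfolding e1 e2 e3 by simp
  qed
  have "{a i<..<a i + t} \<inter> preim E = {a i<..<a i + t} \<inter> f -` E"
    using side_subset[OF i] t foot_pos[of i] unfolding preim_def side_def by fastforce
  hence "slice (preim E) i t = measure lborel ({a i<..<a i + t} \<inter> f -` E)" using i by (simp add: slice_def)
  also have "\<dots> = c i * measure lborel ({A + s<..<A + l (i + 2)} \<inter> E)"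
    using p E by (simp add: pushes_def)
  also have "measure lborel ({A + s<..<A + l (i + 2)} \<inter> E) = slice E (i + 2) (l (i + 2)) - slice E (i + 2) s"
    using measure_split[of A "A + s" "A + l (i + 2)" E] s E by (simp add: slice_def A_def)
  finally show ?thesis by (simp add: s_def)
qed simp

text \<open>Up to the foot, side \<open>i + 2\<close> is covered completely; beyond the foot the
  other branch covers side \<open>i + 1\<close>, beginning at its far end.\<close>

lemma slice_forward:
  assumes i: "i < 3" and t: "foot i \<le> t" "t \<le> l i" and E: "E \<in> sets borel"
  shows "slice (preim E) i t = c i * slice E (i + 2) (l (i + 2)) +
     c (i + 1) * (slice E (i + 1) (l (i + 1)) - slice E (i + 1) ((l i - t) / c (i + 1)))"
proof -
  have full: "slice (preim E) i (foot i) = c i * slice E (i + 2) (l (i + 2))"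
  proof -
    have "l (i + 2) - foot i / c i = 0" using acute[of i] by (simp add: foot_def)
    thus ?thesis using slice_back[OF i _ _ E, of "foot i"] foot_pos(1)[of i] by simp
  qed
  define A where "A = a ((i + 1) mod 3)"
  have l0: "(l i - foot i) / c (i + 1) = l (i + 1)" unfolding foot_compl using acute[of "i + 1"] by simp
  show ?thesis
  proof (cases "t = foot i")
    case True
    thus ?thesis using full l0 by simp
  next
    case False
    hence t0: "a i + foot i < a i + t" using t by simp
    define s where "s = (l i - t) / c (i + 1)"
    have "(l i - t) / c (i + 1) \<le> (l i - foot i) / c (i + 1)"
      using t acute[of "i + 1"] by (intro divide_right_mono) auto
    hence s: "0 \<le> s" "s \<le> l (i + 1)" using t acute[of "i + 1"] unfolding l0 by (auto simp: s_def)
    have c0: "- 1 / c (i + 1) \<noteq> 0" using acute[of "i + 1"] by simp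
    have "f x = (- 1 / c (i + 1)) * x + (A + (l i + a i) / c (i + 1))" if "x \<in> {a i + foot i<..<a i + t}" for x
    proof -
      have "x \<in> side i" "a i + foot i < x" using that t foot_pos[of i] by (auto simp: side_def)
      thus ?thesis using forward_side(2)[OF i] by (simp add: A_def diff_divide_distrib add_divide_distrib)
    qed
    note p = pushes_affine(4)[OF t0 c0 this]
    have "(- 1 / c (i + 1)) * (a i + foot i) + (A + (l i + a i) / c (i + 1)) = A + (l i - foot i) / c (i + 1)"
      by (simp add: add_divide_distrib diff_divide_distrib)
    hence e1: "(- 1 / c (i + 1)) * (a i + foot i) + (A + (l i + a i) / c (i + 1)) = A + l (i + 1)"
      by (simp only: l0)
    have e2: "(- 1 / c (i + 1)) * (a i + t) + (A + (l i + a i) / c (i + 1)) = A + s"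
      by (simp add: s_def add_divide_distrib diff_divide_distrib)
    have e3: "1 / \<bar>- 1 / c (i + 1)\<bar> = c (i + 1)" using acute[of "i + 1"] by simp
    have p: "pushes f (a i + foot i) (a i + t) [(c (i + 1), A + s, A + l (i + 1))]"
    proof -
      have "min (A + l (i + 1)) (A + s) = A + s" "max (A + l (i + 1)) (A + s) = A + l (i + 1)" using s(2) by auto
      thus ?thesis using p unfolding e1 e2 e3 by simp
    qed
    have "slice (preim E) i t = slice (preim E) i (foot i) + measure lborel ({a i + foot i<..<a i + t} \<inter> preim E)"
      using measure_split[of "a i" "a i + foot i" "a i + t" "preim E"] t foot_pos[of i] i preim_sets[OF E]
      by (simp add: slice_def)
    also have "{a i + foot i<..<a i + t} \<inter> preim E = {a i + foot i<..<a i + t} \<inter> f -` E"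
      using side_subset[OF i] t foot_pos[of i] unfolding preim_def side_def by fastforce
    also have "measure lborel \<dots> = c (i + 1) * measure lborel ({A + s<..<A + l (i + 1)} \<inter> E)"
      using p E by (simp add: pushes_def)
    also have "measure lborel ({A + s<..<A + l (i + 1)} \<inter> E) = slice E (i + 1) (l (i + 1)) - slice E (i + 1) s"
      using measure_split[of A "A + s" "A + l (i + 1)" E] s E by (simp add: slice_def A_def)
    finally show ?thesis using full by (simp add: s_def)
  qed
qed

lemma slice_full:
  assumes "i < 3" "E \<in> sets borel"
  shows "slice (preim E) i (l i) = c i * slice E (i + 2) (l (i + 2)) + c (i + 1) * slice E (i + 1) (l (i + 1))"
  using slice_forward[OF assms(1) _ _ assms(2), of "l i"] foot_pos(2)[of i] by simp

text \<open>If side \<open>i\<close> has weight \<open>(l i)\<^sup>2\<close>, then the mass that moves between the sides \<open>i\<close> and \<open>i + 2\<close> at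
  their common vertex is \<open>l i * l (i + 2) * c i\<close> in both directions. So these weights are
  stationary.\<close>

definition total :: real where "total = (\<Sum>i<3. (l i)\<^sup>2)"

definition mass :: "real set \<Rightarrow> real" where "mass E = (\<Sum>i<3. l i / total * slice E i (l i))"

definition acute_measure :: "real measure" where
  "acute_measure = density leb (\<lambda>x. ennreal (\<Sum>i<3. l i / total * indicator (side i) x))"

lemma total_pos: "0 < total"
  unfolding total_def by (intro sum_pos zero_less_power l_pos) (auto simp: lessThan_empty_iff)

lemma sum_3: "(\<Sum>i<3. g i) = g 0 + g 1 + g (2::nat)" for g :: "nat \<Rightarrow> real"
  by (simp add: eval_nat_numeral)

lemma slice_mod3: "slice E 3 t = slice E 0 t" "slice E 4 t = slice E 1 t"
  using slice_mod[of E 3 t] slice_mod[of E 4 t] by simp_all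

lemma mass_preim:
  assumes E: "E \<in> sets borel"
  shows "mass (preim E) = mass E"
proof -
  define h where "h i = slice E i (l i)" for i
  have h: "h 3 = h 0" "h 4 = h 1" by (simp_all add: h_def slice_mod3 l_mod')
  have s: "slice (preim E) i (l i) = c i * h (i + 2) + c (i + 1) * h (i + 1)" if "i < 3" for i
    unfolding h_def by (rule slice_full[OF that E])
  have s': "slice (preim E) 0 (l 0) = c 0 * h 2 + c 1 * h 1" "slice (preim E) 1 (l 1) = c 1 * h 3 + c 2 * h 2"
    "slice (preim E) 2 (l 2) = c 2 * h 4 + c 3 * h 3"
    using s[of 0] s[of 1] s[of 2] by (simp_all add: eval_nat_numeral)
  have eqs: "l 0 = l 2 * c 0 + l 1 * c 1" "l 1 = l 0 * c 1 + l 2 * c 2" "l 2 = l 1 * c 2 + l 0 * c 0"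
    using l_eq[of 0] l_eq[of 1] l_eq[of 2] l_mod' by (simp_all add: eval_nat_numeral)
  \<comment> \<open>Collected by \<open>h j\<close>, each coefficient is the right-hand side of the
    projection formula for side \<open>j\<close>.\<close>
  have "(\<Sum>i<3. l i * slice (preim E) i (l i)) =
      h 0 * (l 2 * c 0 + l 1 * c 1) + h 1 * (l 0 * c 1 + l 2 * c 2) + h 2 * (l 1 * c 2 + l 0 * c 0)"
    unfolding sum_3 s' h l_mod'(4) by (simp add: algebra_simps)
  also have "\<dots> = (\<Sum>i<3. l i * h i)" unfolding eqs[symmetric] by (simp add: sum_3 algebra_simps)
  finally have "(\<Sum>i<3. l i * slice (preim E) i (l i)) / total = (\<Sum>i<3. l i * h i) / total" by simp
  thus ?thesis by (simp add: mass_def h_def sum_divide_distrib)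
qed

lemma side_leb: "i < 3 \<Longrightarrow> side i \<in> sets leb"
  using side_subset[of i] by (auto simp: leb_simps side_def)

lemma acute_density_measurable:
  "(\<lambda>x. ennreal (\<Sum>i<3. l i / total * indicator (side i) x)) \<in> borel_measurable leb"
proof -
  have "(\<lambda>x. \<Sum>i<3. l i / total * indicator (side i) x :: real) \<in> borel_measurable leb"
    using side_leb by (intro borel_measurable_sum borel_measurable_times borel_measurable_const
      borel_measurable_indicator) auto
  thus ?thesis by (rule measurable_compose[OF _ measurable_ennreal])
qed

lemma emeasure_acute:
  assumes E: "E \<in> sets leb"
  shows "emeasure acute_measure E = ennreal (mass E)"
proof -
  have w: "0 \<le> l i / total" for i using l_pos[of i] total_pos by simp
  have [measurable]: "E \<in> sets leb" by (rule E)
  note meas = acute_density_measurable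
  have "emeasure acute_measure E =
      (\<integral>\<^sup>+x. ennreal (\<Sum>i<3. l i / total * indicator (side i) x) * indicator E x \<partial>leb)"
    unfolding acute_measure_def by (rule emeasure_density[OF meas E])
  also have "\<dots> = (\<integral>\<^sup>+x. (\<Sum>i<3. ennreal (l i / total) * indicator (side i \<inter> E) x) \<partial>leb)"
  proof (rule nn_integral_cong)
    fix x
    have "ennreal (\<Sum>i<3. l i / total * indicator (side i) x) = (\<Sum>i<3. ennreal (l i / total) * indicator (side i) x)"
    proof -
      have "ennreal (\<Sum>i<3. l i / total * indicator (side i) x) = (\<Sum>i<3. ennreal (l i / total * indicator (side i) x))"
        by (rule sum_ennreal[symmetric]) (intro mult_nonneg_nonneg w, simp)
      also have "\<dots> = (\<Sum>i<3. ennreal (l i / total) * indicator (side i) x)"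
        using w by (intro sum.cong refl) (simp only: ennreal_mult ennreal_indicator indicator_pos_le)
      finally show ?thesis .
    qed
    thus "ennreal (\<Sum>i<3. l i / total * indicator (side i) x) * indicator E x =
        (\<Sum>i<3. ennreal (l i / total) * indicator (side i \<inter> E) x)"
      by (simp only: sum_distrib_right indicator_inter_arith mult.assoc)
  qed
  also have "\<dots> = (\<Sum>i<3. ennreal (l i / total) * emeasure leb (side i \<inter> E))"
    using side_leb E by (subst nn_integral_sum) (auto simp: nn_integral_cmult_indicator)
  also have "\<dots> = (\<Sum>i<3. ennreal (l i / total * slice E i (l i)))"
  proof (rule sum.cong)
    fix i :: nat assume "i \<in> {..<3}"
    hence i: "i < 3" by simp
    interpret finite_measure leb by (rule leb_simps(2))
    have "emeasure leb (side i \<inter> E) = ennreal (slice E i (l i))"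
      using i leb_simps(4)[of "side i \<inter> E"] side_subset[OF i]
      by (auto simp: emeasure_eq_measure slice_def side_def)
    thus "ennreal (l i / total) * emeasure leb (side i \<inter> E) = ennreal (l i / total * slice E i (l i))"
      by (simp only: ennreal_mult[OF w slice_nonneg])
  qed simp
  also have "\<dots> = ennreal (mass E)"
    unfolding mass_def by (intro sum_ennreal mult_nonneg_nonneg w slice_nonneg)
  finally show ?thesis .
qed

lemma acute_measure_simps:
  "sets acute_measure = sets leb" "space acute_measure = {0..a 3}"
  "E \<in> sets leb \<Longrightarrow> measure acute_measure E = mass E"
proof -
  show "sets acute_measure = sets leb" "space acute_measure = {0..a 3}"
    by (simp_all add: acute_measure_def leb_simps(1))
  have "0 \<le> mass E" unfolding mass_def using l_pos total_pos
    by (intro sum_nonneg mult_nonneg_nonneg divide_nonneg_pos) (auto simp: slice_def less_imp_le)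
  thus "E \<in> sets leb \<Longrightarrow> measure acute_measure E = mass E"
    by (simp add: measure_def emeasure_acute)
qed

lemma slice_space: "i < 3 \<Longrightarrow> 0 \<le> t \<Longrightarrow> t \<le> l i \<Longrightarrow> slice {0..a 3} i t = t"
proof -
  assume i: "i < 3" and t: "0 \<le> t" "t \<le> l i"
  have "{a i<..<a i + t} \<inter> {0..a 3} = {a i<..<a i + t}" using side_subset[OF i] t by (fastforce simp: side_def)
  thus ?thesis using i t by (simp add: slice_def)
qed

lemma mass_space: "mass {0..a 3} = 1"
proof -
  have "mass {0..a 3} = (\<Sum>i<3. (l i)\<^sup>2) / total"
    using slice_space[OF _ less_imp_le[OF l_pos] order_refl]
    by (simp add: mass_def sum_divide_distrib power2_eq_square)
  thus ?thesis using total_pos by (simp add: total_def)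
qed

text \<open>The density is positive on every side, so Lebesgue measure is absolutely continuous with
  respect to \<open>acute_measure\<close>. This carries ergodicity over to Lebesgue measure and
  gives full support.\<close>

lemma mass_zero_imp_null:
  assumes E: "E \<in> sets leb" "mass E = 0"
  shows "measure leb E = 0"
proof -
  have "l i / total * slice E i (l i) = 0" if "i < 3" for i
    using E(2) that l_pos total_pos unfolding mass_def
    by (subst (asm) sum_nonneg_eq_0_iff) (auto simp: slice_def less_imp_le)
  hence z: "slice E i (l i) = 0" if "i < 3" for i
    using that l_pos[of i] total_pos by force
  have s: "side i \<inter> E \<in> null_sets lborel" if "i < 3" for i
    using z[OF that] that E(1) fmeasurable_Int_interval[of E "a i" "a i + l i"]
    by (auto simp: slice_def side_def null_sets_def emeasure_eq_measure2 leb_simps)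
  have "(\<Union>i\<in>{..<3}. side i \<inter> E) \<in> null_sets lborel"
    by (rule null_sets_UN') (use s in auto)
  moreover have "a ` {..3} \<in> null_sets lborel" by (rule finite_imp_null_set_lborel) simp
  ultimately have "(\<Union>i<3. side i \<inter> E) \<union> a ` {..3} \<in> null_sets lborel" by (rule null_sets.Un)
  moreover have "E \<subseteq> (\<Union>i<3. side i \<inter> E) \<union> a ` {..3}"
  proof
    fix x assume x: "x \<in> E"
    show "x \<in> (\<Union>i<3. side i \<inter> E) \<union> a ` {..3}"
    proof (cases "x \<in> a ` {..3}")
      case False
      have "x \<in> {0..a 3}" using x E(1) by (auto simp: leb_simps)
      then obtain i where "i < 3" "x \<in> side i" using point_cases False by blast
      thus ?thesis using x by blast
    qed blast
  qed
  moreover have "E \<in> sets lborel" using E(1) by (simp add: leb_simps)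
  ultimately have "E \<in> null_sets lborel" by (metis null_sets_subset)
  hence "measure lborel E = 0" by (simp add: measure_def null_sets_def)
  thus ?thesis using E(1) leb_simps(4)[of E] unfolding leb_simps(3) by simp
qed

lemma acip_acute: "acip {0..a 3} f acute_measure"
  unfolding acip_def
proof (intro conjI)
  show p: "prob_space acute_measure"
    by (rule prob_spaceI) (use emeasure_acute[of "{0..a 3}"] in \<open>simp add: acute_measure_simps leb_simps mass_space\<close>)
  show "sets acute_measure = sets (restrict_space borel {0..a 3})"
    unfolding acute_measure_simps(1) by (rule leb_sets)
  show "absolutely_continuous leb acute_measure"
    unfolding acute_measure_def by (rule absolutely_continuousI_density[OF acute_density_measurable])
  have fm: "f \<in> measurable acute_measure acute_measure"
    using measurable measurable_cong_sets[OF acute_measure_simps(1) acute_measure_simps(1)] by blast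
  have "distr acute_measure acute_measure f = acute_measure"
  proof (rule measure_eqI)
    fix A assume "A \<in> sets (distr acute_measure acute_measure f)"
    hence A: "A \<in> sets leb" by (simp add: acute_measure_simps(1))
    have "preim A \<in> sets leb" using A preim_sets[of A] by (auto simp: leb_simps preim_def)
    moreover have "f -` A \<inter> space acute_measure = preim A" by (auto simp: preim_def acute_measure_simps)
    ultimately show "emeasure (distr acute_measure acute_measure f) A = emeasure acute_measure A"
      using A mass_preim[of A] emeasure_distr[OF fm, of A]
      by (simp add: acute_measure_simps(1) emeasure_acute leb_simps)
  qed simp
  thus "invariant_under f acute_measure" using fm by (simp add: invariant_under_def)
qed

section \<open>Convergence of the iterates, mixing and full support\<close>

definition iter :: "real set \<Rightarrow> nat \<Rightarrow> real set" where
  "iter A n = {0..a 3} \<inter> (f ^^ n) -` A"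

lemma iter_Suc: "iter A (Suc n) = preim (iter A n)"
  using maps by (auto simp: iter_def preim_def funpow_swap1)

lemma iter_leb: "A \<in> sets leb \<Longrightarrow> iter A n \<in> sets leb"
proof (induction n)
  case 0
  thus ?case by (auto simp: iter_def leb_simps)
next
  case (Suc n)
  thus ?case using preim_sets[of "iter A n"] by (auto simp: iter_Suc leb_simps preim_def)
qed

lemma mass_iter: "A \<in> sets leb \<Longrightarrow> mass (iter A n) = mass A"
proof (induction n)
  case 0
  hence "iter A 0 = A" by (auto simp: iter_def leb_simps)
  thus ?case by simp
next
  case (Suc n)
  have "iter A n \<in> sets borel" using iter_leb[OF Suc.prems] by (simp add: leb_simps)
  thus ?case using Suc mass_preim by (simp add: iter_Suc)
qed

lemma len_le: "i < 3 \<Longrightarrow> l i \<le> a 3"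
  unfolding less_3 using l_pos[of 0] l_pos[of 1] l_pos[of 2] by (auto simp: a_simps)

text \<open>The relative deviations \<open>y\<close> on the three sides satisfy an averaging
  recursion whose coefficients sum to 1 by the projection formula. Invariance of \<open>mass\<close>
  says that their mean with the weights \<open>(l i)\<^sup>2\<close> is zero.\<close>

lemma slice_full_limit:
  assumes A: "A \<in> sets leb" and i: "i < 3"
  shows "(\<lambda>n. slice (iter A n) i (l i) - l i * mass A) \<longlonglongrightarrow> 0"
proof -
  define y where "y n i = (slice (iter A n) i (l i) - l i * mass A) / l i" for n i
  define p where "p i = l (i + 1) * c (i + 1) / l i" for i
  have p1: "1 - p i = l (i + 2) * c i / l i" for i
    using l_pos[of i] l_eq[of i] by (simp add: p_def field_simps)
  have y_mod: "y n (i mod 3) = y n i" for n i by (simp add: y_def slice_mod l_mod)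
  have sl: "slice (iter A n) i (l i) = l i * (y n i + mass A)" for n i
    using l_pos[of i] by (simp add: y_def field_simps)
  have "(\<lambda>n. y n i) \<longlonglongrightarrow> 0"
  proof (rule three_state_average_null[where p = p and w = "\<lambda>i. (l i)\<^sup>2", OF _ _ _ _ i])
    fix n i :: nat assume i: "i < 3"
    have "iter A n \<in> sets borel" using iter_leb[OF A] by (simp add: leb_simps)
    hence "slice (iter A (Suc n)) i (l i) = c i * (l (i + 2) * (y n (i + 2) + mass A)) +
        c (i + 1) * (l (i + 1) * (y n (i + 1) + mass A))"
      using slice_full[OF i] by (simp only: iter_Suc sl)
    also have "\<dots> = l (i + 2) * c i * y n (i + 2) + l (i + 1) * c (i + 1) * y n (i + 1)
        + (l (i + 2) * c i + l (i + 1) * c (i + 1)) * mass A" by (simp add: algebra_simps)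
    also have "l (i + 2) * c i + l (i + 1) * c (i + 1) = l i" by (rule l_eq[symmetric])
    finally have "y (Suc n) i = (l (i + 2) * c i * y n (i + 2) + l (i + 1) * c (i + 1) * y n (i + 1)) / l i"
      by (simp add: y_def)
    thus "y (Suc n) i = p i * y n ((i + 1) mod 3) + (1 - p i) * y n ((i + 2) mod 3)"
      unfolding y_mod p1 by (simp add: p_def add_divide_distrib)
  next
    fix i :: nat assume "i < 3"
    have "0 < p i" using l_pos acute by (simp add: p_def)
    moreover have "0 < 1 - p i" unfolding p1 using l_pos acute by simp
    ultimately show "0 < p i \<and> p i < 1" by simp
    show "0 < (l i)\<^sup>2" by (rule zero_less_power[OF l_pos])
  next
    fix n
    have "(\<Sum>i<3. (l i)\<^sup>2 * y n i) = (\<Sum>i<3. l i * slice (iter A n) i (l i)) - total * mass A"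
    proof -
      have "(l i)\<^sup>2 * y n i = l i * slice (iter A n) i (l i) - (l i)\<^sup>2 * mass A" for i
        using l_pos[of i] by (simp add: y_def power2_eq_square field_simps)
      thus ?thesis by (simp add: total_def sum_subtractf sum_distrib_right)
    qed
    also have "(\<Sum>i<3. l i * slice (iter A n) i (l i)) = total * mass (iter A n)"
      using total_pos by (simp add: mass_def sum_distrib_left)
    finally show "(\<Sum>i<3. (l i)\<^sup>2 * y n i) = 0" using mass_iter[OF A] by simp
  qed
  hence "(\<lambda>n. l i * y n i) \<longlonglongrightarrow> l i * 0" by (intro tendsto_mult_left)
  thus ?thesis using l_pos[of i] by (simp add: y_def)
qed

text \<open>The image of an initial segment of a side under a branch is a final segment of a side.
  So the error of an initial segment is bounded, up to errors of full sides, by a contraction of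
  the errors one step earlier.\<close>

lemma slice_limit:
  assumes A: "A \<in> sets leb" and i: "i < 3" and t: "0 \<le> t" "t \<le> l i"
  shows "(\<lambda>n. slice (iter A n) i t) \<longlonglongrightarrow> t * mass A"
proof -
  interpret P: prob_space acute_measure using acip_acute by (simp add: acip_def)
  have mA: "0 \<le> mass A" "mass A \<le> 1"
    using P.prob_le_1[of A] measure_nonneg[of acute_measure A] acute_measure_simps(3)[OF A] by auto
  have Ab: "iter A n \<in> sets borel" for n using iter_leb[OF A] by (simp add: leb_simps)
  define g where "g n i t = slice (iter A n) i t - t * mass A" for n i t
  define k where "k = 1 / rate"
  have k: "0 \<le> k" "k < 1" using rate_gt_1 by (auto simp: k_def)
  have ck: "c i \<le> k" for i using c_le_rate[of i] by (simp add: k_def)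
  define e where "e n = (\<Sum>j<3. \<bar>g n j (l j)\<bar>)" for n
  have g_mod: "g n (j mod 3) s = g n j s" for n j s by (simp add: g_def slice_mod)
  have e: "\<bar>g n j (l j)\<bar> \<le> e n" for n j
  proof -
    have "\<bar>g n (j mod 3) (l (j mod 3))\<bar> \<le> e n" unfolding e_def by (rule member_le_sum) auto
    thus ?thesis by (simp only: g_mod l_mod)
  qed
  have "(\<lambda>n. e n) \<longlonglongrightarrow> (\<Sum>j<3::nat. \<bar>0\<bar>)"
    unfolding e_def g_def using slice_full_limit[OF A] by (intro tendsto_sum tendsto_rabs) auto
  hence e0: "(\<lambda>n. 2 * e n) \<longlonglongrightarrow> 0" using tendsto_mult_right_zero by fastforce
  \<comment> \<open>A majorant for the errors of all segments: the start \<open>a 3\<close> bounds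
    every side length, and the term \<open>2 * e n\<close> covers the two full sides that occur in
    the forward case.\<close>
  define d where "d = rec_nat (a 3) (\<lambda>n x. k * x + 2 * e n)"
  have d: "d 0 = a 3" "\<And>n. d (Suc n) = k * d n + 2 * e n" by (simp_all add: d_def)
  have e_nn: "0 \<le> e n" for n by (simp add: e_def)
  have bound: "\<bar>g n i t\<bar> \<le> d n" if "i < 3" "0 \<le> t" "t \<le> l i" for n i t
    using that
  proof (induction n arbitrary: i t)
    case 0
    have "0 \<le> slice (iter A 0) i t" by (simp add: slice_def)
    moreover have "slice (iter A 0) i t \<le> t" by (rule slice_bound[OF Ab 0(2)])
    moreover have "0 \<le> t * mass A" "t * mass A \<le> t" using 0 mA by (auto intro: mult_left_le)
    ultimately have "\<bar>g 0 i t\<bar> \<le> t" by (simp add: g_def)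
    thus ?case using 0 len_le[of i] by (simp add: d)
  next
    case (Suc n)
    have IH: "\<bar>g n j s\<bar> \<le> d n" if "0 \<le> s" "s \<le> l j" for j s
      using Suc.IH[of "j mod 3" s] that by (simp add: g_mod l_mod)
    have d_nn: "0 \<le> d n" using IH[of 0 0] l_pos[of 0] by (simp add: g_def)
    have ckm: "c j * x \<le> k * x" if "0 \<le> x" for j x using ck[of j] that by (rule mult_right_mono)
    show ?case
    proof (cases "t \<le> foot i")
      case True
      define s where "s = l (i + 2) - t / c i"
      have s: "0 \<le> s" "s \<le> l (i + 2)"
        using True Suc.prems acute[of i] by (auto simp: s_def foot_def pos_divide_le_eq)
      have "g (Suc n) i t = c i * (g n (i + 2) (l (i + 2)) - g n (i + 2) s)"
      proof -
        have "c i * (l (i + 2) - s) = t" using acute[of i] by (simp add: s_def)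
        hence "t * mass A = c i * (l (i + 2) * mass A - s * mass A)"
          by (metis left_diff_distrib mult.assoc)
        moreover have "slice (preim (iter A n)) i t =
            c i * (slice (iter A n) (i + 2) (l (i + 2)) - slice (iter A n) (i + 2) s)"
          unfolding s_def by (rule slice_back[OF Suc.prems(1,2) True Ab])
        ultimately show ?thesis by (simp add: g_def iter_Suc algebra_simps)
      qed
      hence "\<bar>g (Suc n) i t\<bar> = c i * \<bar>g n (i + 2) (l (i + 2)) - g n (i + 2) s\<bar>"
        using acute[of i] by (simp add: abs_mult)
      also have "\<dots> \<le> c i * (e n + d n)"
        using e[of n "i + 2"] IH[OF s] acute[of i] by (intro mult_left_mono) auto
      also have "\<dots> \<le> k * (e n + d n)" using e_nn d_nn by (intro ckm) simp
      also have "\<dots> \<le> k * d n + 2 * e n"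
        using mult_right_mono[of k 1 "e n"] k e_nn[of n] by (simp add: distrib_left)
      finally show ?thesis by (simp add: d)
    next
      case False
      define s where "s = (l i - t) / c (i + 1)"
      have "l i - t \<le> l (i + 1) * c (i + 1)" using False foot_compl[of i] by simp
      hence s: "0 \<le> s" "s \<le> l (i + 1)"
        using Suc.prems acute[of "i + 1"] by (auto simp: s_def pos_divide_le_eq)
      have "g (Suc n) i t = c i * g n (i + 2) (l (i + 2)) + c (i + 1) * (g n (i + 1) (l (i + 1)) - g n (i + 1) s)"
      proof -
        have "c (i + 1) * s = l i - t" using acute[of "i + 1"] by (simp add: s_def)
        hence "c i * l (i + 2) + c (i + 1) * (l (i + 1) - s) = t"
          using l_eq[of i] by (simp add: algebra_simps)
        hence "t * mass A = c i * (l (i + 2) * mass A) + c (i + 1) * (l (i + 1) * mass A - s * mass A)"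
          by (metis left_diff_distrib distrib_right mult.assoc)
        moreover have "slice (preim (iter A n)) i t = c i * slice (iter A n) (i + 2) (l (i + 2)) +
            c (i + 1) * (slice (iter A n) (i + 1) (l (i + 1)) - slice (iter A n) (i + 1) s)"
          unfolding s_def by (rule slice_forward[OF Suc.prems(1) _ Suc.prems(3) Ab]) (use False in simp)
        ultimately show ?thesis by (simp add: g_def iter_Suc algebra_simps)
      qed
      hence "\<bar>g (Suc n) i t\<bar> \<le> c i * \<bar>g n (i + 2) (l (i + 2))\<bar> +
          c (i + 1) * \<bar>g n (i + 1) (l (i + 1)) - g n (i + 1) s\<bar>"
        using acute[of i] acute[of "i + 1"] abs_triangle_ineq[of "c i * g n (i + 2) (l (i + 2))"
          "c (i + 1) * (g n (i + 1) (l (i + 1)) - g n (i + 1) s)"] by (simp add: abs_mult)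
      also have "\<dots> \<le> c i * e n + c (i + 1) * (e n + d n)"
        using e[of n "i + 2"] e[of n "i + 1"] IH[OF s] acute[of i] acute[of "i + 1"]
        by (intro add_mono mult_left_mono) auto
      also have "\<dots> \<le> k * e n + k * (e n + d n)" using e_nn d_nn by (intro add_mono ckm) auto
      also have "\<dots> \<le> k * d n + 2 * e n"
        using mult_right_mono[of k 1 "e n"] k e_nn[of n] by (simp add: distrib_left)
      finally show ?thesis by (simp add: d)
    qed
  qed
  have "d \<longlonglongrightarrow> 0"
  proof (rule null_of_contraction[OF k _ _ e0])
    show "0 \<le> d n" for n using bound[of 0 0 n] l_pos[of 0] by (simp add: g_def)
  qed (simp add: d)
  moreover have "\<forall>\<^sub>F n in sequentially. norm (g n i t) \<le> d n"
    using bound[OF i t] by (intro always_eventually allI) simp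
  ultimately have "(\<lambda>n. g n i t) \<longlonglongrightarrow> 0" by (rule Lim_null_comparison[rotated])
  thus ?thesis by (simp add: g_def LIM_zero_iff)
qed

lemma slice_atMost:
  assumes "i < 3" "E \<in> sets borel"
  shows "slice (E \<inter> {..x}) i (l i) = slice E i (max 0 (min (l i) (x - a i)))"
  unfolding slice_def
proof (rule measure_eq_AE)
  have "AE z in lborel. z \<noteq> x" by (rule AE_lborel_singleton)
  thus "AE z in lborel. z \<in> {a (i mod 3)<..<a (i mod 3) + l i} \<inter> (E \<inter> {..x}) \<longleftrightarrow>
      z \<in> {a (i mod 3)<..<a (i mod 3) + max 0 (min (l i) (x - a i))} \<inter> E"
    by eventually_elim (use assms(1) in \<open>auto simp: max_def min_def split: if_splits\<close>)
qed (use assms in auto)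

text \<open>For fixed \<open>A\<close>, the sets \<open>D\<close> with the required limit of
  correlations contain the half-lines, by convergence on initial segments, and are closed under
  complements and disjoint countable unions. Half-lines are stable under intersection and generate
  the Borel sets.\<close>

lemma mixing_acute: "mixing f acute_measure"
  unfolding mixing_def
proof (intro conjI ballI)
  show "invariant_under f acute_measure" using acip_acute by (simp add: acip_def)
  interpret P: prob_space acute_measure using acip_acute by (simp add: acip_def)
  fix A B assume A: "A \<in> sets acute_measure" and B: "B \<in> sets acute_measure"
  have Al: "A \<in> sets leb" and Bl: "B \<in> sets leb" using A B by (simp_all add: acute_measure_simps(1))
  note iA = iter_leb[OF Al]
  have X: "{0..a 3} \<in> sets leb" by (simp add: leb_simps)
  have sub: "E \<inter> D \<in> sets leb" if "E \<in> sets leb" "D \<in> sets borel" for E D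
    using that by (auto simp: leb_simps)
  have key: "(\<lambda>n. measure acute_measure (iter A n \<inter> D)) \<longlonglongrightarrow> mass A * measure acute_measure ({0..a 3} \<inter> D)"
    if "D \<in> sets borel" for D
  proof -
    have D: "D \<in> sigma_sets UNIV (range (\<lambda>x::real. {..x}))"
      using that unfolding borel_eq_atMost by simp
    have gen: "E \<in> sets borel" if "E \<in> sigma_sets UNIV (range (\<lambda>x::real. {..x}))" for E
      using that unfolding borel_eq_atMost by simp
    have "Int_stable (range (\<lambda>x::real. {..x}))" by (auto simp: Int_stable_def)
    moreover have "range (\<lambda>x::real. {..x}) \<subseteq> Pow UNIV" by simp
    ultimately show ?thesis using D
    proof (induction rule: sigma_sets_induct_disjoint)
      case (basic E)
      then obtain x where x: "E = {..x}" by auto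
      define s where "s i = max 0 (min (l i) (x - a i))" for i
      have s: "0 \<le> s i" "s i \<le> l i" for i using l_pos[of i] by (auto simp: s_def)
      have m: "measure acute_measure (C \<inter> E) = (\<Sum>i<3. l i / total * slice C i (s i))" if "C \<in> sets leb" for C
      proof -
        have "measure acute_measure (C \<inter> E) = mass (C \<inter> E)"
          using sub[OF that, of E] x by (intro acute_measure_simps(3)) simp
        also have "\<dots> = (\<Sum>i<3. l i / total * slice C i (s i))"
          unfolding mass_def x s_def using that by (intro sum.cong refl) (simp add: slice_atMost leb_simps)
        finally show ?thesis .
      qed
      have "(\<lambda>n. \<Sum>i<3. l i / total * slice (iter A n) i (s i)) \<longlonglongrightarrow> (\<Sum>i<3. l i / total * (s i * mass A))"
        using slice_limit[OF Al _ s] by (intro tendsto_sum tendsto_mult_left) auto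
      also have "(\<Sum>i<3. l i / total * (s i * mass A)) = mass A * (\<Sum>i<3. l i / total * slice {0..a 3} i (s i))"
        using slice_space[OF _ s] by (simp add: sum_distrib_left mult.commute mult.left_commute)
      finally show ?case unfolding m[OF iA] m[OF X] .
    next
      case empty
      show ?case by simp
    next
      case (compl E)
      have E: "E \<in> sets borel" by (rule gen[OF compl(1)])
      have m: "measure acute_measure (C \<inter> (UNIV - E)) = mass C - measure acute_measure (C \<inter> E)"
        if "C \<in> sets leb" for C
      proof -
        have "C \<inter> (UNIV - E) = C - C \<inter> E" by auto
        thus ?thesis
          using that sub[OF that E] acute_measure_simps(3)[OF that]
          by (simp add: P.finite_measure_Diff acute_measure_simps(1))
      qed
      have "(\<lambda>n. mass A - measure acute_measure (iter A n \<inter> E)) \<longlonglongrightarrow>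
          mass A - mass A * measure acute_measure ({0..a 3} \<inter> E)"
        by (intro tendsto_diff tendsto_const compl(2))
      thus ?case unfolding m[OF iA] m[OF X] mass_iter[OF Al] mass_space by (simp add: right_diff_distrib)
    next
      case (union E)
      have E: "E k \<in> sets borel" for k using union(2) gen by auto
      have sm: "(\<lambda>k. measure acute_measure (C \<inter> E k)) sums measure acute_measure (C \<inter> (\<Union>k. E k))"
        if "C \<in> sets leb" for C
      proof -
        have "C \<inter> (\<Union>k. E k) = (\<Union>k. C \<inter> E k)" by auto
        moreover have "range (\<lambda>k. C \<inter> E k) \<subseteq> sets acute_measure"
          using sub[OF that E] by (auto simp: acute_measure_simps(1))
        moreover have "disjoint_family (\<lambda>k. C \<inter> E k)"
          using union(1) by (auto simp: disjoint_family_on_def)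
        ultimately show ?thesis using P.finite_measure_UNION[of "\<lambda>k. C \<inter> E k"] by (simp only:)
      qed
      \<comment> \<open>The masses of the sets \<open>E k\<close> are summable and dominate the
        terms for all \<open>n\<close>, which permits the limit inside the series.\<close>
      have mono: "measure acute_measure (iter A n \<inter> E k) \<le> measure acute_measure ({0..a 3} \<inter> E k)" for n k
        using sub[OF X E] by (intro P.finite_measure_mono) (auto simp: iter_def acute_measure_simps(1))
      have "(\<lambda>n. \<Sum>k. measure acute_measure (iter A n \<inter> E k)) \<longlonglongrightarrow>
          (\<Sum>k. mass A * measure acute_measure ({0..a 3} \<inter> E k))"
        using tannerys_theorem[of "\<lambda>k n. measure acute_measure (iter A n \<inter> E k)"
          "\<lambda>k. mass A * measure acute_measure ({0..a 3} \<inter> E k)" sequentially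
          "\<lambda>k. measure acute_measure ({0..a 3} \<inter> E k)"] union(3) mono sm[OF X]
        by (simp add: sums_iff case_prod_unfold)
      moreover have "(\<Sum>k. mass A * measure acute_measure ({0..a 3} \<inter> E k)) =
          mass A * measure acute_measure ({0..a 3} \<inter> (\<Union>k. E k))"
        using sums_mult[OF sm[OF X]] by (simp add: sums_iff)
      moreover have "(\<Sum>k. measure acute_measure (iter A n \<inter> E k)) = measure acute_measure (iter A n \<inter> (\<Union>k. E k))" for n
        using sm[OF iA] by (simp add: sums_iff)
      ultimately show ?case by simp
    qed
  qed
  have "B \<in> sets borel" "B \<subseteq> {0..a 3}" using Bl by (auto simp: leb_simps)
  hence "(f ^^ n) -` A \<inter> B = iter A n \<inter> B" "{0..a 3} \<inter> B = B" for n by (auto simp: iter_def)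
  thus "(\<lambda>n. measure acute_measure ((f ^^ n) -` A \<inter> B)) \<longlonglongrightarrow> measure acute_measure A * measure acute_measure B"
    using key[OF \<open>B \<in> sets borel\<close>] acute_measure_simps(3)[OF Al] by simp
qed

text \<open>Mixing applied to \<open>A\<close> and itself gives x = x * x for the mass of
  \<open>A\<close>, and null sets of \<open>acute_measure\<close> are Lebesgue null.\<close>

lemma acute_lebesgue_ergodic:
  assumes A: "A \<in> sets leb" "f -` A \<inter> space leb = A"
  shows "measure leb A = 0 \<or> measure leb (space leb - A) = 0"
proof -
  interpret P: prob_space acute_measure using acip_acute by (simp add: acip_def)
  have inv: "(f ^^ n) -` A \<inter> {0..a 3} = A" for n
  proof (induction n)
    case 0
    show ?case using A(1) by (auto simp: leb_simps)
  next
    case (Suc n)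
    have "(f ^^ Suc n) -` A \<inter> {0..a 3} = f -` ((f ^^ n) -` A \<inter> {0..a 3}) \<inter> {0..a 3}"
      using maps by (auto simp: funpow_swap1)
    also have "\<dots> = A" using A(2) unfolding Suc leb_simps(1) .
    finally show ?case .
  qed
  have As: "A \<in> sets acute_measure" using A(1) by (simp add: acute_measure_simps)
  have "A \<subseteq> {0..a 3}" using A(1) by (simp add: leb_simps)
  hence eq: "(f ^^ n) -` A \<inter> A = A" for n using inv[of n] by blast
  have "(\<lambda>n. measure acute_measure ((f ^^ n) -` A \<inter> A)) \<longlonglongrightarrow> measure acute_measure A * measure acute_measure A"
    using mixing_acute As unfolding mixing_def by blast
  hence "(\<lambda>n::nat. measure acute_measure A) \<longlonglongrightarrow> measure acute_measure A * measure acute_measure A"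
    unfolding eq .
  hence "measure acute_measure A = measure acute_measure A * measure acute_measure A"
    by (rule LIMSEQ_unique[OF tendsto_const])
  hence "measure acute_measure A * (measure acute_measure A - 1) = 0"
    unfolding right_diff_distrib by linarith
  hence "measure acute_measure A = 0 \<or> measure acute_measure A = 1" by simp
  moreover have "measure acute_measure (space leb - A) = 1 - measure acute_measure A"
    using P.prob_compl[OF As] by (simp add: acute_measure_simps leb_simps)
  moreover have cs: "space leb - A \<in> sets leb" using A(1) by (rule sets.compl_sets)
  ultimately have "mass A = 0 \<or> mass (space leb - A) = 0"
    unfolding acute_measure_simps(3)[OF A(1)] acute_measure_simps(3)[OF cs] by auto
  thus ?thesis using mass_zero_imp_null[OF A(1)] mass_zero_imp_null[OF cs] by blast
qed

lemma acute_unique_ergodic_acip: "\<exists>!\<mu>. acip {0..a 3} f \<mu> \<and> ergodic f \<mu>"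
  by (rule unique_ergodic_acip[OF acute_lebesgue_ergodic])

lemma acip_eq_acute_measure:
  assumes "acip {0..a 3} f \<mu>"
  shows "\<mu> = acute_measure"
proof -
  have facts: "prob_space \<nu>" "sets \<nu> = sets leb" "absolutely_continuous leb \<nu>" "invariant_under f \<nu>"
    if "acip {0..a 3} f \<nu>" for \<nu>
    using that unfolding acip_def leb_sets by blast+
  show ?thesis
    by (rule acip_unique_of_nonsingular_ergodic[OF leb_simps(2) acute_lebesgue_ergodic
      facts[OF assms] facts[OF acip_acute]])
qed

lemma support_acute: "measure_support acute_measure = {0..a 3}"
proof
  show "measure_support acute_measure \<subseteq> {0..a 3}"
    by (auto simp: measure_support_def acute_measure_simps)
  show "{0..a 3} \<subseteq> measure_support acute_measure"
  proof
    fix x assume x: "x \<in> {0..a 3}"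
    have "emeasure acute_measure (U \<inter> {0..a 3}) > 0" if U: "open U" "x \<in> U" for U
    proof (rule ccontr)
      assume "\<not> ?thesis"
      hence z: "emeasure acute_measure (U \<inter> {0..a 3}) = 0" by simp
      have s: "U \<inter> {0..a 3} \<in> sets leb" using U by (simp add: leb_simps)
      hence "mass (U \<inter> {0..a 3}) = 0"
        using z acute_measure_simps(3)[OF s] by (simp add: measure_def)
      hence null: "measure lborel (U \<inter> {0..a 3}) = 0"
        using mass_zero_imp_null[OF s] by (simp add: leb_simps)
      obtain r where r: "r > 0" "ball x r \<subseteq> U" using U open_contains_ball by blast
      define p where "p = max 0 (x - r)"
      define q where "q = min (a 3) (x + r)"
      have "0 < a 3" by (rule L_pos)
      hence pq: "p < q" using x r(1) by (auto simp: p_def q_def)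
      have "{p<..<q} \<subseteq> U \<inter> {0..a 3}"
      proof
        fix z assume "z \<in> {p<..<q}"
        hence "z \<in> ball x r" "z \<in> {0..a 3}" by (auto simp: p_def q_def dist_real_def)
        thus "z \<in> U \<inter> {0..a 3}" using r(2) by blast
      qed
      hence "measure lborel {p<..<q} \<le> measure lborel (U \<inter> {0..a 3})"
        using s fmeasurable_subset_interval[of "U \<inter> {0..a 3}" 0 "a 3"]
        by (intro measure_mono_fmeasurable) (auto simp: leb_simps)
      thus False using null pq by simp
    qed
    thus "x \<in> measure_support acute_measure"
      using x by (auto simp: measure_support_def acute_measure_simps)
  qed
qed

end

end

section \<open>The theorem for triangles\<close>

context triangle
begin

lemma slap_model:
  assumes "slap_map [A, B, C] \<psi>"
  shows "slap_model len cosine arc \<psi>"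
proof
  have length: "length [A, B, C] = 3" by simp
  have V_mod: "V (i mod 3) = V i" "V (i mod 3 + k) = V (i + k)" for i k
    by (simp_all only: vertex_def length mod_add_left_eq mod_mod_trivial)
  show len_mod: "len (i mod 3) = len i" for i
    unfolding len_def Suc_eq_plus1 V_mod ..
  have "len ((i mod 3 + 2) mod 3) = len ((i + 2) mod 3)" for i by (simp only: mod_add_left_eq)
  hence "len (i mod 3 + 2) = len (i + 2)" for i by (simp only: len_mod)
  thus "cosine (i mod 3) = cosine i" for i unfolding cosine_def V_mod len_mod by simp
  show "\<psi> x \<in> {0..arc 3}" if "x \<in> {0..arc 3}" for x
    using assms that unfolding slap_map_def perimeter_eq by blast
qed (fact len_pos cosine_abs_less_1 len_eq arc_0 arc_Suc slap_map_formula[OF assms])+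

end

theorem theorem1p2:
  fixes A B C :: "real^2" and \<psi> :: "real \<Rightarrow> real" and L :: real
  assumes "\<not> collinear {A, B, C}"
    and "L = perimeter [A, B, C]"
    and "slap_map [A, B, C] \<psi>"
  shows "(\<exists>!\<mu>. acip {0..L} \<psi> \<mu> \<and> ergodic \<psi> \<mu>) \<and>
    (\<forall>\<mu>. acip {0..L} \<psi> \<mu> \<and> ergodic \<psi> \<mu> \<longrightarrow>
       (acute_triangle A B C \<longrightarrow> mixing \<psi> \<mu> \<and> measure_support \<mu> = {0..L}) \<and>
       (\<not> acute_triangle A B C \<longrightarrow>
          (\<exists>k \<Sigma>. mixing_components \<psi> \<mu> k \<Sigma>) \<and>
          (\<forall>k \<Sigma>. mixing_components \<psi> \<mu> k \<Sigma> \<longrightarrow> even k)))"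
proof -
  interpret T: triangle A B C by unfold_locales (rule assms(1))
  interpret slap_model T.len T.cosine T.arc \<psi> by (rule T.slap_model[OF assms(3)])
  have L: "L = T.arc 3" using assms(2) T.perimeter_eq by simp
  show ?thesis
  proof (cases "acute_triangle A B C")
    case True
    have acute: "0 < T.cosine i" for i
    proof -
      have "i mod 3 = 0 \<or> i mod 3 = 1 \<or> i mod 3 = 2" by linarith
      hence "0 < T.cosine (i mod 3)" using True unfolding T.acute_iff by auto
      thus ?thesis by (simp only: c_mod)
    qed
    have "mixing \<psi> \<mu> \<and> measure_support \<mu> = {0..T.arc 3}" if "acip {0..T.arc 3} \<psi> \<mu>" for \<mu>
      unfolding acip_eq_acute_measure[OF acute that]
      using mixing_acute[OF acute] support_acute[OF acute] by blast
    thus ?thesis using True acute_unique_ergodic_acip[OF acute] unfolding L by blast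
  next
    case False
    then obtain k where k: "k < 3" "T.cosine k \<le> 0"
      unfolding T.acute_iff by (auto simp: not_less intro: that[of 0] that[of 1] that[of 2])
    show ?thesis
      using False obtuse_unique_ergodic_acip[OF k] obtuse_even_period[OF k] ex_mixing_components
      unfolding L by blast
  qed
qed

end
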